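(* Let $d\ge 1$, $T>0$, $\mu\in[2,+\infty]$, and let $s_0,s,s_1,r$ be real numbers with $s_0<s<s_1$ and $r>0$. Write $H^\sigma=H^\sigma(\mathbb{R}^d)$, let $u_0\in H^s$, and set $B_s(u_0,r)=\{v_0\in H^s : \|v_0-u_0\|_{H^s}<r\}$. Let $$\Phi\colon B_s(u_0,r)\to L^\mu((0,T);H^{s_0})$$ be a (possibly nonlinear) map satisfying the following two properties. (H1) (Weak Lipschitz) There exists $C_0>0$ such that for all $v_0,w_0\in B_s(u_0,r)$, $$\|\Phi(v_0)-\Phi(w_0)\|_{L^\mu((0,T);H^{s_0})}\le C_0\|v_0-w_0\|_{H^{s_0}}.$$ (H2) (Tame estimate) There exists $C_1>0$ such that for all $v_0\in H^{+\infty}\cap B_s(u_0,r)$, $$\|\Phi(v_0)\|_{L^\mu((0,T);H^{s_1})}\le C_1\|v_0\|_{H^{s_1}}.$$ Then the following three conclusions hold. (i) (Continuous interpolation) For all $v_0\in B_s(u_0,r)$ one has $\Phi(v_0)\in L^\mu((0,T);H^s)$, and the map $v_0\in B_s(u_0,r)\mapsto \Phi(v_0)\in L^\mu((0,T);H^s)$ is continuous. (ii) (Improved regularity in time) For all $v_0\in B_s(u_0,r)$, $$\sum_{j\ge 0}\|\Delta_j\Phi(v_0)\|_{L^\mu((0,T);H^s)}^2<+\infty .$$ (iii) (Continuity in time) Assume in addition that $\mu=+\infty$ and that, for some $v_0\in B_s(u_0,r)$, $\Phi(v_0)\in C^0([0,T];H^{-\infty})$. Then $\Phi(v_0)\in 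C^0([0,T];H^s)$.
   Context: $H^\sigma(\mathbb{R}^d)$ denotes the usual $L^2$-based Sobolev space, $H^{+\infty}=\bigcap_{\sigma\in\mathbb{R}}H^\sigma$ and $H^{-\infty}=\bigcup_{\sigma\in\mathbb{R}}H^\sigma$. $\Phi(v_0)\in C^0([0,T];H^{-\infty})$ means that $\Phi(v_0)$ is (has a representative which is) continuous from $[0,T]$ into $H^\sigma$ for some $\sigma\in\mathbb{R}$. Littlewood-Paley decomposition: fix $\psi\in C_0^\infty(\mathbb{R}^d;\mathbb{R})$ with $0\le\psi\le1$, $\psi(\xi)=1$ for $|\xi|\le 3/4$, $\psi(\xi)=0$ for $|\xi|\ge1$, such that $\varphi(\xi)=\psi(\xi/2)-\psi(\xi)$ satisfies $0\le \varphi\le 1$ (it is supported in $\{3/4\le|\xi|\le2\}$). Then $1=\psi(\xi)+\sum_{p\ge0}\varphi(2^{-p}\xi)$. The Fourier multipliers $\Delta_j$ (acting in the space variable) are $\Delta_0=\psi(D_x)$ and $\Delta_j=\varphi(2^{-(j-1)}D_x)$ for $j\ge1$, so that $u=\sum_{j\ge0}\Delta_ju$ for every tempered distribution $u$. *)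

theory Defs
  imports "HOL-Analysis.Analysis" "HOL-Probability.Essential_Supremum"
begin

section \<open>Smooth and Schwartz functions\<close>

text \<open>
  \<open>iter_partial [b1, ..., bk] f\<close> is the iterated partial derivative of \<open>f\<close> in the directions
  \<open>b1, ..., bk\<close>. Lists over \<open>Basis\<close> play the role of multi-indices.
\<close>

primrec iter_partial ::
  "'a::euclidean_space list \<Rightarrow> ('a \<Rightarrow> 'b::real_normed_vector) \<Rightarrow> 'a \<Rightarrow> 'b" where
  "iter_partial [] f = f"
| "iter_partial (b # bs) f = (\<lambda>x. frechet_derivative (iter_partial bs f) (at x) b)"

definition smooth :: "('a::euclidean_space \<Rightarrow> 'b::real_normed_vector) \<Rightarrow> bool" where
  "smooth f \<longleftrightarrow> (\<forall>bs\<in>lists Basis. \<forall>x. iter_partial bs f differentiable (at x))"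

definition schwartz :: "('a::euclidean_space \<Rightarrow> complex) \<Rightarrow> bool" where
  "schwartz f \<longleftrightarrow> smooth f \<and>
     (\<forall>bs\<in>lists Basis. \<forall>k::nat. bdd_above (range (\<lambda>x. (1 + norm x) ^ k * norm (iter_partial bs f x))))"

definition schwartz_seminorm :: "nat \<Rightarrow> ('a::euclidean_space \<Rightarrow> complex) \<Rightarrow> real" where
  "schwartz_seminorm N f =
     (\<Sum>bs | bs \<in> lists Basis \<and> length bs \<le> N. SUP x. (1 + norm x) ^ N * norm (iter_partial bs f x))"

lemma finite_multi_indices: "finite {bs. bs \<in> lists (Basis::'a::euclidean_space set) \<and> length bs \<le> N}"
  using finite_lists_length_le[OF finite_Basis, of N] by (simp add: lists_eq_set conj_commute)

lemma schwartz_seminorm_mono: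
  fixes f :: "'a::euclidean_space \<Rightarrow> complex"
  assumes "schwartz f" "M \<le> N"
  shows "schwartz_seminorm M f \<le> schwartz_seminorm N f"
proof -
  let ?p = "\<lambda>k bs. SUP x. (1 + norm x) ^ k * norm (iter_partial bs f x)"
  have bdd: "bdd_above (range (\<lambda>x. (1 + norm x) ^ k * norm (iter_partial bs f x)))"
    if "bs \<in> lists Basis" for k bs
    using assms(1) that by (auto simp: schwartz_def)
  have mono: "?p M bs \<le> ?p N bs" if "bs \<in> lists Basis" for bs
    using assms(2)
    by (intro cSUP_mono bdd that) (auto intro!: exI mult_right_mono power_increasing)
  have nonneg: "0 \<le> ?p N bs" if "bs \<in> lists Basis" for bs
    by (rule cSUP_upper2[OF bdd[OF that], of 0]) auto
  have "schwartz_seminorm M f \<le> (\<Sum>bs | bs \<in> lists Basis \<and> length bs \<le> M. ?p N bs)"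
    unfolding schwartz_seminorm_def by (intro sum_mono mono) auto
  also have "\<dots> \<le> schwartz_seminorm N f"
    unfolding schwartz_seminorm_def using assms(2)
    by (intro sum_mono2 finite_multi_indices nonneg) auto
  finally show ?thesis .
qed


section \<open>Tempered distributions\<close>

text \<open>
  A tempered distribution is a continuous linear functional on the Schwartz space. Functionals are
  set to \<open>0\<close> outside the Schwartz space, so that equality in the type is equality of distributions.
\<close>

definition tempered :: "(('a::euclidean_space \<Rightarrow> complex) \<Rightarrow> complex) \<Rightarrow> bool" where
  "tempered u \<longleftrightarrow>
     (\<forall>f g. schwartz f \<longrightarrow> schwartz g \<longrightarrow> u (\<lambda>x. f x + g x) = u f + u g) \<and>
     (\<forall>c f. schwartz f \<longrightarrow> u (\<lambda>x. c * f x) = c * u f) \<and>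
     (\<exists>C N. \<forall>f. schwartz f \<longrightarrow> norm (u f) \<le> C * schwartz_seminorm N f) \<and>
     (\<forall>f. \<not> schwartz f \<longrightarrow> u f = 0)"

lemma tempered_zero: "tempered (\<lambda>_. 0)"
  by (auto simp: tempered_def intro!: exI[of _ 0])

lemma tempered_bound_nonneg:
  assumes "tempered u"
  obtains C N where "C \<ge> 0" "\<And>f M. schwartz f \<Longrightarrow> N \<le> M \<Longrightarrow> norm (u f) \<le> C * schwartz_seminorm M f"
proof -
  from assms obtain C N where *: "\<And>f. schwartz f \<Longrightarrow> norm (u f) \<le> C * schwartz_seminorm N f"
    by (auto simp: tempered_def)
  have "norm (u f) \<le> \<bar>C\<bar> * schwartz_seminorm M f" if f: "schwartz f" and "N \<le> M" for f M
  proof -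
    have bdd: "bdd_above (range (\<lambda>x. (1 + norm x) ^ N * norm (iter_partial bs f x)))"
      if "bs \<in> lists Basis" for bs
      using f that by (auto simp: schwartz_def)
    have "0 \<le> schwartz_seminorm N f"
      unfolding schwartz_seminorm_def
      by (intro sum_nonneg cSUP_upper2[OF bdd, of _ 0]) auto
    then have "C * schwartz_seminorm N f \<le> \<bar>C\<bar> * schwartz_seminorm N f"
      by (intro mult_right_mono) auto
    also have "\<dots> \<le> \<bar>C\<bar> * schwartz_seminorm M f"
      by (intro mult_left_mono schwartz_seminorm_mono f \<open>N \<le> M\<close>) auto
    finally show ?thesis using *[OF f] by linarith
  qed
  then show ?thesis by (intro that[of "\<bar>C\<bar>" N]) auto
qed

lemma tempered_add:
  assumes u: "tempered u" and v: "tempered v"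
  shows "tempered (\<lambda>f. u f + v f)"
proof -
  obtain C M where C: "\<And>f K. schwartz f \<Longrightarrow> M \<le> K \<Longrightarrow> norm (u f) \<le> C * schwartz_seminorm K f"
    using tempered_bound_nonneg[OF u] by metis
  obtain D N where D: "\<And>f K. schwartz f \<Longrightarrow> N \<le> K \<Longrightarrow> norm (v f) \<le> D * schwartz_seminorm K f"
    using tempered_bound_nonneg[OF v] by metis
  have "norm (u f + v f) \<le> (C + D) * schwartz_seminorm (max M N) f" if "schwartz f" for f
    using norm_triangle_ineq[of "u f" "v f"] C[OF that, of "max M N"] D[OF that, of "max M N"]
    by (simp add: distrib_right)
  then have "\<exists>C N. \<forall>f. schwartz f \<longrightarrow> norm (u f + v f) \<le> C * schwartz_seminorm N f"
    by blast
  then show ?thesis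
    using u v by (auto simp: tempered_def algebra_simps)
qed

lemma tempered_uminus: "tempered u \<Longrightarrow> tempered (\<lambda>f. - u f)"
  by (auto simp: tempered_def)

typedef (overloaded) 'a tempered_distribution =
  "{u :: ('a::euclidean_space \<Rightarrow> complex) \<Rightarrow> complex. tempered u}"
  morphisms td_apply Abs_td
  using tempered_zero by blast

setup_lifting type_definition_tempered_distribution

instantiation tempered_distribution :: (euclidean_space) ab_group_add
begin

lift_definition zero_tempered_distribution :: "'a tempered_distribution" is "\<lambda>_. 0"
  by (rule tempered_zero)

lift_definition plus_tempered_distribution ::
  "'a tempered_distribution \<Rightarrow> 'a tempered_distribution \<Rightarrow> 'a tempered_distribution"
  is "\<lambda>u v f. u f + v f"
  by (rule tempered_add)

lift_definition uminus_tempered_distribution ::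
  "'a tempered_distribution \<Rightarrow> 'a tempered_distribution" is "\<lambda>u f. - u f"
  by (rule tempered_uminus)

lift_definition minus_tempered_distribution ::
  "'a tempered_distribution \<Rightarrow> 'a tempered_distribution \<Rightarrow> 'a tempered_distribution"
  is "\<lambda>u v f. u f - v f"
  using tempered_add[OF _ tempered_uminus] by fastforce

instance
  by standard (transfer, simp add: algebra_simps)+

end

text \<open>
  Operations defined by duality with an operation \<open>A\<close> on test functions: \<open>(dual A u) f = u (A f)\<close>.
  The right-hand side is tempered whenever \<open>A\<close> is linear and continuous from the Schwartz space to
  itself, which is the case in all uses below.
\<close>

definition dual_op ::
  "(('a::euclidean_space \<Rightarrow> complex) \<Rightarrow> ('a \<Rightarrow> complex)) \<Rightarrow> 'a tempered_distribution \<Rightarrow> 'a tempered_distribution"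
  where "dual_op A u = Abs_td (\<lambda>f. if schwartz f then td_apply u (A f) else 0)"


section \<open>Fourier transform and Fourier multipliers\<close>

definition fourier :: "('a::euclidean_space \<Rightarrow> complex) \<Rightarrow> 'a \<Rightarrow> complex" where
  "fourier f \<xi> = (LINT x|lborel. cis (- (x \<bullet> \<xi>)) * f x)"

definition inv_fourier :: "('a::euclidean_space \<Rightarrow> complex) \<Rightarrow> 'a \<Rightarrow> complex" where
  "inv_fourier f x = (LINT \<xi>|lborel. cis (x \<bullet> \<xi>) * f \<xi>) / (2 * pi) ^ DIM('a)"

definition fourier_td :: "'a::euclidean_space tempered_distribution \<Rightarrow> 'a tempered_distribution" where
  "fourier_td = dual_op fourier"

definition inv_fourier_td :: "'a::euclidean_space tempered_distribution \<Rightarrow> 'a tempered_distribution" where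
  "inv_fourier_td = dual_op inv_fourier"

definition mult_td ::
  "('a::euclidean_space \<Rightarrow> real) \<Rightarrow> 'a tempered_distribution \<Rightarrow> 'a tempered_distribution" where
  "mult_td m = dual_op (\<lambda>f x. of_real (m x) * f x)"

text \<open>The Fourier multiplier \<open>m(D)\<close>, for smooth compactly supported \<open>m\<close>.\<close>

definition fourier_multiplier ::
  "('a::euclidean_space \<Rightarrow> real) \<Rightarrow> 'a tempered_distribution \<Rightarrow> 'a tempered_distribution" where
  "fourier_multiplier m u = inv_fourier_td (mult_td m (fourier_td u))"


section \<open>Sobolev spaces\<close>

definition represents ::
  "('a::euclidean_space \<Rightarrow> complex) \<Rightarrow> 'a tempered_distribution \<Rightarrow> bool" where
  "represents g u \<longleftrightarrow> g \<in> borel_measurable lborel \<and>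
     (\<forall>f. schwartz f \<longrightarrow> integrable lborel (\<lambda>x. g x * f x) \<and> td_apply u f = (LINT x|lborel. g x * f x))"

definition sobolev :: "real \<Rightarrow> 'a::euclidean_space tempered_distribution set" where
  "sobolev \<sigma> = {u. \<exists>g. represents g (fourier_td u) \<and>
     integrable lborel (\<lambda>\<xi>. (1 + (norm \<xi>)\<^sup>2) powr \<sigma> * (norm (g \<xi>))\<^sup>2)}"

text \<open>
  The function representing the Fourier transform is unique up to null sets, so the norm does not
  depend on the choice made below. It is meaningful only for \<open>u \<in> sobolev \<sigma>\<close>.
\<close>

definition sobolev_norm :: "real \<Rightarrow> 'a::euclidean_space tempered_distribution \<Rightarrow> real" where
  "sobolev_norm \<sigma> u =
     (let g = (SOME g. represents g (fourier_td u))
      in sqrt (LINT \<xi>|lborel. (1 + (norm \<xi>)\<^sup>2) powr \<sigma> * (norm (g \<xi>))\<^sup>2))"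

definition sobolev_ball ::
  "real \<Rightarrow> 'a::euclidean_space tempered_distribution \<Rightarrow> real \<Rightarrow> 'a tempered_distribution set" where
  "sobolev_ball s u r = {v \<in> sobolev s. sobolev_norm s (v - u) < r}"


section \<open>Sobolev-valued functions of time\<close>

text \<open>Strong (Bochner) measurability: almost everywhere limit of simple functions.\<close>

definition bochner_measurable ::
  "real measure \<Rightarrow> real \<Rightarrow> (real \<Rightarrow> 'a::euclidean_space tempered_distribution) \<Rightarrow> bool" where
  "bochner_measurable M \<sigma> F \<longleftrightarrow>
     (\<exists>S. (\<forall>n::nat. simple_function M (S n) \<and> S n ` space M \<subseteq> sobolev \<sigma>) \<and>
          (AE t in M. F t \<in> sobolev \<sigma> \<and> (\<lambda>n. sobolev_norm \<sigma> (S n t - F t)) \<longlonglongrightarrow> 0))"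

text \<open>
  The space \<open>L\<^sup>\<mu>((0,T); H\<^sup>\<sigma>)\<close>. Its elements are given by representatives; the membership condition
  and the norm are invariant under changes on null sets.
\<close>

definition Lmu_sobolev ::
  "ennreal \<Rightarrow> real \<Rightarrow> real \<Rightarrow> (real \<Rightarrow> 'a::euclidean_space tempered_distribution) set" where
  "Lmu_sobolev \<mu> T \<sigma> =
     {F. bochner_measurable (lebesgue_on {0<..<T}) \<sigma> F \<and>
         (if \<mu> = \<infinity> then esssup (lebesgue_on {0<..<T}) (\<lambda>t. ereal (sobolev_norm \<sigma> (F t))) < \<infinity>
          else integrable (lebesgue_on {0<..<T}) (\<lambda>t. sobolev_norm \<sigma> (F t) powr enn2real \<mu>))}"

definition Lmu_sobolev_norm ::
  "ennreal \<Rightarrow> real \<Rightarrow> real \<Rightarrow> (real \<Rightarrow> 'a::euclidean_space tempered_distribution) \<Rightarrow> real" where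
  "Lmu_sobolev_norm \<mu> T \<sigma> F =
     (if \<mu> = \<infinity> then real_of_ereal (esssup (lebesgue_on {0<..<T}) (\<lambda>t. ereal (sobolev_norm \<sigma> (F t))))
      else (LINT t|lebesgue_on {0<..<T}. sobolev_norm \<sigma> (F t) powr enn2real \<mu>) powr (1 / enn2real \<mu>))"

text \<open>
  \<open>F \<in> C\<^sup>0([0,T]; H\<^sup>\<sigma>)\<close> for a function \<open>F\<close> on \<open>(0,T)\<close> given up to null sets: some
  representative of \<open>F\<close> is continuous on \<open>[0,T]\<close> with values in \<open>H\<^sup>\<sigma>\<close>.
\<close>

definition C0_sobolev ::
  "real \<Rightarrow> real \<Rightarrow> (real \<Rightarrow> 'a::euclidean_space tempered_distribution) set" where
  "C0_sobolev T \<sigma> =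
     {F. \<exists>G. (AE t in lebesgue_on {0<..<T}. G t = F t) \<and>
             (\<forall>t\<in>{0..T}. G t \<in> sobolev \<sigma>) \<and>
             (\<forall>t\<in>{0..T}. ((\<lambda>t'. sobolev_norm \<sigma> (G t' - G t)) \<longlongrightarrow> 0) (at t within {0..T}))}"


section \<open>Littlewood-Paley decomposition\<close>

definition LP_annulus :: "('a::euclidean_space \<Rightarrow> real) \<Rightarrow> 'a \<Rightarrow> real" where
  "LP_annulus \<psi> \<xi> = \<psi> (\<xi> /\<^sub>R 2) - \<psi> \<xi>"

definition LP_cutoff :: "('a::euclidean_space \<Rightarrow> real) \<Rightarrow> bool" where
  "LP_cutoff \<psi> \<longleftrightarrow> smooth \<psi> \<and> (\<forall>\<xi>. 0 \<le> \<psi> \<xi> \<and> \<psi> \<xi> \<le> 1) \<and>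
     (\<forall>\<xi>. norm \<xi> \<le> 3 / 4 \<longrightarrow> \<psi> \<xi> = 1) \<and> (\<forall>\<xi>. 1 \<le> norm \<xi> \<longrightarrow> \<psi> \<xi> = 0) \<and>
     (\<forall>\<xi>. 0 \<le> LP_annulus \<psi> \<xi> \<and> LP_annulus \<psi> \<xi> \<le> 1)"

definition LP_block ::
  "('a::euclidean_space \<Rightarrow> real) \<Rightarrow> nat \<Rightarrow> 'a tempered_distribution \<Rightarrow> 'a tempered_distribution" where
  "LP_block \<psi> j =
     (if j = 0 then fourier_multiplier \<psi>
      else fourier_multiplier (\<lambda>\<xi>. LP_annulus \<psi> (\<xi> /\<^sub>R 2 ^ (j - 1))))"

end

theory Submission imports Defs "HOL-Probability.Probability" begin

text \<open>
  The theorem is a nonlinear interpolation result: \<open>\<Phi>\<close> is Lipschitz in a weak norm and bounded in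
  a strong norm on smooth data, and the conclusion is continuity in between.

  Let \<open>S\<^sub>k v\<close>, formally \<open>lowpass k v\<close>, be the part of \<open>v\<close> at frequencies up to about
  \<open>2\<^sup>k\<close>, and expand
  \<open>\<Phi> v - \<Phi> (S\<^sub>n v)\<close> into the telescoping sum of the increments
  \<open>D\<^sub>k = \<Phi> (S\<^bsub>k+1\<^esub> v) - \<Phi> (S\<^sub>k v)\<close>. The Lipschitz bound controls \<open>D\<^sub>k\<close> at level \<open>s0\<close> by the
  single block \<open>\<Delta>\<^bsub>k+1\<^esub> v\<close>; the tame bound controls it at level \<open>s1\<close> by the blocks of \<open>v\<close> up to
  \<open>k+1\<close>. Localising to output frequency \<open>2\<^sup>j\<close> turns the two levels into a gain
  \<open>2\<^bsup>(s-s0)(j-k-1)\<^esup>\<close> and a gain \<open>2\<^bsup>-(s1-s)(j-k-1)\<^esup>\<close>. The better of the two decays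
  geometrically in \<open>\<bar>j-k-1\<bar>\<close>, so that \<open>\<Delta>\<^sub>j D\<^sub>k\<close> is bounded in \<open>L\<^sup>\<mu> H\<^sup>s\<close> by
  a geometric kernel times an envelope of \<open>(\<parallel>\<Delta>\<^sub>l v\<parallel>)\<^sub>l\<close> (\<open>increment_block\<close>). The envelope is
  square-summable because \<open>v \<in> H\<^sup>s\<close>, and by the Schur test so are the blocks of
  \<open>\<Phi> v - \<Phi> (S\<^sub>n v)\<close> (\<open>tail_blocks\<close>). Those of \<open>\<Phi> (S\<^sub>n v)\<close> decay because this
  function is bounded at level \<open>s1\<close>, and the second conclusion follows.

  Minkowski's inequality in \<open>L\<^bsup>\<mu>/2\<^esup>\<close>, which is where \<open>\<mu> \<ge> 2\<close> enters,
  bounds the \<open>L\<^sup>\<mu> H\<^sup>s\<close> norm by the square sum of the block norms (\<open>Lmu_le_of_blocks\<close>). Hence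
  \<open>\<Phi> v \<in> L\<^sup>\<mu> H\<^sup>s\<close>, with \<open>\<Phi> v - \<Phi> (S\<^sub>n v)\<close> bounded by the tail of the envelope
  (\<open>tail_estimate\<close>).

  For continuity, the envelope of \<open>w\<close> is at most that of \<open>v\<close> plus that of \<open>w - v\<close>, so its tails are
  uniformly small for \<open>w\<close> near \<open>v\<close>. What is left is \<open>\<Phi> (S\<^sub>n w) - \<Phi> (S\<^sub>n v)\<close> for a fixed
  \<open>n\<close>: it is bounded at level \<open>s1\<close> and tends to zero at level \<open>s0\<close>, hence tends to zero at
  level \<open>s\<close> by interpolation (\<open>Phi_continuous\<close>). For \<open>\<mu> = \<infinity>\<close>, a representative that is continuous in
  a weak norm satisfies the essential bounds on its blocks at every time; being square-summable,
  they make the Littlewood-Paley series of increments in time converge uniformly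
  (\<open>C0_sobolev_of_blocks\<close>).

  Sobolev norms are read off from a function representing the Fourier transform.
  To compute with them one needs that the Fourier transform acts continuously on Schwartz functions
  (\<open>schwartz_cont_ft\<close>), Fourier inversion (\<open>ft_inversion\<close>), and uniqueness of the representing
  function (\<open>represents_unique\<close>). After that, the estimates of blocks come down to pointwise inequalities
  between weights on the Fourier side (\<open>sobolev_compare\<close>).
\<close>

section \<open>Iterated partial derivatives\<close>

lemma iter_partial_append: "iter_partial (as @ bs) f = iter_partial as (iter_partial bs f)"
  by (induction as) auto

lemma smooth_differentiable: "smooth f \<Longrightarrow> bs \<in> lists Basis \<Longrightarrow> iter_partial bs f differentiable (at x)"
  by (simp add: smooth_def)

lemma smooth_iter_partial: "smooth f \<Longrightarrow> bs \<in> lists Basis \<Longrightarrow> smooth (iter_partial bs f)"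
  unfolding smooth_def by (simp add: iter_partial_append[symmetric])

lemma iter_partial_step:
  assumes "\<And>x. (iter_partial bs f has_derivative D x) (at x)"
  shows "iter_partial (b # bs) f = (\<lambda>x. D x b)"
proof
  fix x
  have "D x = frechet_derivative (iter_partial bs f) (at x)"
    by (rule frechet_derivative_at[OF assms])
  then show "iter_partial (b # bs) f x = D x b" by simp
qed

lemma smooth_has_derivative:
  assumes "smooth f" "bs \<in> lists Basis"
  shows "(iter_partial bs f has_derivative (\<lambda>h. \<Sum>b\<in>Basis. (h \<bullet> b) *\<^sub>R iter_partial (b # bs) f x)) (at x)"
proof -
  have d: "(iter_partial bs f has_derivative frechet_derivative (iter_partial bs f) (at x)) (at x)"
    using smooth_differentiable[OF assms] frechet_derivative_works by blast
  then have lin: "linear (frechet_derivative (iter_partial bs f) (at x))"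
    by (rule has_derivative_linear)
  have "frechet_derivative (iter_partial bs f) (at x) h = (\<Sum>b\<in>Basis. (h \<bullet> b) *\<^sub>R iter_partial (b # bs) f x)" for h
  proof -
    have "frechet_derivative (iter_partial bs f) (at x) h
      = frechet_derivative (iter_partial bs f) (at x) (\<Sum>b\<in>Basis. (h \<bullet> b) *\<^sub>R b)"
      by (simp add: euclidean_representation)
    also have "\<dots> = (\<Sum>b\<in>Basis. (h \<bullet> b) *\<^sub>R iter_partial (b # bs) f x)"
      by (simp add: linear_sum[OF lin] linear_scale[OF lin])
    finally show ?thesis .
  qed
  then have "frechet_derivative (iter_partial bs f) (at x) = (\<lambda>h. \<Sum>b\<in>Basis. (h \<bullet> b) *\<^sub>R iter_partial (b # bs) f x)"
    by (rule ext)
  with d show ?thesis by (rule subst[rotated])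
qed

lemma iter_partial_of_linear_comp:
  assumes L: "bounded_linear L" and f: "smooth (f :: 'c::euclidean_space \<Rightarrow> _)" and bs: "bs \<in> lists Basis"
  shows "iter_partial bs (\<lambda>x. L (f x)) = (\<lambda>x. L (iter_partial bs f x))"
  using bs
proof (induction bs rule: list.induct)
  case (Cons b bs)
  then have bs: "bs \<in> lists Basis" by auto
  have *: "((\<lambda>x. L (iter_partial bs f x)) has_derivative
    (\<lambda>h. L (\<Sum>b\<in>Basis. (h \<bullet> b) *\<^sub>R iter_partial (b # bs) f x))) (at x)" for x
    by (rule bounded_linear.has_derivative[OF L smooth_has_derivative[OF f bs]])
  show ?case
    using iter_partial_step[of bs "\<lambda>x. L (f x)", unfolded Cons.IH[OF bs], OF *, of b] Cons.prems
    by (auto simp: inner_Basis if_distrib[of "\<lambda>u. u *\<^sub>R _"] cong: if_cong)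
qed simp

lemma smooth_linear_comp:
  assumes L: "bounded_linear L" and f: "smooth (f :: 'c::euclidean_space \<Rightarrow> _)"
  shows "smooth (\<lambda>x. L (f x))"
  unfolding smooth_def
proof (intro ballI allI)
  fix bs :: "'c list" and x assume bs: "bs \<in> lists Basis"
  show "iter_partial bs (\<lambda>x. L (f x)) differentiable at x"
    unfolding iter_partial_of_linear_comp[OF L f bs]
    using bounded_linear.has_derivative[OF L smooth_has_derivative[OF f bs]] unfolding differentiable_def by blast
qed

lemma iter_partial_add:
  assumes f: "smooth f" and g: "smooth g" and bs: "bs \<in> lists Basis"
  shows "iter_partial bs (\<lambda>x. f x + g x) = (\<lambda>x. iter_partial bs f x + iter_partial bs g x)"
  using bs
proof (induction bs rule: list.induct)
  case (Cons b bs)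
  then have bs: "bs \<in> lists Basis" by auto
  note * = has_derivative_add[OF smooth_has_derivative[OF f bs] smooth_has_derivative[OF g bs]]
  show ?case
    using iter_partial_step[of bs "\<lambda>x. f x + g x", unfolded Cons.IH[OF bs], OF *, of b] Cons.prems
    by (auto simp: inner_Basis if_distrib[of "\<lambda>u. u *\<^sub>R _"] cong: if_cong)
qed simp

lemma smooth_add:
  assumes f: "smooth f" and g: "smooth g"
  shows "smooth (\<lambda>x. f x + g x)"
  unfolding smooth_def
  by (auto simp: iter_partial_add[OF f g] intro!: differentiable_add smooth_differentiable f g)

text \<open>
  All ways to distribute the derivatives in a list between the two factors of a product, keeping
  their order: the index set of the Leibniz rule.
\<close>

primrec splits :: "'a list \<Rightarrow> ('a list \<times> 'a list) list" where
  "splits [] = [([], [])]"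
| "splits (b # bs) = map (\<lambda>p. (b # fst p, snd p)) (splits bs) @ map (\<lambda>p. (fst p, b # snd p)) (splits bs)"

lemma splits_set_length:
  assumes "(p, q) \<in> set (splits bs)"
  shows "set p \<subseteq> set bs \<and> set q \<subseteq> set bs \<and> length p \<le> length bs \<and> length q \<le> length bs"
  using assms
proof (induction bs arbitrary: p q)
  case (Cons b bs)
  from Cons.prems consider p' where "p = b # p'" "(p', q) \<in> set (splits bs)"
    | q' where "q = b # q'" "(p, q') \<in> set (splits bs)"
    by (fastforce simp: image_iff)
  then show ?case
  proof cases
    case 1
    show ?thesis using Cons.IH[OF 1(2)] unfolding 1(1) by auto
  next
    case 2
    show ?thesis using Cons.IH[OF 2(2)] unfolding 2(1) by auto
  qed
qed simp

lemma splits_lists: "bs \<in> lists A \<Longrightarrow> (p, q) \<in> set (splits bs) \<Longrightarrow> p \<in> lists A \<and> q \<in> lists A"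
  using splits_set_length[of p q bs] unfolding lists_eq_set by blast

lemma splits_length: "(p, q) \<in> set (splits bs) \<Longrightarrow> length p \<le> length bs \<and> length q \<le> length bs"
  using splits_set_length[of p q bs] by blast

lemma norm_sum_list: "norm (sum_list xs) \<le> sum_list (map norm xs)"
  by (induction xs) (auto intro: norm_triangle_le)

lemma has_derivative_sum_list:
  assumes "\<And>p. p \<in> set ps \<Longrightarrow> (F p has_derivative D p) (at x)"
  shows "((\<lambda>x. \<Sum>p\<leftarrow>ps. F p x) has_derivative (\<lambda>h. \<Sum>p\<leftarrow>ps. D p h)) (at x)"
  using assms by (induction ps) (auto intro!: derivative_eq_intros)

lemma iter_partial_mult:
  fixes f g :: "'a::euclidean_space \<Rightarrow> 'b::real_normed_field"
  assumes f: "smooth f" and g: "smooth g" and bs: "bs \<in> lists Basis"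
  shows "iter_partial bs (\<lambda>x. f x * g x) = (\<lambda>x. \<Sum>p\<leftarrow>splits bs. iter_partial (fst p) f x * iter_partial (snd p) g x)"
    (is "?A bs")
    and "iter_partial bs (\<lambda>x. f x * g x) differentiable (at x)"
proof -
  let ?D = "\<lambda>bs f x h. \<Sum>b\<in>Basis. (h \<bullet> b) *\<^sub>R iter_partial (b # bs) f x"
  have der: "((\<lambda>x. \<Sum>p\<leftarrow>splits bs. iter_partial (fst p) f x * iter_partial (snd p) g x) has_derivative
     (\<lambda>h. \<Sum>p\<leftarrow>splits bs. iter_partial (fst p) f x * ?D (snd p) g x h + ?D (fst p) f x h * iter_partial (snd p) g x)) (at x)"
    if "bs \<in> lists Basis" for bs x
  proof (intro has_derivative_sum_list has_derivative_mult smooth_has_derivative f g)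
    fix p assume "p \<in> set (splits bs)"
    then have "(fst p, snd p) \<in> set (splits bs)" by simp
    from splits_lists[OF that this] show "fst p \<in> lists Basis" "snd p \<in> lists Basis" by auto
  qed
  show eq: "?A bs" using bs
  proof (induction bs rule: list.induct)
    case (Cons b bs)
    then have bs: "bs \<in> lists Basis" and b: "b \<in> Basis" by auto
    have D: "?D p f x b = iter_partial (b # p) f x" for p x and f :: "'a \<Rightarrow> 'b"
      using b by (auto simp: inner_Basis if_distrib[of "\<lambda>u. u *\<^sub>R _"] cong: if_cong)
    have "iter_partial (b # bs) (\<lambda>x. f x * g x) = (\<lambda>x. \<Sum>p\<leftarrow>splits bs.
      iter_partial (fst p) f x * ?D (snd p) g x b + ?D (fst p) f x b * iter_partial (snd p) g x)"
      by (rule iter_partial_step) (unfold Cons.IH[OF bs], rule der[OF bs])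
    then show ?case
      unfolding D by (simp add: case_prod_beta sum_list_addf comp_def add.commute del: iter_partial.simps)
  qed simp
  show "iter_partial bs (\<lambda>x. f x * g x) differentiable (at x)"
    unfolding eq using der[OF bs] unfolding differentiable_def by blast
qed

lemma smooth_mult:
  fixes f g :: "'a::euclidean_space \<Rightarrow> 'b::real_normed_field"
  shows "smooth f \<Longrightarrow> smooth g \<Longrightarrow> smooth (\<lambda>x. f x * g x)"
  unfolding smooth_def[of "\<lambda>x. f x * g x"] using iter_partial_mult(2) by blast

lemma smooth_continuous: "smooth f \<Longrightarrow> continuous_on A f"
  using smooth_differentiable[of f "[]"] 
  by (auto intro!: differentiable_imp_continuous_on differentiable_at_imp_differentiable_on)

section \<open>Continuous operators on the Schwartz space\<close>

lemma schwartzD: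
  assumes "schwartz f"
  shows "smooth f"
    and "bs \<in> lists Basis \<Longrightarrow> bdd_above (range (\<lambda>x. (1 + norm x) ^ k * norm (iter_partial bs f x)))"
  using assms by (auto simp: schwartz_def)

lemma schwartz_seminorm_bound:
  assumes f: "schwartz f" and bs: "bs \<in> lists Basis" "length bs \<le> N" and k: "k \<le> N"
  shows "(1 + norm x) ^ k * norm (iter_partial bs f x) \<le> schwartz_seminorm N f"
proof -
  let ?p = "\<lambda>bs. SUP x. (1 + norm x) ^ N * norm (iter_partial bs f x)"
  have nn: "0 \<le> ?p bs" if "bs \<in> lists Basis" for bs
    by (rule cSUP_upper2[OF schwartzD(2)[OF f that], of 0]) auto
  have "(1 + norm x) ^ k * norm (iter_partial bs f x) \<le> (1 + norm x) ^ N * norm (iter_partial bs f x)"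
    using k by (intro mult_right_mono power_increasing) auto
  also have "\<dots> \<le> ?p bs"
    by (rule cSUP_upper[OF _ schwartzD(2)[OF f bs(1)]]) auto
  also have "\<dots> \<le> schwartz_seminorm N f"
    unfolding schwartz_seminorm_def using bs nn
    by (intro member_le_sum[of _ _ ?p] finite_multi_indices) auto
  finally show ?thesis .
qed

lemma schwartz_seminorm_nonneg: "schwartz f \<Longrightarrow> 0 \<le> schwartz_seminorm N f"
  using schwartz_seminorm_bound[of f "[]" N 0 0] by (auto intro: order.trans[OF norm_ge_zero])

text \<open>
  The operators whose transpose \<open>dual_op\<close> is a genuine operation on tempered distributions: outside
  this class \<open>dual_op A u\<close> need not be tempered and \<open>Abs_td\<close> carries no information.
\<close>

definition schwartz_cont :: "(('a::euclidean_space \<Rightarrow> complex) \<Rightarrow> ('a \<Rightarrow> complex)) \<Rightarrow> bool" where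
  "schwartz_cont A \<longleftrightarrow> (\<forall>f. schwartz f \<longrightarrow> schwartz (A f)) \<and>
     (\<forall>f g. schwartz f \<longrightarrow> schwartz g \<longrightarrow> A (\<lambda>x. f x + g x) = (\<lambda>x. A f x + A g x)) \<and>
     (\<forall>c f. schwartz f \<longrightarrow> A (\<lambda>x. c * f x) = (\<lambda>x. c * A f x)) \<and>
     (\<forall>N. \<exists>C\<ge>0. \<exists>M. \<forall>f. schwartz f \<longrightarrow> schwartz_seminorm N (A f) \<le> C * schwartz_seminorm M f)"

lemma schwartz_contD:
  assumes "schwartz_cont A"
  shows "schwartz f \<Longrightarrow> schwartz (A f)"
    and "schwartz f \<Longrightarrow> schwartz g \<Longrightarrow> A (\<lambda>x. f x + g x) = (\<lambda>x. A f x + A g x)"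
    and "schwartz f \<Longrightarrow> A (\<lambda>x. c * f x) = (\<lambda>x. c * A f x)"
    and "\<exists>C\<ge>0. \<exists>M. \<forall>f. schwartz f \<longrightarrow> schwartz_seminorm N (A f) \<le> C * schwartz_seminorm M f"
  using assms unfolding schwartz_cont_def by blast+

text \<open>
  The seminorms are finite sums of suprema, so pointwise bounds of single derivatives suffice; the
  finitely many constants and orders that occur are absorbed into a sum and a maximum.
\<close>

lemma schwartz_contI:
  assumes "\<And>f. schwartz f \<Longrightarrow> smooth (A f)"
    and "\<And>f g. schwartz f \<Longrightarrow> schwartz g \<Longrightarrow> A (\<lambda>x. f x + g x) = (\<lambda>x. A f x + A g x)"
    and "\<And>c f. schwartz f \<Longrightarrow> A (\<lambda>x. c * f x) = (\<lambda>x. c * A f x)"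
    and bd: "\<And>bs k. bs \<in> lists Basis \<Longrightarrow> \<exists>C M. \<forall>f x. schwartz f \<longrightarrow>
      (1 + norm x) ^ k * norm (iter_partial bs (A f) x) \<le> C * schwartz_seminorm M f"
  shows "schwartz_cont A"
proof -
  obtain C M where CM: "\<And>bs k f x. bs \<in> lists Basis \<Longrightarrow> schwartz f \<Longrightarrow>
      (1 + norm x) ^ k * norm (iter_partial bs (A f) x) \<le> C bs k * schwartz_seminorm (M bs k) f"
    using bd by metis
  have "\<exists>C\<ge>0. \<exists>M. \<forall>f. schwartz f \<longrightarrow> schwartz_seminorm N (A f) \<le> C * schwartz_seminorm M f" for N
  proof -
    let ?I = "{bs. bs \<in> lists (Basis::'a set) \<and> length bs \<le> N}"
    define K where "K = Max ((\<lambda>bs. M bs N) ` ?I)"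
    have K: "M bs N \<le> K" if "bs \<in> ?I" for bs
      unfolding K_def using that finite_multi_indices by (intro Max_ge) auto
    have "schwartz_seminorm N (A f) \<le> (\<Sum>bs\<in>?I. \<bar>C bs N\<bar>) * schwartz_seminorm K f" if f: "schwartz f" for f
    proof -
      have "schwartz_seminorm N (A f) \<le> (\<Sum>bs\<in>?I. \<bar>C bs N\<bar> * schwartz_seminorm K f)"
        unfolding schwartz_seminorm_def[of N]
      proof (intro sum_mono cSUP_least)
        fix bs x assume bs: "bs \<in> ?I"
        have "(1 + norm x) ^ N * norm (iter_partial bs (A f) x) \<le> C bs N * schwartz_seminorm (M bs N) f"
          using bs f by (intro CM) auto
        also have "\<dots> \<le> \<bar>C bs N\<bar> * schwartz_seminorm K f"
          using K[OF bs] f by (intro mult_mono schwartz_seminorm_mono schwartz_seminorm_nonneg) auto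
        finally show "(1 + norm x) ^ N * norm (iter_partial bs (A f) x) \<le> \<bar>C bs N\<bar> * schwartz_seminorm K f" .
      qed auto
      then show ?thesis by (simp add: sum_distrib_right)
    qed
    then show ?thesis by (intro exI[of _ "\<Sum>bs\<in>?I. \<bar>C bs N\<bar>"] exI[of _ K] conjI) (auto intro: sum_nonneg)
  qed
  moreover have "schwartz (A f)" if "schwartz f" for f
    unfolding schwartz_def using assms(1)[OF that] CM[OF _ that]
    by (auto intro!: bdd_aboveI2)
  ultimately show ?thesis unfolding schwartz_cont_def using assms(2,3) by blast
qed

lemma schwartz_cont_compose:
  assumes A: "schwartz_cont A" and B: "schwartz_cont B"
  shows "schwartz_cont (\<lambda>f. A (B f))"
proof -
  have "\<exists>C\<ge>0. \<exists>M. \<forall>f. schwartz f \<longrightarrow> schwartz_seminorm N (A (B f)) \<le> C * schwartz_seminorm M f" for N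
  proof -
    obtain C M where C: "C \<ge> 0" "\<And>f. schwartz f \<Longrightarrow> schwartz_seminorm N (A f) \<le> C * schwartz_seminorm M f"
      using schwartz_contD(4)[OF A] by metis
    obtain D K where D: "D \<ge> 0" "\<And>f. schwartz f \<Longrightarrow> schwartz_seminorm M (B f) \<le> D * schwartz_seminorm K f"
      using schwartz_contD(4)[OF B] by metis
    have "schwartz_seminorm N (A (B f)) \<le> C * D * schwartz_seminorm K f" if "schwartz f" for f
      using C(2)[OF schwartz_contD(1)[OF B that]] mult_left_mono[OF D(2)[OF that] C(1)] by simp
    then show ?thesis using C(1) D(1) by (intro exI[of _ "C * D"]) auto
  qed
  then show ?thesis
    unfolding schwartz_cont_def
    using schwartz_contD[OF A] schwartz_contD[OF B] by auto
qed

lemma smooth_cmult: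
  fixes f :: "'a::euclidean_space \<Rightarrow> 'b::real_normed_algebra"
  shows "smooth f \<Longrightarrow> smooth (\<lambda>x. c * f x)"
  by (rule smooth_linear_comp[OF bounded_linear_mult_right])

lemma schwartz_add:
  assumes "schwartz f" "schwartz g" shows "schwartz (\<lambda>x. f x + g x)"
proof -
  have "(1 + norm x) ^ k * norm (iter_partial bs (\<lambda>x. f x + g x) x) \<le>
    schwartz_seminorm (max k (length bs)) f + schwartz_seminorm (max k (length bs)) g"
    if "bs \<in> lists Basis" for k bs x
  proof -
    have "(1 + norm x) ^ k * norm (iter_partial bs (\<lambda>x. f x + g x) x) \<le>
      (1 + norm x) ^ k * norm (iter_partial bs f x) + (1 + norm x) ^ k * norm (iter_partial bs g x)"
      unfolding iter_partial_add[OF schwartzD(1)[OF assms(1)] schwartzD(1)[OF assms(2)] that] distrib_left[symmetric]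
      by (intro mult_left_mono norm_triangle_ineq) auto
    then show ?thesis
      using schwartz_seminorm_bound[OF assms(1) that, of "max k (length bs)" k x]
        schwartz_seminorm_bound[OF assms(2) that, of "max k (length bs)" k x] by auto
  qed
  then show ?thesis
    unfolding schwartz_def using smooth_add[OF assms[THEN schwartzD(1)]] by (auto intro!: bdd_aboveI2)
qed

lemma iter_partial_cmult:
  fixes f :: "'a::euclidean_space \<Rightarrow> 'b::real_normed_algebra"
  assumes "smooth f" "bs \<in> lists Basis"
  shows "iter_partial bs (\<lambda>x. c * f x) = (\<lambda>x. c * iter_partial bs f x)"
  by (rule iter_partial_of_linear_comp[OF bounded_linear_mult_right assms])

lemma schwartz_cont_cmult: "schwartz_cont (\<lambda>f x. c * f x)"
proof (rule schwartz_contI)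
  fix bs :: "'a list" and k assume bs: "bs \<in> lists Basis"
  have "(1 + norm x) ^ k * norm (iter_partial bs (\<lambda>x. c * f x) x)
     \<le> norm c * schwartz_seminorm (max k (length bs)) f" if "schwartz f" for f x
    using mult_left_mono[OF schwartz_seminorm_bound[OF that bs, of "max k (length bs)" k x], of "norm c"]
    by (simp add: iter_partial_cmult[OF schwartzD(1)[OF that] bs] norm_mult algebra_simps)
  then show "\<exists>C M. \<forall>f x. schwartz f \<longrightarrow>
      (1 + norm x) ^ k * norm (iter_partial bs (\<lambda>x. c * f x) x) \<le> C * schwartz_seminorm M f"
    by blast
qed (auto simp: algebra_simps intro: smooth_cmult schwartzD)

lemma schwartz_cont_partial:
  assumes b: "b \<in> Basis"
  shows "schwartz_cont (iter_partial [b])"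
proof (rule schwartz_contI)
  fix bs :: "'a list" and k assume bs: "bs \<in> lists Basis"
  have "(1 + norm x) ^ k * norm (iter_partial bs (iter_partial [b] f) x)
     \<le> 1 * schwartz_seminorm (max k (length bs + 1)) f" if "schwartz f" for f x
    unfolding iter_partial_append[symmetric]
    using schwartz_seminorm_bound[OF that, of "bs @ [b]" "max k (length bs + 1)" k x] bs b by simp
  then show "\<exists>C M. \<forall>f x. schwartz f \<longrightarrow>
      (1 + norm x) ^ k * norm (iter_partial bs (iter_partial [b] f) x) \<le> C * schwartz_seminorm M f"
    by blast
next
  fix f g :: "'a \<Rightarrow> complex" assume "schwartz f" "schwartz g"
  then show "iter_partial [b] (\<lambda>x. f x + g x) = (\<lambda>x. iter_partial [b] f x + iter_partial [b] g x)"
    using b by (intro iter_partial_add schwartzD) auto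
next
  fix f :: "'a \<Rightarrow> complex" and c assume "schwartz f"
  then show "iter_partial [b] (\<lambda>x. c * f x) = (\<lambda>x. c * iter_partial [b] f x)"
    using b by (intro iter_partial_cmult schwartzD) auto
qed (use b in \<open>intro smooth_iter_partial schwartzD; auto\<close>)

text \<open>
  By the Leibniz rule a derivative of \<open>g f\<close> is a sum of products; the polynomial growth of the
  derivatives of \<open>g\<close> is paid for by a stronger weight on those of \<open>f\<close>. This covers multiplication by
  coordinates as well as by smooth cutoffs.
\<close>

lemma schwartz_cont_mult:
  fixes g :: "'a::euclidean_space \<Rightarrow> complex"
  assumes g: "smooth g"
    and growth: "\<And>bs. bs \<in> lists Basis \<Longrightarrow> \<exists>C m. \<forall>x. norm (iter_partial bs g x) \<le> C * (1 + norm x) ^ m"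
  shows "schwartz_cont (\<lambda>f x. g x * f x)"
proof (rule schwartz_contI)
  fix bs :: "'a list" and k assume bs: "bs \<in> lists Basis"
  obtain C m where Cm: "\<And>bs x. bs \<in> lists Basis \<Longrightarrow> norm (iter_partial bs g x) \<le> C bs * (1 + norm x) ^ m bs"
    using growth by metis
  have C0: "C bs \<ge> 0" if "bs \<in> lists Basis" for bs
    using order.trans[OF norm_ge_zero Cm[OF that, of 0]] by simp
  define N where "N = (\<Sum>p\<leftarrow>splits bs. m (fst p)) + k + length bs"
  have N: "m (fst p) + k \<le> N" if "p \<in> set (splits bs)" for p
    unfolding N_def using member_le_sum_list[of "m (fst p)" "map (\<lambda>p. m (fst p)) (splits bs)"] that by auto
  have "(1 + norm x) ^ k * norm (iter_partial bs (\<lambda>x. g x * f x) x)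
    \<le> (\<Sum>p\<leftarrow>splits bs. C (fst p)) * schwartz_seminorm N f" if f: "schwartz f" for f x
  proof -
    have "norm (iter_partial bs (\<lambda>x. g x * f x) x) \<le>
       (\<Sum>p\<leftarrow>splits bs. norm (iter_partial (fst p) g x * iter_partial (snd p) f x))"
      unfolding iter_partial_mult(1)[OF g schwartzD(1)[OF f] bs]
      using norm_sum_list[of "map (\<lambda>p. iter_partial (fst p) g x * iter_partial (snd p) f x) (splits bs)"] 
      by (simp add: comp_def)
    then have "(1 + norm x) ^ k * norm (iter_partial bs (\<lambda>x. g x * f x) x) \<le>
      (1 + norm x) ^ k * (\<Sum>p\<leftarrow>splits bs. norm (iter_partial (fst p) g x * iter_partial (snd p) f x))"
      by (intro mult_left_mono) auto
    also have "\<dots> = (\<Sum>p\<leftarrow>splits bs. (1 + norm x) ^ k * norm (iter_partial (fst p) g x * iter_partial (snd p) f x))"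
      by (rule sum_list_const_mult[symmetric])
    also have "\<dots> \<le> (\<Sum>p\<leftarrow>splits bs. C (fst p) * schwartz_seminorm N f)"
    proof (rule sum_list_mono)
      fix p assume p: "p \<in> set (splits bs)"
      then have pq: "(fst p, snd p) \<in> set (splits bs)" by simp
      have l: "fst p \<in> lists Basis" "snd p \<in> lists Basis" "length (snd p) \<le> N"
        using splits_lists[OF bs pq] splits_length[OF pq] by (auto simp: N_def)
      have "(1 + norm x) ^ k * norm (iter_partial (fst p) g x * iter_partial (snd p) f x) \<le>
        (1 + norm x) ^ k * ((C (fst p) * (1 + norm x) ^ m (fst p)) * norm (iter_partial (snd p) f x))"
        unfolding norm_mult by (intro mult_left_mono mult_right_mono Cm l) auto
      also have "\<dots> = C (fst p) * ((1 + norm x) ^ (m (fst p) + k) * norm (iter_partial (snd p) f x))"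
        by (simp add: power_add)
      also have "\<dots> \<le> C (fst p) * schwartz_seminorm N f"
        by (intro mult_left_mono schwartz_seminorm_bound f l N[OF p] C0)
      finally show "(1 + norm x) ^ k * norm (iter_partial (fst p) g x * iter_partial (snd p) f x) \<le> C (fst p) * schwartz_seminorm N f" .
    qed
    also have "\<dots> = (\<Sum>p\<leftarrow>splits bs. C (fst p)) * schwartz_seminorm N f"
      by (rule sum_list_mult_const)
    finally show ?thesis .
  qed
  then show "\<exists>C M. \<forall>f x. schwartz f \<longrightarrow>
      (1 + norm x) ^ k * norm (iter_partial bs (\<lambda>x. g x * f x) x) \<le> C * schwartz_seminorm M f"
    by blast
next
  fix f :: "'a \<Rightarrow> complex" assume "schwartz f"
  then show "smooth (\<lambda>x. g x * f x)" by (intro smooth_mult g schwartzD(1))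
qed (simp_all add: algebra_simps)

lemma iter_partial_Cons_const: "iter_partial (b # bs) (\<lambda>_. c) = (\<lambda>_. 0)"
proof (induction bs arbitrary: b)
  case Nil
  show ?case by (simp add: frechet_derivative_const)
next
  case (Cons a bs)
  show ?case using Cons[of a] by (simp add: frechet_derivative_const)
qed

text \<open>
  Stated for a list that ends in two directions, since the innermost derivatives act first: the last
  direction produces a constant and the one before it annihilates that constant.
\<close>

lemma iter_partial_bounded_linear:
  assumes L: "bounded_linear L"
  shows "iter_partial (bs @ [a, b]) L = (\<lambda>_. 0)" "iter_partial [b] L = (\<lambda>_. L b)"
proof -
  show 1: "iter_partial [b] L = (\<lambda>_. L b)" for b
    using frechet_derivative_at[OF bounded_linear_imp_has_derivative[OF L]] by (auto simp: fun_eq_iff)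
  have "iter_partial (bs @ [a, b]) L = iter_partial (bs @ [a]) (iter_partial [b] L)"
    by (simp only: iter_partial_append[symmetric] append_assoc append_Cons append_Nil)
  also have "\<dots> = (\<lambda>_. 0)"
    unfolding 1 by (cases "bs @ [a]") (auto simp only: iter_partial_Cons_const append_is_Nil_conv)
  finally show "iter_partial (bs @ [a, b]) L = (\<lambda>_. 0)" .
qed

lemma schwartz_cont_coord:
  assumes L: "bounded_linear L"
  shows "schwartz_cont (\<lambda>f x. L x * f x)"
proof (rule schwartz_cont_mult)
  have cases: "bs = [] \<or> (\<exists>b. bs = [b]) \<or> (\<exists>cs a b. bs = cs @ [a, b])" for bs :: "'a list"
    by (metis append.left_neutral append_Cons append_assoc rev_exhaust)
  have d: "iter_partial bs L differentiable at x" for bs x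
    using cases[of bs]
  proof (elim disjE exE)
    assume "bs = []"
    then show ?thesis using bounded_linear_imp_differentiable[OF L] by (simp only: iter_partial.simps)
  next
    fix b assume "bs = [b]"
    then show ?thesis by (simp only: iter_partial_bounded_linear[OF L] differentiable_const)
  next
    fix cs a b assume "bs = cs @ [a, b]"
    then show ?thesis by (simp only: iter_partial_bounded_linear[OF L] differentiable_const)
  qed
  show "smooth L" unfolding smooth_def using d by blast
  fix bs :: "'a list"
  obtain K where K: "\<And>x. norm (L x) \<le> norm x * K" "K > 0" using bounded_linear.pos_bounded[OF L] by blast
  from cases[of bs] show "\<exists>C m. \<forall>x. norm (iter_partial bs L x) \<le> C * (1 + norm x) ^ m"
  proof (elim disjE exE)
    assume bs: "bs = []"
    have "norm (L x) \<le> K * (1 + norm x) ^ 1" for x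
      using K(1)[of x] K(2) by (simp only: distrib_left power_one_right mult.commute[of K "norm x"])
    then show ?thesis unfolding bs iter_partial.simps by blast
  next
    fix b assume bs: "bs = [b]"
    show ?thesis unfolding bs iter_partial_bounded_linear[OF L]
      by (intro exI[of _ "norm (L b)"] exI[of _ 0]) simp
  next
    fix cs a b assume bs: "bs = cs @ [a, b]"
    show ?thesis unfolding bs iter_partial_bounded_linear[OF L]
      by (intro exI[of _ 0]) simp
  qed
qed

section \<open>Integration of rapidly decreasing functions\<close>

text \<open>
  Fubini for functions of product form. It yields integrability of a polynomially decaying function
  and the Fourier transform of the Gaussian from their one-dimensional counterparts.
\<close>

lemma lborel_prod_coordinates:
  fixes f :: "'a::euclidean_space \<Rightarrow> real \<Rightarrow> 'b::{real_normed_field,banach,second_countable_topology}"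
  assumes f: "\<And>b. b \<in> Basis \<Longrightarrow> integrable lborel (f b)"
  shows "integrable lborel (\<lambda>x. \<Prod>b\<in>Basis. f b (x \<bullet> b))"
    and "(LINT x|lborel. (\<Prod>b\<in>Basis. f b (x \<bullet> b))) = (\<Prod>b\<in>Basis. (LINT t|lborel. f b t))"
proof -
  interpret product_sigma_finite "\<lambda>_::'a. lborel::real measure" by standard
  define J where "J = (\<lambda>g::'a \<Rightarrow> real. \<Sum>b\<in>Basis. g b *\<^sub>R b)"
  have J: "J \<in> (\<Pi>\<^sub>M b\<in>Basis. lborel) \<rightarrow>\<^sub>M borel"
    unfolding J_def by measurable
  have eq: "(\<Prod>b\<in>Basis. f b (J g \<bullet> b)) = (\<Prod>b\<in>Basis. f b (g b))" for g
    unfolding J_def by (intro prod.cong) (simp_all add: inner_sum_left_Basis)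
  have m: "f b \<in> borel_measurable borel" if "b \<in> Basis" for b
    using borel_measurable_integrable[OF f[OF that]] by simp
  have meas: "(\<lambda>x::'a. \<Prod>b\<in>Basis. f b (x \<bullet> b)) \<in> borel_measurable borel"
    by (intro borel_measurable_prod measurable_compose[OF _ m]) auto
  have eqd: "(lborel::'a measure) = distr (\<Pi>\<^sub>M b\<in>Basis. lborel) borel J"
    unfolding J_def by (rule lborel_eq)
  show "integrable lborel (\<lambda>x. \<Prod>b\<in>Basis. f b (x \<bullet> b))"
    unfolding eqd by (subst integrable_distr_eq[OF J meas]) (simp only: eq, intro product_integrable_prod f finite_Basis)
  show "(LINT x|lborel. (\<Prod>b\<in>Basis. f b (x \<bullet> b))) = (\<Prod>b\<in>Basis. (LINT t|lborel. f b t))"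
    unfolding eqd by (subst integral_distr[OF J meas]) (simp only: eq, intro product_integral_prod f finite_Basis)
qed

text \<open>
  The exponent is twice the dimension because one factor \<open>(1 + \<bar>x\<bar>)\<^sup>2\<close> per coordinate dominates
  \<open>1 + (x \<bullet> b)\<^sup>2\<close>.
\<close>

definition decay :: "'a::euclidean_space \<Rightarrow> real" where
  "decay x = 1 / (1 + norm x) ^ (2 * DIM('a))"

lemma decay_nonneg: "0 \<le> decay x"
  by (simp add: decay_def)

lemma integrable_decay: "integrable lborel (decay :: 'a::euclidean_space \<Rightarrow> real)"
proof (rule Bochner_Integration.integrable_bound)
  have "integrable lborel (\<lambda>t::real. inverse (1 + t\<^sup>2))"
    using integrable_inverse_1_plus_square by (simp add: set_integrable_def)
  then show "integrable lborel (\<lambda>x::'a. \<Prod>b\<in>Basis. inverse (1 + (x \<bullet> b)\<^sup>2))"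
    by (rule lborel_prod_coordinates(1))
  show "(decay :: 'a \<Rightarrow> real) \<in> borel_measurable lborel"
    unfolding decay_def by measurable
  have "norm (decay x) \<le> norm (\<Prod>b\<in>Basis. inverse (1 + (x \<bullet> b)\<^sup>2))" for x :: 'a
  proof -
    have "decay x = (\<Prod>b\<in>(Basis::'a set). inverse ((1 + norm x)\<^sup>2))"
      by (simp add: decay_def power_mult divide_inverse power_inverse)
    also have "\<dots> \<le> (\<Prod>b\<in>Basis. inverse (1 + (x \<bullet> b)\<^sup>2))"
    proof (intro prod_mono conjI le_imp_inverse_le)
      fix b :: 'a assume "b \<in> Basis"
      have "(x \<bullet> b)\<^sup>2 \<le> (norm x)\<^sup>2"
        using Basis_le_norm[OF \<open>b \<in> Basis\<close>, of x] by (simp add: abs_le_square_iff[symmetric])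
      also have "1 + (norm x)\<^sup>2 \<le> (1 + norm x)\<^sup>2" by (simp add: power2_sum)
      finally show "1 + (x \<bullet> b)\<^sup>2 \<le> (1 + norm x)\<^sup>2" by simp
    qed (auto simp: add_pos_nonneg)
    finally show ?thesis by (simp add: decay_nonneg prod_nonneg)
  qed
  then show "AE x::'a in lborel. norm (decay x) \<le> norm (\<Prod>b\<in>Basis. inverse (1 + (x \<bullet> b)\<^sup>2))"
    by simp
qed

lemma schwartz_measurable: "schwartz f \<Longrightarrow> f \<in> borel_measurable borel"
  by (intro borel_measurable_continuous_onI smooth_continuous schwartzD)

lemma schwartz_decay:
  assumes "schwartz (f::'a::euclidean_space \<Rightarrow> complex)" "bs \<in> lists Basis" "length bs + k + 2 * DIM('a) \<le> N"
  shows "(1 + norm x) ^ k * norm (iter_partial bs f x) \<le> schwartz_seminorm N f * decay x"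
proof -
  have "(1 + norm x) ^ (k + 2 * DIM('a)) * norm (iter_partial bs f x) \<le> schwartz_seminorm N f"
    by (rule schwartz_seminorm_bound) (use assms in auto)
  then show ?thesis
    unfolding decay_def times_divide_eq_right mult_1_right
    by (subst pos_le_divide_eq) (auto simp: power_add mult_ac intro!: zero_less_power add_pos_nonneg)
qed

lemma schwartz_decay0:
  assumes "schwartz (f::'a::euclidean_space \<Rightarrow> complex)"
  shows "norm (f x) \<le> schwartz_seminorm (2 * DIM('a)) f * decay x"
  using schwartz_decay[OF assms, of "[]" 0 "2 * DIM('a)" x] by simp

lemma schwartz_integrable:
  assumes "schwartz (f::'a::euclidean_space \<Rightarrow> complex)"
  shows "integrable lborel f"
proof (rule Bochner_Integration.integrable_bound)
  show "integrable lborel (\<lambda>x. schwartz_seminorm (2 * DIM('a)) f * decay x)"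
    by (intro integrable_mult_right integrable_decay)
  show "AE x in lborel. norm (f x) \<le> norm (schwartz_seminorm (2 * DIM('a)) f * decay x)"
    using schwartz_decay0[OF assms] order.trans[OF _ abs_ge_self] by (intro AE_I2) fastforce
  show "f \<in> borel_measurable lborel" using schwartz_measurable[OF assms] by simp
qed

section \<open>Fourier transform of Schwartz functions\<close>

text \<open>
  The sign \<open>c\<close> treats the Fourier transform (\<open>c = - 1\<close>) and, up to a constant, its inverse
  (\<open>c = 1\<close>) at once.
\<close>

definition ft :: "real \<Rightarrow> ('a::euclidean_space \<Rightarrow> complex) \<Rightarrow> 'a \<Rightarrow> complex" where
  "ft c f \<xi> = (LINT x|lborel. cis (c * (x \<bullet> \<xi>)) * f x)"

lemma fourier_eq_ft: "fourier f = ft (- 1) f"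
  by (auto simp: fourier_def ft_def fun_eq_iff)

lemma inv_fourier_eq_ft: "inv_fourier f = (\<lambda>x::'a::euclidean_space. inverse ((2 * pi) ^ DIM('a)) * ft 1 f x)"
  by (simp add: inv_fourier_def ft_def fun_eq_iff divide_inverse inner_commute)

lemma cis_integrable:
  assumes "integrable lborel f"
  shows "integrable lborel (\<lambda>x. cis (c * (x \<bullet> \<xi>)) * f x)"
proof (rule Bochner_Integration.integrable_bound[OF assms])
  have [measurable]: "f \<in> borel_measurable borel" using borel_measurable_integrable[OF assms] by simp
  have [measurable]: "cis \<in> borel_measurable borel"
    by (intro borel_measurable_continuous_onI continuous_intros)
  show "(\<lambda>x. cis (c * (x \<bullet> \<xi>)) * f x) \<in> borel_measurable lborel" by measurable
qed (simp add: norm_mult)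

lemma ft_add: "schwartz f \<Longrightarrow> schwartz g \<Longrightarrow> ft c (\<lambda>x. f x + g x) = (\<lambda>x. ft c f x + ft c g x)"
  by (auto simp: ft_def fun_eq_iff distrib_left cis_integrable schwartz_integrable)

lemma ft_cmult: "ft c (\<lambda>x. a * f x) = (\<lambda>x. a * ft c f x)"
  by (auto simp: ft_def fun_eq_iff mult.left_commute)

lemma norm_ft_le:
  fixes f :: "'a::euclidean_space \<Rightarrow> complex"
  assumes "schwartz f"
  shows "norm (ft c f \<xi>) \<le> integral\<^sup>L lborel (decay :: 'a \<Rightarrow> real) * schwartz_seminorm (2 * DIM('a)) f"
proof -
  have "norm (ft c f \<xi>) \<le> (LINT x|lborel. norm (cis (c * (x \<bullet> \<xi>)) * f x))"
    unfolding ft_def by (rule integral_norm_bound)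
  also have "\<dots> \<le> (LINT x|lborel. schwartz_seminorm (2 * DIM('a)) f * decay (x::'a))"
    using schwartz_decay0[OF assms] integrable_decay schwartz_integrable[OF assms]
    by (intro integral_mono integrable_norm cis_integrable integrable_mult_right) (auto simp: norm_mult)
  finally show ?thesis by (simp add: mult.commute)
qed

lemma norm_cis_remainder: "norm (cis (a + t) - cis a - \<i> * of_real t * cis a) \<le> t\<^sup>2"
proof -
  have "norm (cis t - (1 + \<i> * of_real t)) \<le> t\<^sup>2 / 2"
    using iexp_approx1[of t 1] by (simp add: cis_conv_exp numeral_2_eq_2)
  moreover have "cis (a + t) - cis a - \<i> * of_real t * cis a = cis a * (cis t - (1 + \<i> * of_real t))"
    by (simp add: cis_mult[symmetric] algebra_simps)
  moreover have "t\<^sup>2 / 2 \<le> t\<^sup>2" by simp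
  ultimately show ?thesis by (simp only: norm_mult norm_cis)
qed

definition coord_mult :: "real \<Rightarrow> 'a::euclidean_space \<Rightarrow> ('a \<Rightarrow> complex) \<Rightarrow> 'a \<Rightarrow> complex" where
  "coord_mult c b f x = \<i> * of_real (c * (x \<bullet> b)) * f x"

lemma schwartz_cont_coord_mult: "schwartz_cont (coord_mult c b)"
proof -
  have "bounded_linear (\<lambda>x. \<i> * of_real (c * (x \<bullet> b)))"
    by (intro bounded_linear_compose[OF bounded_linear_mult_right] bounded_linear_compose[OF bounded_linear_of_real]
        bounded_linear_inner_left)
  from schwartz_cont_coord[OF this] show ?thesis
    unfolding coord_mult_def[abs_def] .
qed

text \<open>
  Differentiation under the integral sign: the second order remainder of the exponential gives an error of order \<open>\<bar>h\<bar>\<^sup>2\<close> times a second moment of \<open>f\<close>.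
\<close>

lemma ft_has_derivative:
  fixes f :: "'a::euclidean_space \<Rightarrow> complex"
  assumes f: "schwartz f"
  shows "(ft c f has_derivative (\<lambda>h. \<Sum>b\<in>Basis. (h \<bullet> b) *\<^sub>R ft c (coord_mult c b f) \<xi>)) (at \<xi>)"
proof -
  define P where "P = schwartz_seminorm (2 * DIM('a) + 2) f"
  define K where "K = c\<^sup>2 * (P * integral\<^sup>L lborel (decay :: 'a \<Rightarrow> real))"
  have cm: "schwartz (coord_mult c b f)" for b
    by (rule schwartz_contD(1)[OF schwartz_cont_coord_mult f])
  note int = cis_integrable[OF schwartz_integrable[OF f]]
  have lin: "(\<Sum>b\<in>Basis. (h \<bullet> b) *\<^sub>R ft c (coord_mult c b f) \<xi>)
    = (LINT x|lborel. \<i> * of_real (c * (x \<bullet> h)) * cis (c * (x \<bullet> \<xi>)) * f x)" (is "?l h = ?r h")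
    and linint: "integrable lborel (\<lambda>x. \<i> * of_real (c * (x \<bullet> h)) * cis (c * (x \<bullet> \<xi>)) * f x)" for h
  proof -
    have e: "\<i> * of_real (c * (x \<bullet> h)) * cis (c * (x \<bullet> \<xi>)) * f x =
       (\<Sum>b\<in>Basis. (h \<bullet> b) *\<^sub>R (cis (c * (x \<bullet> \<xi>)) * coord_mult c b f x))" for x
      unfolding coord_mult_def euclidean_inner[of x h] of_real_mult of_real_sum sum_distrib_left sum_distrib_right
      by (intro sum.cong) (auto simp: scaleR_conv_of_real)
    show "?l h = ?r h" unfolding e ft_def
      by (subst Bochner_Integration.integral_sum)
        (auto intro!: integrable_scaleR_right[OF cis_integrable[OF schwartz_integrable[OF cm]]])
    show "integrable lborel (\<lambda>x. \<i> * of_real (c * (x \<bullet> h)) * cis (c * (x \<bullet> \<xi>)) * f x)"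
      unfolding e
      by (intro Bochner_Integration.integrable_sum integrable_scaleR_right[OF cis_integrable[OF schwartz_integrable[OF cm]]])
  qed
  have bound: "norm (ft c f (\<xi> + h) - ft c f \<xi> - ?l h) \<le> K * (norm h)\<^sup>2" for h
  proof -
    let ?R = "\<lambda>x. cis (c * (x \<bullet> (\<xi> + h))) * f x - cis (c * (x \<bullet> \<xi>)) * f x - \<i> * of_real (c * (x \<bullet> h)) * cis (c * (x \<bullet> \<xi>)) * f x"
    have "norm (ft c f (\<xi> + h) - ft c f \<xi> - ?l h) = norm (LINT x|lborel. ?R x)"
      unfolding lin unfolding ft_def by (simp only: Bochner_Integration.integral_diff int linint Bochner_Integration.integrable_diff)
    also have "\<dots> \<le> (LINT x|lborel. norm (?R x))"
      by (rule integral_norm_bound)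
    also have "\<dots> \<le> (LINT x|lborel. c\<^sup>2 * (norm h)\<^sup>2 * (P * decay (x::'a)))"
    proof (rule integral_mono)
      show "integrable lborel (\<lambda>x. norm (?R x))"
        by (intro integrable_norm Bochner_Integration.integrable_diff int linint)
      show "integrable lborel (\<lambda>x. c\<^sup>2 * (norm h)\<^sup>2 * (P * decay (x::'a)))"
        by (intro integrable_mult_right integrable_decay)
      fix x :: 'a
      have "?R x = (cis (c * (x \<bullet> \<xi>) + c * (x \<bullet> h)) - cis (c * (x \<bullet> \<xi>)) - \<i> * of_real (c * (x \<bullet> h)) * cis (c * (x \<bullet> \<xi>))) * f x"
        by (simp add: inner_add_right algebra_simps)
      then have "norm (?R x) \<le> (c * (x \<bullet> h))\<^sup>2 * norm (f x)"
        using norm_cis_remainder[of "c * (x \<bullet> \<xi>)" "c * (x \<bullet> h)"]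
        by (simp only: norm_mult) (intro mult_right_mono, auto)
      also have "(c * (x \<bullet> h))\<^sup>2 * norm (f x) \<le> (c\<^sup>2 * (norm h)\<^sup>2 * (1 + norm x)\<^sup>2) * norm (f x)"
      proof (rule mult_right_mono)
        have "(x \<bullet> h)\<^sup>2 \<le> (norm x * norm h)\<^sup>2"
          using Cauchy_Schwarz_ineq2[of x h] by (simp add: abs_le_square_iff[symmetric])
        also have "\<dots> \<le> ((1 + norm x) * norm h)\<^sup>2"
          by (intro power_mono mult_right_mono) auto
        finally show "(c * (x \<bullet> h))\<^sup>2 \<le> c\<^sup>2 * (norm h)\<^sup>2 * (1 + norm x)\<^sup>2"
          by (simp add: power_mult_distrib mult_left_mono mult.assoc mult.commute[of "(norm h)\<^sup>2"])
      qed auto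
      also have "\<dots> = c\<^sup>2 * (norm h)\<^sup>2 * ((1 + norm x)\<^sup>2 * norm (f x))" by simp
      also have "\<dots> \<le> c\<^sup>2 * (norm h)\<^sup>2 * (P * decay x)"
        using schwartz_decay[OF f, of "[]" 2 "2 * DIM('a) + 2" x] unfolding P_def
        by (intro mult_left_mono) auto
      finally show "norm (?R x) \<le> c\<^sup>2 * (norm h)\<^sup>2 * (P * decay x)" .
    qed
    also have "\<dots> = K * (norm h)\<^sup>2" by (simp add: K_def)
    finally show ?thesis .
  qed
  show ?thesis
  proof (rule has_derivativeI_sandwich[where e=1 and H="\<lambda>y. K * norm (y - \<xi>)"])
    show "bounded_linear ?l"
      by (intro bounded_linear_sum bounded_linear_scaleR_const bounded_linear_inner_left)
    show "norm (ft c f y - ft c f \<xi> - ?l (y - \<xi>)) / norm (y - \<xi>) \<le> K * norm (y - \<xi>)" if "y \<noteq> \<xi>" for y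
      using bound[of "y - \<xi>"] that by (simp add: divide_simps power2_eq_square mult.assoc)
    show "((\<lambda>y. K * norm (y - \<xi>)) \<longlongrightarrow> 0) (at \<xi>)"
      by (rule tendsto_eq_intros refl | simp)+
  qed simp
qed

primrec coord_mults :: "real \<Rightarrow> 'a::euclidean_space list \<Rightarrow> ('a \<Rightarrow> complex) \<Rightarrow> 'a \<Rightarrow> complex" where
  "coord_mults c [] f = f"
| "coord_mults c (b # bs) f = coord_mult c b (coord_mults c bs f)"

lemma schwartz_cont_id: "schwartz_cont (\<lambda>f. f)"
  using schwartz_cont_cmult[of 1] by simp

lemma schwartz_cont_coord_mults: "schwartz_cont (coord_mults c bs)"
proof (induction bs)
  case Nil
  show ?case using schwartz_cont_id by simp
next
  case (Cons b bs)
  show ?case using schwartz_cont_compose[OF schwartz_cont_coord_mult Cons.IH] by simp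
qed

lemma iter_partial_ft:
  assumes f: "schwartz f" and "bs \<in> lists Basis"
  shows "iter_partial bs (ft c f) = ft c (coord_mults c bs f)"
  using assms(2)
proof (induction bs rule: list.induct)
  case (Cons b bs)
  then have bs: "bs \<in> lists Basis" and b: "b \<in> Basis" by auto
  have "iter_partial (b # bs) (ft c f) = (\<lambda>\<xi>. \<Sum>b'\<in>Basis. (b \<bullet> b') *\<^sub>R ft c (coord_mult c b' (coord_mults c bs f)) \<xi>)"
    by (rule iter_partial_step)
      (unfold Cons.IH[OF bs], rule ft_has_derivative[OF schwartz_contD(1)[OF schwartz_cont_coord_mults f]])
  also have "\<dots> = ft c (coord_mults c (b # bs) f)"
    using b by (auto simp: inner_Basis if_distrib[of "\<lambda>u. u *\<^sub>R _"] cong: if_cong)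
  finally show ?case .
qed simp

lemma smooth_ft:
  assumes f: "schwartz f"
  shows "smooth (ft c f)"
  unfolding smooth_def differentiable_def
proof (intro ballI allI)
  fix bs :: "'a list" and x assume bs: "bs \<in> lists Basis"
  show "\<exists>D. (iter_partial bs (ft c f) has_derivative D) (at x)"
    unfolding iter_partial_ft[OF f bs]
    using ft_has_derivative[OF schwartz_contD(1)[OF schwartz_cont_coord_mults f]] by blast
qed

lemma ft_translate:
  fixes f :: "'a::euclidean_space \<Rightarrow> complex"
  assumes f: "integrable lborel f"
  shows "integrable lborel (\<lambda>x. f (x + v))"
    and "ft c (\<lambda>x. f (x + v)) \<xi> = cis (- (c * (v \<bullet> \<xi>))) * ft c f \<xi>"
proof -
  have m: "f \<in> borel_measurable borel" using borel_measurable_integrable[OF f] by simp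
  have mc: "(\<lambda>x. cis (c * (x \<bullet> \<xi>)) * f x) \<in> borel_measurable borel"
    using borel_measurable_integrable[OF cis_integrable[OF f]] by simp
  have d: "(lborel :: 'a measure) = distr lborel borel ((+) v)" by (rule lborel_distr_plus[symmetric])
  have "integrable (distr lborel borel ((+) v)) f" using f by (subst d[symmetric])
  then show "integrable lborel (\<lambda>x. f (x + v))"
    by (subst (asm) integrable_distr_eq) (use m in \<open>auto simp: add.commute\<close>)
  have "ft c f \<xi> = (LINT x|distr lborel borel ((+) v). cis (c * (x \<bullet> \<xi>)) * f x)"
    unfolding ft_def by (subst d) (rule refl)
  also have "\<dots> = (LINT x|lborel. cis (c * ((v + x) \<bullet> \<xi>)) * f (v + x))"
    by (subst integral_distr) (use mc in auto)
  also have "\<dots> = (LINT x|lborel. cis (c * (v \<bullet> \<xi>)) * (cis (c * (x \<bullet> \<xi>)) * f (x + v)))"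
    by (intro Bochner_Integration.integral_cong refl)
      (simp add: inner_add_left distrib_left cis_mult[symmetric] add.commute)
  also have "\<dots> = cis (c * (v \<bullet> \<xi>)) * ft c (\<lambda>x. f (x + v)) \<xi>"
    by (simp add: ft_def)
  finally show "ft c (\<lambda>x. f (x + v)) \<xi> = cis (- (c * (v \<bullet> \<xi>))) * ft c f \<xi>"
    by (simp add: mult.assoc[symmetric] cis_mult)
qed

lemma schwartz_increment_bound:
  fixes f :: "'a::euclidean_space \<Rightarrow> complex"
  assumes f: "schwartz f" and b: "b \<in> Basis" and t: "0 < t" "t \<le> 1"
  shows "norm ((f (x + t *\<^sub>R b) - f x) /\<^sub>R t)
    \<le> 2 ^ (2 * DIM('a)) * schwartz_seminorm (2 * DIM('a) + 1) f * decay x"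
proof -
  let ?P = "schwartz_seminorm (2 * DIM('a) + 1) f"
  let ?K = "2 ^ (2 * DIM('a)) * ?P * decay x"
  have P: "0 \<le> ?P" by (rule schwartz_seminorm_nonneg[OF f])
  let ?D = "\<lambda>y h. \<Sum>b\<in>Basis. (h \<bullet> b) *\<^sub>R iter_partial [b] f y"
  have Db: "?D y (s *\<^sub>R b) = s *\<^sub>R iter_partial [b] f y" for y s
    using b by (auto simp: inner_Basis if_distrib[of "\<lambda>u. u *\<^sub>R _"] if_distrib[of "\<lambda>u. s * u"] cong: if_cong)
  have der: "((\<lambda>s. f (x + s *\<^sub>R b)) has_derivative (\<lambda>s. s *\<^sub>R iter_partial [b] f (x + s0 *\<^sub>R b))) (at s0 within A)" for s0 A
  proof -
    have 1: "((\<lambda>s. x + s *\<^sub>R b) has_derivative (\<lambda>s. s *\<^sub>R b)) (at s0 within A)"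
      by (auto intro!: derivative_eq_intros)
    have "(f has_derivative ?D (x + s0 *\<^sub>R b)) (at (x + s0 *\<^sub>R b))"
      using smooth_has_derivative[OF schwartzD(1)[OF f], of "[]"] by (simp del: iter_partial.simps(2))
    from has_derivative_compose[OF 1 this] show ?thesis
      unfolding Db .
  qed
  have bd: "norm (iter_partial [b] f (x + s *\<^sub>R b)) \<le> ?K" if s: "s \<in> {0..t}" for s
  proof -
    have "norm x \<le> norm (x + s *\<^sub>R b) + norm (s *\<^sub>R b)"
      using norm_triangle_ineq4[of "x + s *\<^sub>R b" "s *\<^sub>R b"] by simp
    moreover have "norm (s *\<^sub>R b) \<le> 1" using s t b by (simp add: norm_Basis)
    moreover have "u \<le> p + q \<Longrightarrow> q \<le> 1 \<Longrightarrow> 0 \<le> p \<Longrightarrow> 1 + u \<le> 2 * (1 + p)" for u p q :: real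
      by simp
    ultimately have "1 + norm x \<le> 2 * (1 + norm (x + s *\<^sub>R b))"
      using norm_ge_zero by blast
    then have "(1 + norm x) ^ (2 * DIM('a)) \<le> (2 * (1 + norm (x + s *\<^sub>R b))) ^ (2 * DIM('a))"
      by (intro power_mono) auto
    then have dec: "decay (x + s *\<^sub>R b) \<le> 2 ^ (2 * DIM('a)) * decay x"
      unfolding decay_def power_mult_distrib
      by (simp add: divide_simps add_pos_nonneg zero_less_power add_nonneg_eq_0_iff)
    have "norm (iter_partial [b] f (x + s *\<^sub>R b)) \<le> ?P * decay (x + s *\<^sub>R b)"
      using schwartz_decay[OF f, of "[b]" 0 "2 * DIM('a) + 1" "x + s *\<^sub>R b"] b by (simp del: iter_partial.simps)
    also have "\<dots> \<le> ?P * (2 ^ (2 * DIM('a)) * decay x)"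
      by (rule mult_left_mono[OF dec P])
    finally show ?thesis by (simp add: mult_ac)
  qed
  have "norm (f (x + t *\<^sub>R b) - f (x + 0 *\<^sub>R b)) \<le> ?K * norm (t - 0)"
  proof (rule differentiable_bound[of "{0..t}" "\<lambda>s. f (x + s *\<^sub>R b)"])
    fix s assume s: "s \<in> {0..t}"
    show "((\<lambda>s. f (x + s *\<^sub>R b)) has_derivative (\<lambda>r. r *\<^sub>R iter_partial [b] f (x + s *\<^sub>R b))) (at s within {0..t})"
      by (rule der)
    show "onorm (\<lambda>r. r *\<^sub>R iter_partial [b] f (x + s *\<^sub>R b)) \<le> ?K"
      using mult_right_mono[OF bd[OF s] abs_ge_zero] by (intro onorm_le) (simp only: norm_scaleR mult.commute real_norm_def)
  qed (use t in auto)
  then show ?thesis using t by (simp add: divide_simps mult.commute)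
qed

lemma increment_tendsto_partial:
  fixes f :: "'a::euclidean_space \<Rightarrow> complex"
  assumes f: "schwartz f" and b: "b \<in> Basis"
  shows "(\<lambda>n. (f (x + inverse (real (Suc n)) *\<^sub>R b) - f x) /\<^sub>R inverse (real (Suc n))) \<longlonglongrightarrow> iter_partial [b] f x"
proof -
  let ?D = "\<lambda>h. \<Sum>b\<in>Basis. (h \<bullet> b) *\<^sub>R iter_partial [b] f x"
  have Db: "?D (s *\<^sub>R b) = s *\<^sub>R iter_partial [b] f x" for s
    using b by (auto simp: inner_Basis if_distrib[of "\<lambda>u. u *\<^sub>R _"] if_distrib[of "\<lambda>u. s * u"] cong: if_cong)
  have 1: "((\<lambda>s. x + s *\<^sub>R b) has_derivative (\<lambda>s. s *\<^sub>R b)) (at 0)"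
    by (auto intro!: derivative_eq_intros)
  have 2: "(f has_derivative ?D) (at (x + 0 *\<^sub>R b))"
    using smooth_has_derivative[OF schwartzD(1)[OF f], of "[]" x] by (simp del: iter_partial.simps(2))
  have "((\<lambda>s. f (x + s *\<^sub>R b)) has_vector_derivative iter_partial [b] f x) (at 0)"
    using has_derivative_compose[OF 1 2] unfolding Db has_vector_derivative_def .
  then have "((\<lambda>s. norm (f (x + s *\<^sub>R b) - f x - s *\<^sub>R iter_partial [b] f x) / norm s) \<longlongrightarrow> 0) (at 0)"
    unfolding has_vector_derivative_def has_derivative_iff_norm by (simp del: iter_partial.simps)
  then have "((\<lambda>s. norm ((f (x + s *\<^sub>R b) - f x) /\<^sub>R s - iter_partial [b] f x)) \<longlongrightarrow> 0) (at 0)"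
  proof (rule Lim_transform_eventually)
    have "norm (f (x + s *\<^sub>R b) - f x - s *\<^sub>R iter_partial [b] f x) / norm s
      = norm ((f (x + s *\<^sub>R b) - f x) /\<^sub>R s - iter_partial [b] f x)" if "s \<noteq> 0" for s
    proof -
      have "f (x + s *\<^sub>R b) - f x - s *\<^sub>R iter_partial [b] f x
        = s *\<^sub>R ((f (x + s *\<^sub>R b) - f x) /\<^sub>R s - iter_partial [b] f x)"
        using that by (simp add: scaleR_diff_right del: iter_partial.simps)
      then have "norm (f (x + s *\<^sub>R b) - f x - s *\<^sub>R iter_partial [b] f x)
        = \<bar>s\<bar> * norm ((f (x + s *\<^sub>R b) - f x) /\<^sub>R s - iter_partial [b] f x)"
        by (metis norm_scaleR)
      then show ?thesis using that by (simp only: real_norm_def) (simp del: iter_partial.simps)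
    qed
    then show "\<forall>\<^sub>F s in at 0. norm (f (x + s *\<^sub>R b) - f x - s *\<^sub>R iter_partial [b] f x) / norm s
      = norm ((f (x + s *\<^sub>R b) - f x) /\<^sub>R s - iter_partial [b] f x)"
      by (auto simp: eventually_at_filter)
  qed
  then have "((\<lambda>s. (f (x + s *\<^sub>R b) - f x) /\<^sub>R s) \<longlongrightarrow> iter_partial [b] f x) (at 0)"
    by (rule LIM_zero_cancel[OF tendsto_norm_zero_cancel])
  moreover have "filterlim (\<lambda>n. inverse (real (Suc n))) (at 0) sequentially"
    unfolding filterlim_at using LIMSEQ_inverse_real_of_nat by auto
  ultimately show ?thesis by (rule filterlim_compose)
qed

text \<open>
  Integration by parts in disguise: a translate of \<open>f\<close> has the Fourier transform of \<open>f\<close> times a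
  phase, and both sides of this identity are differentiated in the translation parameter, the left one
  by dominated convergence.
\<close>

lemma ft_partial:
  fixes f :: "'a::euclidean_space \<Rightarrow> complex"
  assumes f: "schwartz f" and b: "b \<in> Basis"
  shows "ft c (iter_partial [b] f) \<xi> = - \<i> * of_real (c * (\<xi> \<bullet> b)) * ft c f \<xi>"
proof -
  define t where "t n = inverse (real (Suc n))" for n
  have t: "0 < t n" "t n \<le> 1" for n by (auto simp: t_def divide_simps)
  have t0: "t \<longlonglongrightarrow> 0" unfolding t_def by (rule LIMSEQ_inverse_real_of_nat)
  define S where "S n x = cis (c * (x \<bullet> \<xi>)) * ((f (x + t n *\<^sub>R b) - f x) /\<^sub>R t n)" for n x
  define \<beta> where "\<beta> = c * (\<xi> \<bullet> b)"
  note fi = schwartz_integrable[OF f]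
  have Si: "integral\<^sup>L lborel (S n) = ((cis (- (t n * \<beta>)) - 1) /\<^sub>R t n) * ft c f \<xi>" for n
  proof -
    have "integral\<^sup>L lborel (S n) = (LINT x|lborel. (cis (c * (x \<bullet> \<xi>)) * f (x + t n *\<^sub>R b) - cis (c * (x \<bullet> \<xi>)) * f x) /\<^sub>R t n)"
      unfolding S_def by (intro Bochner_Integration.integral_cong refl) (simp add: scaleR_diff_right right_diff_distrib)
    also have "\<dots> = (ft c (\<lambda>x. f (x + t n *\<^sub>R b)) \<xi> - ft c f \<xi>) /\<^sub>R t n"
      unfolding ft_def
      by (subst integral_scaleR_right, subst Bochner_Integration.integral_diff)
        (intro cis_integrable fi ft_translate | rule refl)+
    also have "\<dots> = ((cis (- (t n * \<beta>)) - 1) /\<^sub>R t n) * ft c f \<xi>"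
      unfolding ft_translate(2)[OF fi] by (simp add: \<beta>_def inner_commute algebra_simps)
    finally show ?thesis .
  qed
  have "(\<lambda>n. integral\<^sup>L lborel (S n)) \<longlonglongrightarrow> (LINT x|lborel. cis (c * (x \<bullet> \<xi>)) * iter_partial [b] f x)"
  proof (rule integral_dominated_convergence[where w="\<lambda>x. 2 ^ (2 * DIM('a)) * schwartz_seminorm (2 * DIM('a) + 1) f * decay x"])
    have [measurable]: "f \<in> borel_measurable borel" by (rule schwartz_measurable[OF f])
    have [measurable]: "cis \<in> borel_measurable borel"
      by (intro borel_measurable_continuous_onI continuous_intros)
    show "S n \<in> borel_measurable lborel" for n unfolding S_def by measurable
    show "(\<lambda>x. cis (c * (x \<bullet> \<xi>)) * iter_partial [b] f x) \<in> borel_measurable lborel"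
      using borel_measurable_integrable[OF cis_integrable[OF schwartz_integrable[OF schwartz_contD(1)[OF schwartz_cont_partial[OF b] f]]]] .
    show "integrable lborel (\<lambda>x. 2 ^ (2 * DIM('a)) * schwartz_seminorm (2 * DIM('a) + 1) f * decay (x::'a))"
      by (intro integrable_mult_right integrable_decay)
    show "AE x in lborel. (\<lambda>n. S n x) \<longlonglongrightarrow> cis (c * (x \<bullet> \<xi>)) * iter_partial [b] f x"
      unfolding S_def t_def by (intro AE_I2 tendsto_mult_left increment_tendsto_partial f b)
    show "AE x in lborel. norm (S n x) \<le> 2 ^ (2 * DIM('a)) * schwartz_seminorm (2 * DIM('a) + 1) f * decay x" for n
      unfolding S_def norm_mult norm_cis mult_1_left by (intro AE_I2 schwartz_increment_bound f b t)
  qed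
  moreover have "(\<lambda>n. integral\<^sup>L lborel (S n)) \<longlonglongrightarrow> (- \<i> * of_real \<beta>) * ft c f \<xi>"
    unfolding Si
  proof (rule tendsto_mult_right)
    have bd: "norm ((cis (- (t n * \<beta>)) - 1) /\<^sub>R t n - (- \<i> * of_real \<beta>)) \<le> \<beta>\<^sup>2 * t n" for n
    proof -
      have "(cis (- (t n * \<beta>)) - 1) /\<^sub>R t n - (- \<i> * of_real \<beta>) =
        (cis (0 + - (t n * \<beta>)) - cis 0 - \<i> * of_real (- (t n * \<beta>)) * cis 0) /\<^sub>R t n"
        using t(1)[of n] by (simp add: scaleR_conv_of_real algebra_simps)
      then have "norm ((cis (- (t n * \<beta>)) - 1) /\<^sub>R t n - (- \<i> * of_real \<beta>)) \<le> (- (t n * \<beta>))\<^sup>2 / t n"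
        using norm_cis_remainder[of 0 "- (t n * \<beta>)"] t(1)[of n]
        by (simp only: norm_scaleR) (simp add: divide_simps)
      also have "\<dots> = \<beta>\<^sup>2 * t n" using t(1)[of n] by (simp add: power2_eq_square)
      finally show ?thesis .
    qed
    have "(\<lambda>n. \<beta>\<^sup>2 * t n) \<longlonglongrightarrow> 0" using tendsto_mult_left[OF t0, of "\<beta>\<^sup>2"] by simp
    then have "(\<lambda>n. (cis (- (t n * \<beta>)) - 1) /\<^sub>R t n - (- \<i> * of_real \<beta>)) \<longlonglongrightarrow> 0"
      by (rule Lim_null_comparison[rotated]) (use bd in auto)
    then show "(\<lambda>n. (cis (- (t n * \<beta>)) - 1) /\<^sub>R t n) \<longlonglongrightarrow> - \<i> * of_real \<beta>"
      by (simp only: LIM_zero_iff)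
  qed
  ultimately show ?thesis
    unfolding ft_def[of c "iter_partial [b] f"] \<beta>_def using LIMSEQ_unique by blast
qed

text \<open>
  One power of \<open>1 + \<bar>\<xi>\<bar>\<close> is bounded by one plus the sum of the coordinates, and each coordinate is
  absorbed as a derivative of \<open>f\<close>.
\<close>

lemma ft_decay:
  fixes c :: real
  assumes c: "\<bar>c\<bar> = 1"
  shows "\<exists>C M. 0 \<le> C \<and> (\<forall>(f::'a::euclidean_space \<Rightarrow> complex) \<xi>. schwartz f \<longrightarrow>
     (1 + norm \<xi>) ^ k * norm (ft c f \<xi>) \<le> C * schwartz_seminorm M f)"
proof (induction k)
  case 0
  have "0 \<le> integral\<^sup>L lborel (decay :: 'a \<Rightarrow> real)" by (simp add: decay_nonneg)
  then show ?case using norm_ft_le by (auto intro!: exI[of _ "integral\<^sup>L lborel decay"] exI[of _ "2 * DIM('a)"])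
next
  case (Suc k)
  then obtain C M where C: "0 \<le> C"
    and CM: "\<And>(f::'a \<Rightarrow> complex) \<xi>. schwartz f \<Longrightarrow> (1 + norm \<xi>) ^ k * norm (ft c f \<xi>) \<le> C * schwartz_seminorm M f"
    by blast
  have "\<exists>D K. 0 \<le> D \<and> (\<forall>f. schwartz f \<longrightarrow> schwartz_seminorm M (iter_partial [b] f) \<le> D * schwartz_seminorm K f)"
    if "b \<in> Basis" for b :: 'a
    using schwartz_contD(4)[OF schwartz_cont_partial[OF that], of M] by blast
  then obtain D K where D: "\<And>b::'a. b \<in> Basis \<Longrightarrow> 0 \<le> D b"
    and DK: "\<And>(b::'a) f. b \<in> Basis \<Longrightarrow> schwartz f \<Longrightarrow> schwartz_seminorm M (iter_partial [b] f) \<le> D b * schwartz_seminorm (K b) f"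
    by metis
  \<comment> \<open>An order that serves all directions at once.\<close>
  define L where "L = M + (\<Sum>b\<in>(Basis::'a set). K b)"
  have L: "M \<le> L" "b \<in> Basis \<Longrightarrow> K b \<le> L" for b :: 'a
    using member_le_sum[of b "Basis" K] by (auto simp: L_def intro!: trans_le_add2)
  have "(1 + norm \<xi>) ^ Suc k * norm (ft c f \<xi>) \<le> (C + (\<Sum>b\<in>(Basis::'a set). C * D b)) * schwartz_seminorm L f"
    if f: "schwartz f" for f :: "'a \<Rightarrow> complex" and \<xi>
  proof -
    have nb: "\<bar>\<xi> \<bullet> b\<bar> * norm (ft c f \<xi>) = norm (ft c (iter_partial [b] f) \<xi>)" if "b \<in> Basis" for b
      using c by (simp add: ft_partial[OF f that] norm_mult abs_mult del: iter_partial.simps)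
    have "(1 + norm \<xi>) ^ Suc k * norm (ft c f \<xi>) \<le> (1 + norm \<xi>) ^ k * ((1 + (\<Sum>b\<in>Basis. \<bar>\<xi> \<bullet> b\<bar>)) * norm (ft c f \<xi>))"
      using norm_le_l1[of \<xi>] by (simp only: power_Suc2 mult.assoc) (intro mult_left_mono mult_right_mono, auto)
    also have "\<dots> = (1 + norm \<xi>) ^ k * norm (ft c f \<xi>) + (\<Sum>b\<in>Basis. (1 + norm \<xi>) ^ k * (\<bar>\<xi> \<bullet> b\<bar> * norm (ft c f \<xi>)))"
      by (simp add: distrib_left distrib_right sum_distrib_left sum_distrib_right)
    also have "\<dots> = (1 + norm \<xi>) ^ k * norm (ft c f \<xi>) + (\<Sum>b\<in>Basis. (1 + norm \<xi>) ^ k * norm (ft c (iter_partial [b] f) \<xi>))"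
      by (simp only: nb cong: sum.cong)
    also have "\<dots> \<le> C * schwartz_seminorm L f + (\<Sum>b\<in>Basis. C * D b * schwartz_seminorm L f)"
    proof (intro add_mono sum_mono)
      show "(1 + norm \<xi>) ^ k * norm (ft c f \<xi>) \<le> C * schwartz_seminorm L f"
        using CM[OF f, of \<xi>] mult_left_mono[OF schwartz_seminorm_mono[OF f L(1)] C] by linarith
      fix b :: 'a assume b: "b \<in> Basis"
      have "(1 + norm \<xi>) ^ k * norm (ft c (iter_partial [b] f) \<xi>) \<le> C * schwartz_seminorm M (iter_partial [b] f)"
        by (rule CM[OF schwartz_contD(1)[OF schwartz_cont_partial[OF b] f]])
      also have "\<dots> \<le> C * (D b * schwartz_seminorm (K b) f)"
        by (intro mult_left_mono DK b f C)
      also have "\<dots> \<le> C * (D b * schwartz_seminorm L f)"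
        by (intro mult_left_mono schwartz_seminorm_mono L b f C D)
      finally show "(1 + norm \<xi>) ^ k * norm (ft c (iter_partial [b] f) \<xi>) \<le> C * D b * schwartz_seminorm L f"
        by simp
    qed
    also have "\<dots> = (C + (\<Sum>b\<in>(Basis::'a set). C * D b)) * schwartz_seminorm L f"
      by (simp add: distrib_right sum_distrib_right)
    finally show ?thesis .
  qed
  moreover have "0 \<le> C + (\<Sum>b\<in>(Basis::'a set). C * D b)"
    using C D by (intro add_nonneg_nonneg sum_nonneg mult_nonneg_nonneg) auto
  ultimately show ?case by blast
qed

lemma schwartz_cont_ft:
  assumes c: "\<bar>c\<bar> = 1"
  shows "schwartz_cont (ft c)"
proof (rule schwartz_contI)
  fix bs :: "'a list" and k assume bs: "bs \<in> lists Basis"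
  obtain C M where C: "0 \<le> C"
    and CM: "\<And>(f::'a \<Rightarrow> complex) \<xi>. schwartz f \<Longrightarrow> (1 + norm \<xi>) ^ k * norm (ft c f \<xi>) \<le> C * schwartz_seminorm M f"
    using ft_decay[OF c] by metis
  obtain D K where DK: "\<And>f. schwartz f \<Longrightarrow> schwartz_seminorm M (coord_mults c bs f) \<le> D * schwartz_seminorm K f"
    using schwartz_contD(4)[OF schwartz_cont_coord_mults] by metis
  have "(1 + norm x) ^ k * norm (iter_partial bs (ft c f) x) \<le> C * D * schwartz_seminorm K f" if "schwartz f" for f x
    unfolding iter_partial_ft[OF that bs]
    using CM[OF schwartz_contD(1)[OF schwartz_cont_coord_mults that], of x] mult_left_mono[OF DK[OF that] C]
    by (simp add: mult.assoc) (meson order_trans)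
  then show "\<exists>C M. \<forall>f x. schwartz f \<longrightarrow> (1 + norm x) ^ k * norm (iter_partial bs (ft c f) x) \<le> C * schwartz_seminorm M f"
    by blast
qed (auto simp: ft_cmult ft_add smooth_ft)

section \<open>Fourier inversion\<close>

lemma integral_lborel_affine:
  fixes f :: "'a::euclidean_space \<Rightarrow> 'b::{banach, second_countable_topology}"
  assumes c: "c \<noteq> 0" and f: "f \<in> borel_measurable borel"
  shows "integral\<^sup>L lborel f = \<bar>c\<bar> ^ DIM('a) *\<^sub>R (LINT x|lborel. f (t + c *\<^sub>R x))"
proof -
  have "integral\<^sup>L lborel f = integral\<^sup>L (density (distr lborel borel (\<lambda>x. t + c *\<^sub>R x)) (\<lambda>_. \<bar>c\<bar> ^ DIM('a))) f"
    by (subst lborel_affine[OF c, of t]) (rule refl)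
  also have "\<dots> = (LINT x|distr lborel borel (\<lambda>x. t + c *\<^sub>R x). \<bar>c\<bar> ^ DIM('a) *\<^sub>R f x)"
    by (subst integral_density) (use f in auto)
  also have "\<dots> = (LINT x|lborel. \<bar>c\<bar> ^ DIM('a) *\<^sub>R f (t + c *\<^sub>R x))"
    by (subst integral_distr) (use f in auto)
  finally show ?thesis by simp
qed

text \<open>
  The centred Gaussian density with unit covariance.
\<close>

definition gauss :: "'a::euclidean_space \<Rightarrow> real" where
  "gauss x = (\<Prod>b\<in>Basis. std_normal_density (x \<bullet> b))"

lemma gauss_nonneg: "0 \<le> gauss x"
  by (simp add: gauss_def prod_nonneg)

lemma gauss_le: "gauss (x::'a::euclidean_space) \<le> gauss (0::'a)"
proof -
  have "std_normal_density t \<le> std_normal_density 0" for t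
    unfolding std_normal_density_def by (intro mult_left_mono) auto
  then show ?thesis unfolding gauss_def by (intro prod_mono conjI) simp_all
qed

lemma gauss_zero: "gauss (0::'a::euclidean_space) = (1 / sqrt (2 * pi)) ^ DIM('a)"
  by (simp add: gauss_def std_normal_density_def)

lemma continuous_gauss: "continuous_on A gauss"
  unfolding gauss_def std_normal_density_def by (intro continuous_intros) auto

lemma gauss_measurable [measurable]: "gauss \<in> borel_measurable borel"
  by (intro borel_measurable_continuous_onI continuous_gauss)

lemma integrable_gauss_scaled:
  assumes "e \<noteq> 0"
  shows "integrable lborel (\<lambda>x::'a::euclidean_space. gauss (e *\<^sub>R x))"
proof -
  have "integrable lborel (\<lambda>t. std_normal_density (0 + e * t))"
    using assms by (intro lborel_integrable_real_affine) auto
  then have "integrable lborel (\<lambda>t. std_normal_density (e * t))" by simp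
  from lborel_prod_coordinates(1)[of "\<lambda>_. \<lambda>t. std_normal_density (e * t)", OF this]
  show ?thesis unfolding gauss_def by simp
qed

lemma integral_gauss: "(LINT x|lborel. gauss (x::'a::euclidean_space)) = 1"
  using lborel_prod_coordinates(2)[of "\<lambda>_::'a. std_normal_density"] unfolding gauss_def by simp

text \<open>
  The Gaussian is, up to a factor, its own Fourier transform. In one dimension this is the characteristic
  function of the normal distribution.
\<close>

lemma ft_gauss: "ft 1 (\<lambda>x. of_real (gauss x)) (z::'a::euclidean_space) = of_real (sqrt (2 * pi) ^ DIM('a) * gauss z)"
proof -
  define F where "F b t = cis (t * (z \<bullet> b)) * of_real (std_normal_density t)" for b t
  have one: "(LINT t|lborel. F b t) = of_real (sqrt (2 * pi) * std_normal_density (z \<bullet> b))" for b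
  proof -
    have "of_real (exp (- ((z \<bullet> b)\<^sup>2) / 2)) = char std_normal_distribution (z \<bullet> b)"
      by (simp add: char_std_normal_distribution)
    also have "\<dots> = (LINT t|lborel. std_normal_density t *\<^sub>R iexp ((z \<bullet> b) * t))"
      unfolding char_def by (subst integral_density) auto
    also have "\<dots> = (LINT t|lborel. F b t)"
      by (simp add: F_def cis_conv_exp scaleR_conv_of_real mult.commute)
    finally show ?thesis by (simp add: std_normal_density_def)
  qed
  have int: "integrable lborel (F b)" for b
  proof (rule Bochner_Integration.integrable_bound)
    show "integrable lborel std_normal_density" by simp
    have [measurable]: "cis \<in> borel_measurable borel"
      by (intro borel_measurable_continuous_onI continuous_intros)
    show "F b \<in> borel_measurable lborel" unfolding F_def by measurable
  qed (simp add: F_def norm_mult)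
  have cp: "cis (\<Sum>b\<in>A. t b) = (\<Prod>b\<in>A. cis (t b))" for A and t :: "'a \<Rightarrow> real"
    by (induction A rule: infinite_finite_induct) (auto simp: cis_mult[symmetric])
  have "ft 1 (\<lambda>x. of_real (gauss x)) z = (LINT x|lborel. (\<Prod>b\<in>Basis. F b (x \<bullet> b)))"
    unfolding ft_def F_def
    by (intro Bochner_Integration.integral_cong refl)
      (simp add: euclidean_inner[of _ z] cp prod.distrib gauss_def)
  also have "\<dots> = (\<Prod>b\<in>Basis. (LINT t|lborel. F b t))"
    by (rule lborel_prod_coordinates(2)[OF int])
  also have "\<dots> = of_real (sqrt (2 * pi) ^ DIM('a) * gauss z)"
    unfolding one by (simp add: gauss_def prod.distrib)
  finally show ?thesis .
qed

text \<open>
  A Gaussian factor makes the double integral absolutely convergent. After Fubini, the substitution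
  \<open>y = x + e z\<close> and the transform of the Gaussian leave an average of \<open>f\<close> around \<open>x\<close> at scale
  \<open>e\<close>.
\<close>

lemma ft_inversion_regularised:
  fixes f :: "'a::euclidean_space \<Rightarrow> complex"
  assumes f: "schwartz f" and e: "0 < e"
  shows "(LINT \<xi>|lborel. cis (x \<bullet> \<xi>) * (of_real (gauss (e *\<^sub>R \<xi>)) * ft (- 1) f \<xi>))
    = of_real (sqrt (2 * pi) ^ DIM('a)) * (LINT z|lborel. f (x + e *\<^sub>R z) * of_real (gauss z))"
proof -
  have [measurable]: "cis \<in> borel_measurable borel"
    by (intro borel_measurable_continuous_onI continuous_intros)
  have [measurable]: "f \<in> borel_measurable borel" by (rule schwartz_measurable[OF f])
  let ?h = "\<lambda>\<xi> y. cis (x \<bullet> \<xi>) * (of_real (gauss (e *\<^sub>R \<xi>)) * (cis (- (y \<bullet> \<xi>)) * f y))"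
  have nf: "integrable lborel (\<lambda>y. norm (f y))" using schwartz_integrable[OF f] by simp
  have int: "integrable (lborel \<Otimes>\<^sub>M lborel) (case_prod ?h)"
  proof (rule lborel_pair.Fubini_integrable)
    show "case_prod ?h \<in> borel_measurable (lborel \<Otimes>\<^sub>M lborel)" by measurable
    have "(LINT y|lborel. norm (?h \<xi> y)) = gauss (e *\<^sub>R \<xi>) * (LINT y|lborel. norm (f y))" for \<xi>
      by (simp add: norm_mult gauss_nonneg)
    then show "integrable lborel (\<lambda>\<xi>. LINT y|lborel. norm (case_prod ?h (\<xi>, y)))"
      using e integrable_gauss_scaled[of e, where 'a='a] by simp
    have "integrable lborel (?h \<xi>)" for \<xi>
      using cis_integrable[OF schwartz_integrable[OF f], of "- 1" \<xi>] by (intro integrable_mult_right) simp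
    then show "AE \<xi> in lborel. integrable lborel (\<lambda>y. case_prod ?h (\<xi>, y))" by simp
  qed
  have "(LINT \<xi>|lborel. cis (x \<bullet> \<xi>) * (of_real (gauss (e *\<^sub>R \<xi>)) * ft (- 1) f \<xi>))
    = (LINT \<xi>|lborel. (LINT y|lborel. ?h \<xi> y))"
    by (simp add: ft_def)
  also have "\<dots> = (LINT y|lborel. (LINT \<xi>|lborel. ?h \<xi> y))"
    by (rule lborel_pair.Fubini_integral[OF int, symmetric])
  also have "\<dots> = \<bar>e\<bar> ^ DIM('a) *\<^sub>R (LINT z|lborel. (LINT \<xi>|lborel. ?h \<xi> (x + e *\<^sub>R z)))"
  proof (rule integral_lborel_affine)
    show "(\<lambda>y. LINT \<xi>|lborel. ?h \<xi> y) \<in> borel_measurable borel"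
      using lborel.borel_measurable_lebesgue_integral[of "\<lambda>y \<xi>. ?h \<xi> y" borel] by measurable
  qed (use e in simp)
  also have "\<dots> = (LINT z|lborel. f (x + e *\<^sub>R z) * (\<bar>e\<bar> ^ DIM('a) *\<^sub>R (LINT \<xi>|lborel. cis (1 * ((0 + e *\<^sub>R \<xi>) \<bullet> (- z))) * of_real (gauss (0 + e *\<^sub>R \<xi>)))))"
  proof -
    have "(LINT \<xi>|lborel. ?h \<xi> (x + e *\<^sub>R z)) = (LINT \<xi>|lborel. f (x + e *\<^sub>R z) * (cis (1 * ((0 + e *\<^sub>R \<xi>) \<bullet> (- z))) * of_real (gauss (0 + e *\<^sub>R \<xi>))))" for z
    proof (intro Bochner_Integration.integral_cong refl)
      fix \<xi> :: 'a
      have "cis (1 * ((0 + e *\<^sub>R \<xi>) \<bullet> (- z))) = cis (x \<bullet> \<xi>) * cis (- ((x + e *\<^sub>R z) \<bullet> \<xi>))"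
        unfolding cis_mult by (simp add: inner_add_left inner_add_right inner_commute)
      then show "?h \<xi> (x + e *\<^sub>R z) = f (x + e *\<^sub>R z) * (cis (1 * ((0 + e *\<^sub>R \<xi>) \<bullet> (- z))) * of_real (gauss (0 + e *\<^sub>R \<xi>)))"
        by (simp only: mult_ac) simp
    qed
    then show ?thesis by (simp only: integral_mult_right_zero mult_scaleR_right integral_scaleR_right)
  qed
  also have "\<dots> = (LINT z|lborel. f (x + e *\<^sub>R z) * ft 1 (\<lambda>x. of_real (gauss x)) (- z))"
    unfolding ft_def using e
    by (subst integral_lborel_affine[of e "\<lambda>\<xi>. cis (1 * (\<xi> \<bullet> (- z))) * of_real (gauss \<xi>)" 0 for z, symmetric]) auto
  also have "\<dots> = (LINT z|lborel. of_real (sqrt (2 * pi) ^ DIM('a)) * (f (x + e *\<^sub>R z) * of_real (gauss z)))"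
  proof -
    have "gauss (- z) = gauss z" for z :: 'a by (simp add: gauss_def std_normal_density_def)
    then show ?thesis unfolding ft_gauss by (simp add: mult_ac)
  qed
  finally show ?thesis by simp
qed

text \<open>
  Both sides of the regularised formula converge as the scale tends to zero: the left one to the
  inverse transform times \<open>gauss 0\<close>, the right one to \<open>f x\<close> times a constant.
\<close>

lemma ft_inversion:
  fixes f :: "'a::euclidean_space \<Rightarrow> complex"
  assumes f: "schwartz f"
  shows "ft 1 (ft (- 1) f) x = (2 * pi) ^ DIM('a) * f x"
proof -
  have [measurable]: "cis \<in> borel_measurable borel"
    by (intro borel_measurable_continuous_onI continuous_intros)
  have [measurable]: "f \<in> borel_measurable borel" by (rule schwartz_measurable[OF f])
  have sf: "schwartz (ft (- 1) f)" by (rule schwartz_contD(1)[OF schwartz_cont_ft f]) simp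
  have [measurable]: "ft (- 1) f \<in> borel_measurable borel" by (rule schwartz_measurable[OF sf])
  define e where "e n = inverse (real (Suc n))" for n
  have e: "0 < e n" for n by (simp add: e_def)
  have e0: "e \<longlonglongrightarrow> 0" unfolding e_def by (rule LIMSEQ_inverse_real_of_nat)
  let ?L = "\<lambda>n. LINT \<xi>|lborel. cis (x \<bullet> \<xi>) * (of_real (gauss (e n *\<^sub>R \<xi>)) * ft (- 1) f \<xi>)"
  let ?c = "complex_of_real (sqrt (2 * pi) ^ DIM('a))"
  have gl: "(\<lambda>n. gauss (e n *\<^sub>R \<xi>)) \<longlonglongrightarrow> gauss (0::'a)" for \<xi> :: 'a
  proof -
    have "(\<lambda>n. e n *\<^sub>R \<xi>) \<longlonglongrightarrow> 0 *\<^sub>R \<xi>" by (intro tendsto_intros e0)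
    then show ?thesis
      using continuous_on_tendsto_compose[OF continuous_gauss[of UNIV], of "\<lambda>n. e n *\<^sub>R \<xi>" 0 sequentially] by simp
  qed
  have 1: "?L \<longlonglongrightarrow> (LINT \<xi>|lborel. cis (x \<bullet> \<xi>) * (of_real (gauss (0::'a)) * ft (- 1) f \<xi>))"
  proof (rule integral_dominated_convergence[where w="\<lambda>\<xi>. gauss (0::'a) * norm (ft (- 1) f \<xi>)"])
    show "integrable lborel (\<lambda>\<xi>. gauss (0::'a) * norm (ft (- 1) f \<xi>))"
      using schwartz_integrable[OF sf] by simp
    show "AE \<xi> in lborel. (\<lambda>n. cis (x \<bullet> \<xi>) * (of_real (gauss (e n *\<^sub>R \<xi>)) * ft (- 1) f \<xi>)) \<longlonglongrightarrow> cis (x \<bullet> \<xi>) * (of_real (gauss (0::'a)) * ft (- 1) f \<xi>)"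
      by (intro AE_I2 tendsto_intros gl)
    show "AE \<xi> in lborel. norm (cis (x \<bullet> \<xi>) * (of_real (gauss (e n *\<^sub>R \<xi>)) * ft (- 1) f \<xi>)) \<le> gauss (0::'a) * norm (ft (- 1) f \<xi>)" for n
      using gauss_le by (intro AE_I2) (auto simp: norm_mult gauss_nonneg intro!: mult_right_mono)
  qed measurable
  obtain B where B: "\<And>y. norm (f y) \<le> B"
    using schwartz_seminorm_bound[OF f, of "[]" 0 0] by auto
  have "(\<lambda>n. LINT z|lborel. f (x + e n *\<^sub>R z) * of_real (gauss z)) \<longlonglongrightarrow> (LINT z|lborel. f x * of_real (gauss (z::'a)))"
  proof (rule integral_dominated_convergence[where w="\<lambda>z. B * gauss z"])
    show "integrable lborel (\<lambda>z::'a. B * gauss z)"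
      using integrable_gauss_scaled[of 1, where 'a='a] by simp
    have "(\<lambda>n. f (x + e n *\<^sub>R z)) \<longlonglongrightarrow> f x" for z
    proof -
      have "(\<lambda>n. x + e n *\<^sub>R z) \<longlonglongrightarrow> x + 0 *\<^sub>R z" by (intro tendsto_intros e0)
      then show ?thesis
        using continuous_on_tendsto_compose[OF smooth_continuous[OF schwartzD(1)[OF f], of UNIV], of "\<lambda>n. x + e n *\<^sub>R z" x sequentially] by simp
    qed
    then show "AE z in lborel. (\<lambda>n. f (x + e n *\<^sub>R z) * of_real (gauss z)) \<longlonglongrightarrow> f x * of_real (gauss z)"
      by (intro AE_I2 tendsto_intros)
    show "AE z in lborel. norm (f (x + e n *\<^sub>R z) * complex_of_real (gauss z)) \<le> B * gauss z" for n
      using B by (intro AE_I2) (auto simp: norm_mult gauss_nonneg intro!: mult_right_mono)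
  qed measurable
  then have "(\<lambda>n. ?c * (LINT z|lborel. f (x + e n *\<^sub>R z) * of_real (gauss z))) \<longlonglongrightarrow> ?c * (LINT z|lborel. f x * of_real (gauss (z::'a)))"
    by (rule tendsto_mult_left)
  then have 2: "?L \<longlonglongrightarrow> ?c * f x"
    unfolding ft_inversion_regularised[OF f e] by (simp add: integral_gauss)
  have "ft 1 (ft (- 1) f) x * of_real (gauss (0::'a)) = ?c * f x"
    using LIMSEQ_unique[OF 1 2] by (simp add: ft_def[of 1] inner_commute mult.left_commute mult.commute)
  then have eq: "?c * (ft 1 (ft (- 1) f) x * of_real (gauss (0::'a))) = ?c * (?c * f x)" by (rule arg_cong)
  have c1: "?c * of_real (gauss (0::'a)) = 1"
    by (simp add: gauss_zero power_divide)
  have "ft 1 (ft (- 1) f) x = (?c * of_real (gauss (0::'a))) * ft 1 (ft (- 1) f) x"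
    unfolding c1 by simp
  also have "\<dots> = ?c * (ft 1 (ft (- 1) f) x * of_real (gauss (0::'a)))"
    by (simp only: mult_ac)
  also have "\<dots> = of_real (sqrt (2 * pi) ^ DIM('a) * sqrt (2 * pi) ^ DIM('a)) * f x"
    unfolding eq of_real_mult by (simp only: mult.assoc)
  also have "sqrt (2 * pi) ^ DIM('a) * sqrt (2 * pi) ^ DIM('a) = (2 * pi) ^ DIM('a)"
    by (subst power_mult_distrib[symmetric]) simp
  finally show ?thesis by simp
qed

lemma inv_fourier_fourier:
  assumes "schwartz f"
  shows "inv_fourier (fourier f) = f"
proof
  fix x
  show "inv_fourier (fourier f) x = f x"
    unfolding inv_fourier_eq_ft fourier_eq_ft ft_inversion[OF assms] mult.assoc[symmetric] of_real_mult[symmetric]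
    by (subst left_inverse) simp_all
qed

lemma schwartz_cont_fourier: "schwartz_cont fourier"
  using schwartz_cont_ft[of "- 1"] by (simp add: fourier_eq_ft[abs_def])

lemma schwartz_cont_inv_fourier: "schwartz_cont inv_fourier"
  unfolding inv_fourier_eq_ft[abs_def]
  by (intro schwartz_cont_compose[OF schwartz_cont_cmult] schwartz_cont_ft) simp

section \<open>Operators on tempered distributions by duality\<close>

lemma td_apply_tempered: "tempered (td_apply u)"
  using td_apply[of u] by simp

lemma td_apply_dual_op:
  assumes A: "schwartz_cont A"
  shows "td_apply (dual_op A u) f = (if schwartz f then td_apply u (A f) else 0)"
proof -
  have u: "tempered (td_apply u)" by (rule td_apply_tempered)
  have "tempered (\<lambda>f. if schwartz f then td_apply u (A f) else 0)"
    unfolding tempered_def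
  proof (intro conjI allI impI)
    fix f g :: "'a \<Rightarrow> complex" assume "schwartz f" "schwartz g"
    then show "(if schwartz (\<lambda>x. f x + g x) then td_apply u (A (\<lambda>x. f x + g x)) else 0) =
       (if schwartz f then td_apply u (A f) else 0) + (if schwartz g then td_apply u (A g) else 0)"
      using u schwartz_add[of f g] schwartz_contD(1,2)[OF A] by (simp add: tempered_def)
  next
    fix f :: "'a \<Rightarrow> complex" and c assume "schwartz f"
    then show "(if schwartz (\<lambda>x. c * f x) then td_apply u (A (\<lambda>x. c * f x)) else 0) =
       c * (if schwartz f then td_apply u (A f) else 0)"
      using u schwartz_contD(1)[OF schwartz_cont_cmult, of f c] schwartz_contD(1,3)[OF A] by (simp add: tempered_def)
  next
    obtain C N where C: "0 \<le> C" and CN: "\<And>f. schwartz f \<Longrightarrow> norm (td_apply u f) \<le> C * schwartz_seminorm N f"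
      using tempered_bound_nonneg[OF u] by (metis order_refl)
    obtain D M where DM: "\<And>f. schwartz f \<Longrightarrow> schwartz_seminorm N (A f) \<le> D * schwartz_seminorm M f"
      using schwartz_contD(4)[OF A] by metis
    have "norm (td_apply u (A f)) \<le> C * D * schwartz_seminorm M f" if "schwartz f" for f
      using CN[OF schwartz_contD(1)[OF A that]] mult_left_mono[OF DM[OF that] C] by simp
    then show "\<exists>C N. \<forall>f. schwartz f \<longrightarrow> norm (if schwartz f then td_apply u (A f) else 0) \<le> C * schwartz_seminorm N f"
      by auto
  qed auto
  then show ?thesis by (simp add: dual_op_def Abs_td_inverse)
qed

lemma td_eqI: "(\<And>f. schwartz f \<Longrightarrow> td_apply u f = td_apply v f) \<Longrightarrow> u = v"
  using td_apply_tempered[of u] td_apply_tempered[of v]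
  by (intro td_apply_inject[THEN iffD1] ext) (metis tempered_def)

text \<open>
  By duality this is \<open>inv_fourier (fourier f) = f\<close>. It makes a Fourier multiplier act on the
  Fourier side as multiplication by its symbol.
\<close>

lemma fourier_td_inv_fourier_td: "fourier_td (inv_fourier_td w) = w"
  by (rule td_eqI)
    (simp add: fourier_td_def inv_fourier_td_def td_apply_dual_op schwartz_cont_fourier schwartz_cont_inv_fourier
      schwartz_contD(1) inv_fourier_fourier)

lemma fourier_td_diff: "fourier_td (u - v) = fourier_td u - fourier_td v"
  by (rule td_eqI) (simp add: fourier_td_def td_apply_dual_op schwartz_cont_fourier minus_tempered_distribution.rep_eq)

lemma fourier_td_add: "fourier_td (u + v) = fourier_td u + fourier_td v"
  by (rule td_eqI) (simp add: fourier_td_def td_apply_dual_op schwartz_cont_fourier plus_tempered_distribution.rep_eq)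

section \<open>Smooth cutoffs\<close>

lemma iter_partial_affine:
  assumes f: "smooth f" and "bs \<in> lists Basis"
  shows "iter_partial bs (\<lambda>x. f (a *\<^sub>R x + v)) = (\<lambda>x. a ^ length bs *\<^sub>R iter_partial bs f (a *\<^sub>R x + v))"
  using assms(2)
proof (induction bs rule: list.induct)
  case (Cons b bs)
  then have bs: "bs \<in> lists Basis" and b: "b \<in> Basis" by auto
  have D: "((\<lambda>x. a ^ length bs *\<^sub>R iter_partial bs f (a *\<^sub>R x + v)) has_derivative
     (\<lambda>h. a ^ length bs *\<^sub>R (\<Sum>b\<in>Basis. (a *\<^sub>R h \<bullet> b) *\<^sub>R iter_partial (b # bs) f (a *\<^sub>R x + v)))) (at x)" for x
  proof (intro has_derivative_scaleR_right)
    have 1: "((\<lambda>x. a *\<^sub>R x + v) has_derivative (\<lambda>h. a *\<^sub>R h)) (at x)"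
      by (auto intro!: derivative_eq_intros)
    show "((\<lambda>x. iter_partial bs f (a *\<^sub>R x + v)) has_derivative
      (\<lambda>h. \<Sum>b\<in>Basis. (a *\<^sub>R h \<bullet> b) *\<^sub>R iter_partial (b # bs) f (a *\<^sub>R x + v))) (at x)"
      by (rule has_derivative_compose[OF 1 smooth_has_derivative[OF f bs]])
  qed
  have "iter_partial (b # bs) (\<lambda>x. f (a *\<^sub>R x + v)) =
    (\<lambda>x. a ^ length bs *\<^sub>R (\<Sum>b'\<in>Basis. (a *\<^sub>R b \<bullet> b') *\<^sub>R iter_partial (b' # bs) f (a *\<^sub>R x + v)))"
    by (rule iter_partial_step) (unfold Cons.IH[OF bs], rule D)
  also have "\<dots> = (\<lambda>x. a ^ length (b # bs) *\<^sub>R iter_partial (b # bs) f (a *\<^sub>R x + v))"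
    using b by (auto simp: inner_Basis if_distrib[of "\<lambda>u. u *\<^sub>R _"] if_distrib[of "\<lambda>u. a * u"] mult.commute cong: if_cong)
  finally show ?case .
qed simp

lemma smooth_affine:
  assumes f: "smooth f"
  shows "smooth (\<lambda>x. f (a *\<^sub>R x + v))"
  unfolding smooth_def
proof (intro ballI allI)
  fix bs :: "'a list" and x assume bs: "bs \<in> lists Basis"
  have "(\<lambda>x. a *\<^sub>R x + v) differentiable (at x)" by (intro derivative_intros)
  then have "(\<lambda>x. iter_partial bs f (a *\<^sub>R x + v)) differentiable (at x)"
    using smooth_differentiable[OF f bs] by (rule differentiable_compose[rotated])
  then show "iter_partial bs (\<lambda>x. f (a *\<^sub>R x + v)) differentiable (at x)"
    unfolding iter_partial_affine[OF f bs] by (intro derivative_intros) auto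
qed

lemma smooth_scale: "smooth f \<Longrightarrow> smooth (\<lambda>x. f (x /\<^sub>R a))"
  using smooth_affine[of f "inverse a" 0] by simp

lemma smooth_const: "smooth (\<lambda>_. c)"
  unfolding smooth_def
proof (intro ballI allI)
  fix bs :: "'a list" and x :: 'a
  show "iter_partial bs (\<lambda>_. c) differentiable at x"
  proof (cases bs)
    case (Cons b bs')
    show ?thesis unfolding Cons iter_partial_Cons_const by simp
  qed simp
qed

lemma iter_partial_vanish:
  assumes f: "\<And>x. R < norm x \<Longrightarrow> f x = 0" and x: "R < norm x"
  shows "iter_partial bs f x = 0"
  using x
proof (induction bs arbitrary: x)
  case (Cons b bs)
  have "(iter_partial bs f has_derivative (\<lambda>_. 0)) (at x)"
  proof (rule has_derivative_transform_within_open)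
    show "((\<lambda>_. 0) has_derivative (\<lambda>_. 0)) (at x)" by simp
    show "open {x::'a. R < norm x}" by (intro open_Collect_less continuous_intros)
  qed (use Cons in auto)
  then have "frechet_derivative (iter_partial bs f) (at x) = (\<lambda>_. 0)"
    by (rule frechet_derivative_at[symmetric])
  then show ?case by simp
qed (use f in simp)

lemma smooth_compact_bounded:
  assumes s: "smooth f" and f: "\<And>x. R < norm x \<Longrightarrow> f x = 0" and bs: "bs \<in> lists Basis"
  shows "\<exists>C. \<forall>x. norm (iter_partial bs f x) \<le> C"
proof -
  have "continuous_on UNIV (iter_partial bs f)"
    by (rule smooth_continuous[OF smooth_iter_partial[OF s bs]])
  then have "compact (iter_partial bs f ` cball 0 R)"
    by (intro compact_continuous_image) (auto intro: continuous_on_subset)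
  then obtain C where C: "\<And>x. x \<in> cball 0 R \<Longrightarrow> norm (iter_partial bs f x) \<le> C"
    using compact_imp_bounded[of "iter_partial bs f ` cball 0 R"] unfolding bounded_iff by (metis imageI)
  have "norm (iter_partial bs f x) \<le> max C 0" for x
  proof (cases "norm x \<le> R")
    case True
    then have "x \<in> cball 0 R" by simp
    from C[OF this] show ?thesis by (rule max.coboundedI1)
  next
    case False
    then have "iter_partial bs f x = 0" by (intro iter_partial_vanish[of R f] f) simp_all
    then show ?thesis by simp
  qed
  then show ?thesis by blast
qed

lemma schwartz_compact_support:
  assumes s: "smooth f" and f: "\<And>x. R < norm x \<Longrightarrow> f x = 0"
  shows "schwartz f"
  unfolding schwartz_def
proof (intro conjI ballI allI s)
  fix bs :: "'a list" and k :: nat assume bs: "bs \<in> lists Basis"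
  obtain C where C: "\<And>x. norm (iter_partial bs f x) \<le> C"
    using smooth_compact_bounded[OF s f bs] by blast
  have C0: "0 \<le> C" using order.trans[OF norm_ge_zero C] .
  have "(1 + norm x) ^ k * norm (iter_partial bs f x) \<le> (1 + \<bar>R\<bar>) ^ k * C" for x
  proof (cases "norm x \<le> R")
    case True
    then show ?thesis using C C0 by (intro mult_mono power_mono) auto
  next
    case False
    then have "iter_partial bs f x = 0" by (intro iter_partial_vanish[of R f] f) simp_all
    then show ?thesis using C0 by simp
  qed
  then show "bdd_above (range (\<lambda>x. (1 + norm x) ^ k * norm (iter_partial bs f x)))"
    by (intro bdd_aboveI2)
qed

lemma schwartz_cont_cutoff:
  fixes m :: "'a::euclidean_space \<Rightarrow> real"
  assumes s: "smooth m" and m: "\<And>x. R < norm x \<Longrightarrow> m x = 0"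
  shows "schwartz_cont (\<lambda>f x. of_real (m x) * f x)"
proof (rule schwartz_cont_mult)
  show sm: "smooth (\<lambda>x. complex_of_real (m x))"
    by (rule smooth_linear_comp[OF bounded_linear_of_real s])
  fix bs :: "'a list" assume "bs \<in> lists Basis"
  from smooth_compact_bounded[OF sm _ this, of R] m
  obtain C where "\<And>x. norm (iter_partial bs (\<lambda>x. complex_of_real (m x)) x) \<le> C" by auto
  then show "\<exists>C k. \<forall>x. norm (iter_partial bs (\<lambda>x. complex_of_real (m x)) x) \<le> C * (1 + norm x) ^ k"
    by (intro exI[of _ C] exI[of _ 0]) simp
qed

section \<open>Distributions represented by functions\<close>

lemma representsD:
  assumes "represents g u"
  shows "g \<in> borel_measurable borel" "schwartz f \<Longrightarrow> integrable lborel (\<lambda>x. g x * f x)"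
    "schwartz f \<Longrightarrow> td_apply u f = (LINT x|lborel. g x * f x)"
  using assms by (auto simp: represents_def)

lemma represents_add: "represents g u \<Longrightarrow> represents h v \<Longrightarrow> represents (\<lambda>x. g x + h x) (u + v)"
  unfolding represents_def by (auto simp: plus_tempered_distribution.rep_eq distrib_right)

lemma represents_diff: "represents g u \<Longrightarrow> represents h v \<Longrightarrow> represents (\<lambda>x. g x - h x) (u - v)"
  unfolding represents_def by (auto simp: minus_tempered_distribution.rep_eq left_diff_distrib)

lemma represents_fourier_multiplier:
  fixes m :: "'a::euclidean_space \<Rightarrow> real"
  assumes s: "smooth m" and m: "\<And>x. R < norm x \<Longrightarrow> m x = 0"
    and g: "represents g (fourier_td u)"
  shows "represents (\<lambda>\<xi>. m \<xi> *\<^sub>R g \<xi>) (fourier_td (fourier_multiplier m u))"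
proof -
  note A = schwartz_cont_cutoff[OF s m]
  have eq: "(m x *\<^sub>R g x) * f x = g x * (of_real (m x) * f x)" for x f
    by (simp add: scaleR_conv_of_real mult_ac)
  show ?thesis
    unfolding represents_def fourier_multiplier_def fourier_td_inv_fourier_td eq
    using representsD[OF g] schwartz_contD(1)[OF A]
      borel_measurable_scaleR[OF borel_measurable_continuous_onI[OF smooth_continuous[OF s]] representsD(1)[OF g]]
    by (auto simp: mult_td_def td_apply_dual_op[OF A])
qed

text \<open>
  The sets where \<open>\<psi> (n (x - c)) = 1\<close>, with \<open>c\<close> in a countable dense set and support inside \<open>U\<close>,
  exhaust \<open>U\<close>. If \<open>q\<^sub>k\<close> enumerates these bumps, then \<open>1 - (\<Prod>k<n. 1 - q\<^sub>k)\<close> vanishes outside \<open>U\<close>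
  and is equal to one at each point of \<open>U\<close> as soon as \<open>n\<close> is large.
\<close>

lemma smooth_approx_open:
  fixes U :: "'a::euclidean_space set"
  assumes psi: "LP_cutoff (\<psi> :: 'a \<Rightarrow> real)" and U: "open U"
  obtains s :: "nat \<Rightarrow> 'a \<Rightarrow> real" where "\<And>n. smooth (s n)" "\<And>n x. 0 \<le> s n x" "\<And>n x. s n x \<le> 1"
    "\<And>x. (\<lambda>n. s n x) \<longlonglongrightarrow> indicator U x"
proof -
  obtain D :: "'a set" where D: "countable D" "\<And>X. open X \<Longrightarrow> X \<noteq> {} \<Longrightarrow> \<exists>d\<in>D. d \<in> X"
    using countable_dense_setE by blast
  define q where "q = (\<lambda>(c, n) x. \<psi> (real (Suc n) *\<^sub>R (x - c)))"
  define I where "I = {i \<in> D \<times> (UNIV :: nat set). \<forall>x. x \<notin> U \<longrightarrow> q i x = 0}"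
  have q01: "0 \<le> q i x" "q i x \<le> 1" for i x
    using psi by (auto simp: q_def LP_cutoff_def split: prod.splits)
  have qs: "smooth (q i)" for i
  proof -
    obtain c n where i: "i = (c, n)" by force
    have "q i = (\<lambda>x. \<psi> (real (Suc n) *\<^sub>R x + (- real (Suc n) *\<^sub>R c)))"
      by (simp add: q_def i fun_eq_iff algebra_simps del: of_nat_Suc)
    then show ?thesis using smooth_affine[of \<psi>] psi by (simp add: LP_cutoff_def)
  qed
  have cov: "\<exists>i\<in>I. q i x = 1" if x: "x \<in> U" for x
  proof -
    \<comment> \<open>The bump has radius below \<open>r / 2\<close> and equals one up to three quarters of its radius, where \<open>x\<close> lies.\<close>
    obtain r where r: "0 < r" "ball x r \<subseteq> U" using U x by (meson openE)
    obtain n where n: "2 * inverse (real (Suc n)) < r"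
      using reals_Archimedean[of "r / 2"] r(1) by (auto simp: field_simps simp del: of_nat_Suc)
    obtain c where c: "c \<in> D" "c \<in> ball x (3 / 4 * inverse (real (Suc n)))"
      using D(2)[of "ball x (3 / 4 * inverse (real (Suc n)))"] by auto
    have "norm (real (Suc n) *\<^sub>R (x - c)) \<le> 3 / 4"
      using c(2) unfolding norm_scaleR by (simp add: dist_norm field_simps del: of_nat_Suc)
    then have "q (c, n) x = 1" using psi by (simp add: q_def LP_cutoff_def)
    moreover have "q (c, n) y = 0" if "y \<notin> U" for y
    proof -
      have "r \<le> dist x y" using r(2) that by (auto simp: subset_iff not_less)
      moreover have "dist x c < 3 / 4 * inverse (real (Suc n))" using c(2) by simp
      moreover have "dist x y \<le> dist x c + norm (y - c)"
        using dist_triangle[of x y c] by (simp add: dist_norm norm_minus_commute)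
      ultimately have "inverse (real (Suc n)) \<le> norm (y - c)"
        using n by (simp del: of_nat_Suc) (smt (verit) inverse_nonnegative_iff_nonnegative of_nat_0_le_iff)
      then have "1 \<le> norm (real (Suc n) *\<^sub>R (y - c))"
        unfolding norm_scaleR by (simp add: field_simps del: of_nat_Suc)
      then show ?thesis using psi by (simp add: q_def LP_cutoff_def)
    qed
    ultimately show ?thesis using c(1) by (auto simp: I_def)
  qed
  show ?thesis
  proof (cases "I = {}")
    case True
    then have "U = {}" using cov by auto
    then show ?thesis by (intro that[of "\<lambda>_ _. 0"]) (auto simp: smooth_const)
  next
    case False
    have "countable I" unfolding I_def using D(1) by (intro countable_subset[OF _ countable_SIGMA[of D "\<lambda>_. UNIV"]]) auto
    then obtain e :: "nat \<Rightarrow> 'a \<times> nat" where e: "range e = I"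
      using False uncountable_def by metis
    define p where "p n x = (\<Prod>k<n. 1 - q (e k) x)" for n x
    have p01: "0 \<le> p n x" "p n x \<le> 1" for n x
      unfolding p_def by (intro prod_nonneg prod_le_1 conjI; simp add: q01)+
    have pS: "p (Suc n) = (\<lambda>x. p n x * (1 + (- 1) * q (e n) x))" for n
      by (auto simp: p_def fun_eq_iff)
    have p0: "p 0 = (\<lambda>_. 1)" by (simp add: p_def fun_eq_iff)
    have ps: "smooth (p n)" for n
    proof (induction n)
      case 0
      show ?case unfolding p0 by (rule smooth_const)
    next
      case (Suc n)
      show ?case unfolding pS by (intro smooth_mult smooth_add smooth_const qs Suc)
    qed
    have lim: "(\<lambda>n. 1 - p n x) \<longlonglongrightarrow> indicator U x" for x
    proof (cases "x \<in> U")
      case True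
      then obtain k where k: "q (e k) x = 1" using cov e by (metis imageE)
      have "1 - p n x = indicator U x" if "n \<ge> Suc k" for n
      proof -
        have "p n x = 0" unfolding p_def using k that by (intro prod_zero) auto
        then show ?thesis using True by simp
      qed
      then show ?thesis by (intro tendsto_eventually) (auto simp: eventually_sequentially)
    next
      case False
      then have "q (e k) x = 0" for k using e unfolding I_def by blast
      then show ?thesis using False by (simp add: p_def)
    qed
    have "smooth (\<lambda>x. 1 - p n x)" for n
      using smooth_add[OF smooth_const[of 1] smooth_mult[OF smooth_const[of "- 1"] ps]] by simp
    then show ?thesis using p01 lim by (intro that[of "\<lambda>n x. 1 - p n x"]) auto
  qed
qed

text \<open>
  After multiplication by a cutoff, \<open>h\<close> is integrable and its integral over every open set is a limit
  of integrals against Schwartz functions, hence zero. Open sets are stable under intersection and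
  generate the Borel sets, so the integral over every Borel set is zero.
\<close>

lemma vanishing_against_schwartz:
  fixes h :: "'a::euclidean_space \<Rightarrow> complex"
  assumes psi: "LP_cutoff (\<psi> :: 'a \<Rightarrow> real)"
    and h: "\<And>f. schwartz f \<Longrightarrow> integrable lborel (\<lambda>x. h x * f x)"
    and h0: "\<And>f. schwartz f \<Longrightarrow> (LINT x|lborel. h x * f x) = 0"
  shows "AE x in lborel. h x = 0"
proof -
  define cut where "cut R x = \<psi> (x /\<^sub>R real (Suc R))" for R and x :: 'a
  have ch: "schwartz (\<lambda>x. complex_of_real (s x) * complex_of_real (cut R x))" if "smooth s" for s R
  proof (rule schwartz_compact_support[of _ "real (Suc R)"])
    show "smooth (\<lambda>x. complex_of_real (s x) * complex_of_real (cut R x))"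
      unfolding cut_def using psi
      by (intro smooth_mult smooth_linear_comp[OF bounded_linear_of_real] that smooth_scale) (simp add: LP_cutoff_def)
    fix x :: 'a assume "real (Suc R) < norm x"
    then have "1 \<le> norm (x /\<^sub>R real (Suc R))" by (simp add: field_simps del: of_nat_Suc)
    then show "complex_of_real (s x) * complex_of_real (cut R x) = 0"
      using psi by (simp add: cut_def LP_cutoff_def del: of_nat_Suc)
  qed
  have AE_R: "AE x in lborel. h x * of_real (cut R x) = 0" for R
  proof -
    define H where "H x = h x * of_real (cut R x)" for x
    have Hs: "integrable lborel (\<lambda>x. H x * of_real (s x))" "(LINT x|lborel. H x * of_real (s x)) = 0"
      if "smooth s" for s
      using h[OF ch[OF that, of R]] h0[OF ch[OF that, of R]] by (simp_all add: H_def mult_ac)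
    have Hi: "integrable lborel H" and H0: "integral\<^sup>L lborel H = 0"
      using Hs[OF smooth_const[of 1]] by simp_all
    have "(LINT x|lborel. indicator A x *\<^sub>R H x) = 0" if "A \<in> sets borel" for A
    proof -
      have "Int_stable {S::'a set. open S}" by (auto simp: Int_stable_def)
      moreover have "{S::'a set. open S} \<subseteq> Pow UNIV" by simp
      moreover have "A \<in> sigma_sets UNIV {S::'a set. open S}"
        using that by (simp add: borel_def)
      ultimately show ?thesis
      proof (induction A rule: sigma_sets_induct_disjoint)
        case (basic U)
        then have "open U" by simp
        then obtain s :: "nat \<Rightarrow> 'a \<Rightarrow> real" where s: "\<And>n. smooth (s n)" "\<And>n x. 0 \<le> s n x" "\<And>n x. s n x \<le> 1"
          "\<And>x. (\<lambda>n. s n x) \<longlonglongrightarrow> indicator U x"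
          using smooth_approx_open[OF psi] by blast
        have "(\<lambda>n. LINT x|lborel. H x * of_real (s n x)) \<longlonglongrightarrow> (LINT x|lborel. indicator U x *\<^sub>R H x)"
        proof (rule integral_dominated_convergence[where w="\<lambda>x. norm (H x)"])
          show "integrable lborel (\<lambda>x. norm (H x))" using Hi by simp
          show "(\<lambda>x. indicator U x *\<^sub>R H x) \<in> borel_measurable lborel"
            using borel_measurable_integrable[OF Hi] basic by auto
          show "(\<lambda>x. H x * of_real (s n x)) \<in> borel_measurable lborel" for n
            using borel_measurable_integrable[OF Hs(1)[OF s(1)]] .
          have "(\<lambda>n. H x * of_real (s n x)) \<longlonglongrightarrow> H x * of_real (indicator U x)" for x
            by (intro tendsto_intros s(4))
          then show "AE x in lborel. (\<lambda>n. H x * of_real (s n x)) \<longlonglongrightarrow> indicator U x *\<^sub>R H x"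
            by (intro AE_I2) (simp add: scaleR_conv_of_real mult.commute)
          show "AE x in lborel. norm (H x * complex_of_real (s n x)) \<le> norm (H x)" for n
            using s(2,3) by (intro AE_I2) (simp add: norm_mult mult_left_le)
        qed
        then show ?case unfolding Hs(2)[OF s(1)] using LIMSEQ_unique tendsto_const by blast
      next
        case (compl A)
        then have A: "A \<in> sets lborel" by (simp add: borel_def)
        have "(LINT x|lborel. indicator (UNIV - A) x *\<^sub>R H x) = (LINT x|lborel. H x - indicator A x *\<^sub>R H x)"
          by (intro Bochner_Integration.integral_cong refl) (auto simp: indicator_def)
        also have "\<dots> = 0"
          using A Hi H0 compl by (subst Bochner_Integration.integral_diff) (auto intro: integrable_mult_indicator)
        finally show ?case .
      next
        case (union A)
        then have A: "A i \<in> sets lborel" for i by (auto simp: borel_def)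
        have "(LINT x:(\<Union>i. A i)|lborel. H x) = (\<Sum>i. (LINT x:A i|lborel. H x))"
        proof -
          have "set_integrable lborel (\<Union>i. A i) H"
            unfolding set_integrable_def using Hi A by (intro integrable_mult_indicator) auto
          moreover have "A i \<inter> A j = {}" if "i \<noteq> j" for i j
            using union(1) that by (auto simp: disjoint_family_on_def)
          ultimately show ?thesis
            using A by (intro lebesgue_integral_countable_add)
        qed
        then show ?case using union(3) by (simp add: set_lebesgue_integral_def sums_iff)
      qed simp_all
    qed
    then have "AE x in lborel. H x = 0"
      by (intro sigma_finite_measure.density_zero[OF sigma_finite_lborel] Hi) (simp add: set_lebesgue_integral_def)
    then show ?thesis by (simp add: H_def)
  qed
  have "AE x in lborel. \<forall>R. h x * of_real (cut R x) = 0"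
    unfolding AE_all_countable using AE_R by blast
  then show ?thesis
  proof (rule AE_mp, intro AE_I2 impI)
    fix x :: 'a assume *: "\<forall>R. h x * of_real (cut R x) = 0"
    obtain R :: nat where R: "4 / 3 * norm x < real R" using reals_Archimedean2 by blast
    have "norm (x /\<^sub>R real (Suc R)) \<le> 3 / 4" using R by (simp add: field_simps)
    then have "cut R x = 1" using psi by (simp add: cut_def LP_cutoff_def)
    then show "h x = 0" using * by (metis mult_1_right of_real_1)
  qed
qed

lemma represents_unique:
  assumes "LP_cutoff (\<psi> :: 'a::euclidean_space \<Rightarrow> real)" "represents g u" "represents h (u :: 'a tempered_distribution)"
  shows "AE x in lborel. g x = h x"
proof -
  have "AE x in lborel. g x - h x = 0"
    using representsD[OF assms(2)] representsD[OF assms(3)]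
    by (intro vanishing_against_schwartz[OF assms(1)]) (auto simp: left_diff_distrib)
  then show ?thesis by simp
qed

section \<open>Bounds in Lebesgue spaces\<close>

text \<open>
  \<open>f\<close> is measurable with \<open>L\<^sup>\<mu>\<close> norm at most \<open>B\<close>. Bounds, rather than values of norms, include
  integrability and pass to limits, and they have one form for finite and infinite \<open>\<mu>\<close>.
\<close>

definition Lp_le :: "'t measure \<Rightarrow> ennreal \<Rightarrow> ('t \<Rightarrow> real) \<Rightarrow> real \<Rightarrow> bool" where
  "Lp_le M \<mu> f B \<longleftrightarrow> f \<in> borel_measurable M \<and> 0 \<le> B \<and>
     (if \<mu> = \<infinity> then AE t in M. \<bar>f t\<bar> \<le> B
      else (\<integral>\<^sup>+t. ennreal (\<bar>f t\<bar> powr enn2real \<mu>) \<partial>M) \<le> ennreal (B powr enn2real \<mu>))"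

lemma Lp_leD: "Lp_le M \<mu> f B \<Longrightarrow> f \<in> borel_measurable M" "Lp_le M \<mu> f B \<Longrightarrow> 0 \<le> B"
  by (auto simp: Lp_le_def)

lemma exponent_ge:
  assumes "of_nat n \<le> \<mu>" "\<mu> \<noteq> \<infinity>"
  shows "real n \<le> enn2real \<mu>"
proof -
  have "enn2real (of_nat n) \<le> enn2real \<mu>"
    using assms by (intro enn2real_mono) (auto simp: top.not_eq_extremum)
  then show ?thesis by simp
qed

lemma Lp_le_mono:
  assumes f: "f \<in> borel_measurable M" and fg: "AE t in M. \<bar>f t\<bar> \<le> \<bar>g t\<bar>" and g: "Lp_le M \<mu> g B" and "B \<le> B'"
  shows "Lp_le M \<mu> f B'"
proof (cases "\<mu> = \<infinity>")
  case True
  have "AE t in M. \<bar>g t\<bar> \<le> B" using g True by (simp add: Lp_le_def)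
  with fg have "AE t in M. \<bar>f t\<bar> \<le> B'" by eventually_elim (use assms(4) in linarith)
  then show ?thesis using assms True by (auto simp: Lp_le_def)
next
  case False
  let ?p = "enn2real \<mu>"
  have p: "0 \<le> ?p" by simp
  have "(\<integral>\<^sup>+t. ennreal (\<bar>f t\<bar> powr ?p) \<partial>M) \<le> (\<integral>\<^sup>+t. ennreal (\<bar>g t\<bar> powr ?p) \<partial>M)"
    using fg by (intro nn_integral_mono_AE) (auto elim!: eventually_mono intro!: ennreal_leI powr_mono2)
  also have "\<dots> \<le> ennreal (B powr ?p)" using g False by (simp add: Lp_le_def)
  also have "\<dots> \<le> ennreal (B' powr ?p)" using assms(4) Lp_leD(2)[OF g] by (intro ennreal_leI powr_mono2) auto
  finally show ?thesis using assms False Lp_leD(2)[OF g] by (auto simp: Lp_le_def)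
qed

lemma Lp_le_cmult:
  assumes f: "Lp_le M \<mu> f B"
  shows "Lp_le M \<mu> (\<lambda>t. c * f t) (\<bar>c\<bar> * B)"
proof (cases "\<mu> = \<infinity>")
  case True
  then show ?thesis using f by (auto simp: Lp_le_def abs_mult elim!: eventually_mono intro!: mult_left_mono)
next
  case False
  let ?p = "enn2real \<mu>"
  have [measurable]: "f \<in> borel_measurable M" by (rule Lp_leD(1)[OF f])
  have "(\<integral>\<^sup>+t. ennreal (\<bar>c * f t\<bar> powr ?p) \<partial>M) = ennreal (\<bar>c\<bar> powr ?p) * (\<integral>\<^sup>+t. ennreal (\<bar>f t\<bar> powr ?p) \<partial>M)"
    by (subst nn_integral_cmult[symmetric]) (auto simp: abs_mult powr_mult ennreal_mult')
  also have "\<dots> \<le> ennreal (\<bar>c\<bar> powr ?p) * ennreal (B powr ?p)"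
    using f False by (intro mult_left_mono) (auto simp: Lp_le_def)
  also have "\<dots> = ennreal ((\<bar>c\<bar> * B) powr ?p)"
    using Lp_leD(2)[OF f] by (simp add: powr_mult ennreal_mult')
  finally show ?thesis using f False by (auto simp: Lp_le_def)
qed

lemma Lp_le_zero: "0 \<le> B \<Longrightarrow> Lp_le M \<mu> (\<lambda>_. 0) B"
  by (cases "enn2real \<mu> = 0") (auto simp: Lp_le_def)

lemma Lp_le_null:
  assumes f: "Lp_le M \<mu> f 0" and p: "1 \<le> \<mu>"
  shows "AE t in M. f t = 0"
proof (cases "\<mu> = \<infinity>")
  case True
  then show ?thesis using f by (auto simp: Lp_le_def elim!: eventually_mono)
next
  case False
  have [measurable]: "f \<in> borel_measurable M" by (rule Lp_leD(1)[OF f])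
  have "(\<integral>\<^sup>+t. ennreal (\<bar>f t\<bar> powr enn2real \<mu>) \<partial>M) = 0"
    using f False by (simp add: Lp_le_def)
  then have "AE t in M. ennreal (\<bar>f t\<bar> powr enn2real \<mu>) = 0"
    by (subst (asm) nn_integral_0_iff_AE) auto
  then show ?thesis by (auto elim!: eventually_mono)
qed

lemma powr_convex_combination:
  fixes x y a b p :: real
  assumes p: "1 \<le> p" and xy: "0 \<le> x" "0 \<le> y" and ab: "0 \<le> a" "0 \<le> b" "a + b = 1"
  shows "(a * x + b * y) powr p \<le> a * x powr p + b * y powr p"
proof -
  have scale: "(c * z) powr p \<le> c * z powr p" if "0 \<le> c" "c \<le> 1" "0 \<le> z" for c z :: real
  proof (cases "c = 0")
    case False
    then have "c powr p \<le> c powr 1" using that p by (intro powr_mono') auto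
    then show ?thesis using that False by (simp add: powr_mult mult_right_mono)
  qed simp
  show ?thesis
  proof (cases "x = 0 \<or> y = 0")
    case True
    then show ?thesis using scale[of a x] scale[of b y] xy ab by auto
  next
    case False
    then have "x \<in> {0<..}" "y \<in> {0<..}" using xy by auto
    moreover have a: "a = 1 - b" using ab by simp
    ultimately show ?thesis
      unfolding a using convex_onD[OF powr_convex[OF p], of b x y] ab by simp
  qed
qed

text \<open>
  Minkowski's inequality. For finite exponents, \<open>(f + g) / (A + B)\<close> is a convex combination of
  \<open>f / A\<close> and \<open>g / B\<close> with weights \<open>A / (A + B)\<close> and \<open>B / (A + B)\<close>, and \<open>x \<mapsto> x powr p\<close> is
  convex.
\<close>

lemma Lp_le_add:
  assumes f: "Lp_le M \<mu> f A" and g: "Lp_le M \<mu> g B" and \<mu>: "1 \<le> \<mu>"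
  shows "Lp_le M \<mu> (\<lambda>t. f t + g t) (A + B)"
proof -
  have [measurable]: "f \<in> borel_measurable M" "g \<in> borel_measurable M"
    using f g by (auto dest: Lp_leD)
  have A0: "0 \<le> A" and B0: "0 \<le> B" using Lp_leD(2)[OF f] Lp_leD(2)[OF g] by auto
  show ?thesis
  proof (cases "A = 0 \<or> B = 0")
    case True
    then show ?thesis
    proof
      assume "A = 0"
      with f have "AE t in M. f t = 0" using Lp_le_null \<mu> by auto
      then have "AE t in M. \<bar>f t + g t\<bar> \<le> \<bar>g t\<bar>" by eventually_elim simp
      then show ?thesis using A0 by (intro Lp_le_mono[OF _ _ g]) auto
    next
      assume "B = 0"
      with g have "AE t in M. g t = 0" using Lp_le_null \<mu> by auto
      then have "AE t in M. \<bar>f t + g t\<bar> \<le> \<bar>f t\<bar>" by eventually_elim simp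
      then show ?thesis using B0 by (intro Lp_le_mono[OF _ _ f]) auto
    qed
  next
    case False
    then have A: "0 < A" and B: "0 < B" using A0 B0 by auto
    show ?thesis
    proof (cases "\<mu> = \<infinity>")
      case True
      have "AE t in M. \<bar>f t\<bar> \<le> A" "AE t in M. \<bar>g t\<bar> \<le> B" using f g True by (auto simp: Lp_le_def)
      then have "AE t in M. \<bar>f t + g t\<bar> \<le> A + B" by eventually_elim linarith
      then show ?thesis using A B True by (simp add: Lp_le_def)
    next
      case fin: False
      define p where "p = enn2real \<mu>"
      have p: "1 \<le> p" using exponent_ge[of 1 \<mu>] \<mu> fin by (simp add: p_def)
      define a where "a = A / (A + B)"
      define b where "b = B / (A + B)"
      have ab: "0 \<le> a" "0 \<le> b" "a + b = 1" using A B by (auto simp: a_def b_def divide_simps)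
      \<comment> \<open>Convexity turns into a linear inequality for the integrals, with total mass \<open>a + b = 1\<close>.\<close>
      have pt: "\<bar>f t + g t\<bar> powr p \<le> (A + B) powr p * (a / A powr p * \<bar>f t\<bar> powr p + b / B powr p * \<bar>g t\<bar> powr p)" for t
      proof -
        have "\<bar>f t + g t\<bar> powr p \<le> ((A + B) * (a * (\<bar>f t\<bar> / A) + b * (\<bar>g t\<bar> / B))) powr p"
        proof (rule powr_mono2)
          have "(A + B) * (a * (\<bar>f t\<bar> / A) + b * (\<bar>g t\<bar> / B)) = \<bar>f t\<bar> + \<bar>g t\<bar>"
            using A B by (simp add: a_def b_def distrib_left)
          then show "\<bar>f t + g t\<bar> \<le> (A + B) * (a * (\<bar>f t\<bar> / A) + b * (\<bar>g t\<bar> / B))" by simp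
        qed (use p in auto)
        also have "\<dots> = (A + B) powr p * (a * (\<bar>f t\<bar> / A) + b * (\<bar>g t\<bar> / B)) powr p"
          using A B ab by (subst powr_mult) auto
        also have "\<dots> \<le> (A + B) powr p * (a * (\<bar>f t\<bar> / A) powr p + b * (\<bar>g t\<bar> / B) powr p)"
        proof (rule mult_left_mono)
          show "(a * (\<bar>f t\<bar> / A) + b * (\<bar>g t\<bar> / B)) powr p \<le> a * (\<bar>f t\<bar> / A) powr p + b * (\<bar>g t\<bar> / B) powr p"
            using ab A B p by (intro powr_convex_combination) auto
        qed simp
        also have "\<dots> = (A + B) powr p * (a / A powr p * \<bar>f t\<bar> powr p + b / B powr p * \<bar>g t\<bar> powr p)"
          using A B by (simp add: powr_divide)
        finally show ?thesis .
      qed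
      have If: "(\<integral>\<^sup>+t. ennreal (\<bar>f t\<bar> powr p) \<partial>M) \<le> ennreal (A powr p)" and Ig: "(\<integral>\<^sup>+t. ennreal (\<bar>g t\<bar> powr p) \<partial>M) \<le> ennreal (B powr p)"
        using f g fin by (auto simp: Lp_le_def p_def)
      let ?c = "(A + B) powr p * (a / A powr p)" and ?d = "(A + B) powr p * (b / B powr p)"
      have cd: "0 \<le> ?c" "0 \<le> ?d" using ab by auto
      have "(\<integral>\<^sup>+t. ennreal (\<bar>f t + g t\<bar> powr p) \<partial>M) \<le>
        (\<integral>\<^sup>+t. ennreal ?c * ennreal (\<bar>f t\<bar> powr p) + ennreal ?d * ennreal (\<bar>g t\<bar> powr p) \<partial>M)"
      proof (rule nn_integral_mono)
        fix t
        have "ennreal (\<bar>f t + g t\<bar> powr p) \<le> ennreal (?c * \<bar>f t\<bar> powr p + ?d * \<bar>g t\<bar> powr p)"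
          using pt[of t] by (intro ennreal_leI) (simp only: distrib_left mult.assoc)
        also have "\<dots> = ennreal ?c * ennreal (\<bar>f t\<bar> powr p) + ennreal ?d * ennreal (\<bar>g t\<bar> powr p)"
          using cd by (simp only: ennreal_plus ennreal_mult powr_ge_zero mult_nonneg_nonneg)
        finally show "ennreal (\<bar>f t + g t\<bar> powr p) \<le> ennreal ?c * ennreal (\<bar>f t\<bar> powr p) + ennreal ?d * ennreal (\<bar>g t\<bar> powr p)" .
      qed
      also have "\<dots> = ennreal ?c * (\<integral>\<^sup>+t. ennreal (\<bar>f t\<bar> powr p) \<partial>M) + ennreal ?d * (\<integral>\<^sup>+t. ennreal (\<bar>g t\<bar> powr p) \<partial>M)"
        by (subst nn_integral_add) (auto simp: nn_integral_cmult)
      also have "\<dots> \<le> ennreal ?c * ennreal (A powr p) + ennreal ?d * ennreal (B powr p)"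
        by (intro add_mono mult_left_mono If Ig) auto
      also have "\<dots> = ennreal (?c * A powr p + ?d * B powr p)"
        using cd by (simp only: ennreal_plus ennreal_mult powr_ge_zero mult_nonneg_nonneg)
      also have "?c * A powr p + ?d * B powr p = (A + B) powr p"
        using A B ab(3) by (simp add: distrib_left[symmetric])
      finally show ?thesis using A B fin by (simp add: Lp_le_def p_def)
    qed
  qed
qed

lemma Lp_le_sum:
  assumes "finite J" "\<And>j. j \<in> J \<Longrightarrow> Lp_le M \<mu> (f j) (d j)" "1 \<le> \<mu>"
  shows "Lp_le M \<mu> (\<lambda>t. \<Sum>j\<in>J. f j t) (\<Sum>j\<in>J. d j)"
  using assms(1,2) by (induction J rule: finite_induct) (auto intro: Lp_le_zero Lp_le_add assms(3))

lemma Lp_le_square: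
  assumes "2 \<le> \<mu>" "f \<in> borel_measurable M" "0 \<le> B"
  shows "Lp_le M (\<mu> / 2) (\<lambda>t. (f t)\<^sup>2) (B\<^sup>2) \<longleftrightarrow> Lp_le M \<mu> f B"
proof (cases "\<mu> = \<infinity>")
  case True
  then have "\<mu> / 2 = \<infinity>" by (simp add: ennreal_top_divide)
  then show ?thesis using assms True by (auto simp: Lp_le_def abs_le_square_iff[symmetric])
next
  case False
  have h: "\<mu> / 2 \<noteq> \<infinity>" using False by (simp add: ennreal_divide_eq_top_iff)
  have e: "enn2real (\<mu> / 2) = enn2real \<mu> / 2"
    using False by (cases \<mu>) (auto simp: divide_ennreal[of _ 2, simplified])
  have sq: "x\<^sup>2 powr (enn2real \<mu> / 2) = \<bar>x\<bar> powr enn2real \<mu>" for x :: real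
  proof (cases "x = 0")
    case False
    then have "x\<^sup>2 powr (enn2real \<mu> / 2) = (\<bar>x\<bar> powr 2) powr (enn2real \<mu> / 2)" by (simp add: powr_numeral)
    then show ?thesis by (simp only: powr_powr) simp
  qed simp
  show ?thesis using assms False h by (simp add: Lp_le_def e sq)
qed

text \<open>
  Minkowski's inequality in \<open>L\<^bsup>\<mu>/2\<^esup>\<close> for the squares, which requires \<open>\<mu> \<ge> 2\<close>.
\<close>

lemma Lp_le_square_sum:
  assumes J: "finite J" and f: "\<And>j. j \<in> J \<Longrightarrow> Lp_le M \<mu> (f j) (d j)" and \<mu>: "2 \<le> \<mu>"
  shows "Lp_le M \<mu> (\<lambda>t. sqrt (\<Sum>j\<in>J. (f j t)\<^sup>2)) (sqrt (\<Sum>j\<in>J. (d j)\<^sup>2))"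
proof -
  have "1 \<le> \<mu> / 2"
    using divide_right_mono_ennreal[OF \<mu>, of 2] by (simp add: ennreal_divide_self)
  then have "Lp_le M (\<mu> / 2) (\<lambda>t. \<Sum>j\<in>J. (f j t)\<^sup>2) (\<Sum>j\<in>J. (d j)\<^sup>2)"
    using f by (intro Lp_le_sum[OF J] Lp_le_square[OF \<mu>, THEN iffD2]) (blast dest: Lp_leD)+
  moreover have "(\<lambda>t. sqrt (\<Sum>j\<in>J. (f j t)\<^sup>2)) \<in> borel_measurable M"
    by (rule measurable_compose[OF Lp_leD(1)[OF calculation]]) simp
  ultimately show ?thesis
    by (subst Lp_le_square[OF \<mu>, symmetric]) (auto simp: sum_nonneg)
qed

text \<open>
  By monotone convergence the supremum has a finite integral, so it is finite almost everywhere.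
\<close>

lemma Lp_le_incseq_AE_bounded:
  assumes f: "\<And>n. Lp_le M \<mu> (f n) B" and pos: "\<And>n t. 0 \<le> f n t"
    and mono: "AE t in M. incseq (\<lambda>n. f n t)" and \<mu>: "1 \<le> \<mu>"
  shows "AE t in M. \<exists>K. \<forall>n. f n t \<le> K"
proof (cases "\<mu> = \<infinity>")
  case True
  then have "AE t in M. \<forall>n. f n t \<le> B"
    unfolding AE_all_countable using f by (auto simp: Lp_le_def pos)
  then show ?thesis by (auto elim!: eventually_mono)
next
  case False
  define p where "p = enn2real \<mu>"
  have p: "1 \<le> p" using exponent_ge[of 1 \<mu>] \<mu> False by (simp add: p_def)
  have [measurable]: "f n \<in> borel_measurable M" for n using f by (auto dest: Lp_leD)
  have "(\<integral>\<^sup>+t. (SUP n. ennreal (f n t powr p)) \<partial>M) = (SUP n. \<integral>\<^sup>+t. ennreal (f n t powr p) \<partial>M)"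
    using mono p pos
    by (intro nn_integral_monotone_convergence_SUP_AE)
      (auto elim!: eventually_mono simp: incseq_Suc_iff intro!: ennreal_leI powr_mono2)
  also have "\<dots> \<le> ennreal (B powr p)"
    using f False pos by (intro SUP_least) (auto simp: Lp_le_def p_def)
  finally have "(\<integral>\<^sup>+t. (SUP n. ennreal (f n t powr p)) \<partial>M) \<noteq> \<infinity>"
    by (auto simp: top_unique)
  then have "AE t in M. (SUP n. ennreal (f n t powr p)) \<noteq> \<infinity>"
    by (intro nn_integral_noteq_infinite) auto
  then show ?thesis
  proof eventually_elim
    case (elim t)
    then obtain K where K: "0 \<le> K" "(SUP n. ennreal (f n t powr p)) = ennreal K"
      by (cases "SUP n. ennreal (f n t powr p)") (auto simp: top_ennreal_def)
    have "f n t \<le> K powr (1 / p)" for n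
    proof -
      have "ennreal (f n t powr p) \<le> ennreal K" using K(2) by (metis SUP_upper UNIV_I)
      then have "f n t powr p \<le> K" using K(1) by simp
      then have "(f n t powr p) powr (1 / p) \<le> K powr (1 / p)" using p by (intro powr_mono2) auto
      then show ?thesis using p pos[of n t] by (simp add: powr_powr)
    qed
    then show ?case by blast
  qed
qed

lemma Lp_le_limit:
  assumes f: "\<And>n. Lp_le M \<mu> (f n) B" and lim: "AE t in M. (\<lambda>n. f n t) \<longlonglongrightarrow> g t"
    and g: "g \<in> borel_measurable M" and \<mu>: "1 \<le> \<mu>"
  shows "Lp_le M \<mu> g B"
proof (cases "\<mu> = \<infinity>")
  case True
  then have "AE t in M. \<forall>n. \<bar>f n t\<bar> \<le> B"
    unfolding AE_all_countable using f by (auto simp: Lp_le_def)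
  with lim have "AE t in M. \<bar>g t\<bar> \<le> B"
  proof eventually_elim
    case (elim t)
    from tendsto_rabs[OF elim(1)] show ?case by (rule LIMSEQ_le_const2) (use elim(2) in auto)
  qed
  then show ?thesis using g True Lp_leD(2)[OF f] by (simp add: Lp_le_def)
next
  case False
  define p where "p = enn2real \<mu>"
  have p: "1 \<le> p" using exponent_ge[of 1 \<mu>] \<mu> False by (simp add: p_def)
  have [measurable]: "f n \<in> borel_measurable M" for n using f by (auto dest: Lp_leD)
  have "(\<integral>\<^sup>+t. ennreal (\<bar>g t\<bar> powr p) \<partial>M) \<le> (\<integral>\<^sup>+t. liminf (\<lambda>n. ennreal (\<bar>f n t\<bar> powr p)) \<partial>M)"
  proof (rule nn_integral_mono_AE, use lim in eventually_elim)
    case (elim t)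
    have "(\<lambda>n. ennreal (\<bar>f n t\<bar> powr p)) \<longlonglongrightarrow> ennreal (\<bar>g t\<bar> powr p)"
      using p by (intro tendsto_ennrealI tendsto_powr2 tendsto_rabs elim tendsto_const) auto
    from lim_imp_Liminf[OF sequentially_bot this] show ?case by simp
  qed
  also have "\<dots> \<le> liminf (\<lambda>n. \<integral>\<^sup>+t. ennreal (\<bar>f n t\<bar> powr p) \<partial>M)"
    by (rule nn_integral_liminf) measurable
  also have "\<dots> \<le> liminf (\<lambda>n. ennreal (B powr p))"
    using f False by (intro Liminf_mono always_eventually) (auto simp: Lp_le_def p_def)
  also have "\<dots> = ennreal (B powr p)" by (simp add: Liminf_const)
  finally show ?thesis using g False Lp_leD(2)[OF f] by (simp add: Lp_le_def p_def)
qed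

section \<open>Sobolev spaces on the Fourier side\<close>

text \<open>
  The Sobolev weight on the Fourier side.
\<close>

abbreviation wt :: "real \<Rightarrow> 'a::euclidean_space \<Rightarrow> real" where
  "wt \<sigma> \<xi> \<equiv> (1 + (norm \<xi>)\<^sup>2) powr \<sigma>"

text \<open>
  The square of the Sobolev norm of a distribution whose Fourier transform is \<open>g\<close>. As an extended
  number it is finite exactly when the distribution belongs to the Sobolev space.
\<close>

definition energy :: "real \<Rightarrow> ('a::euclidean_space \<Rightarrow> complex) \<Rightarrow> ennreal" where
  "energy \<sigma> g = (\<integral>\<^sup>+\<xi>. ennreal (wt \<sigma> \<xi> * (norm (g \<xi>))\<^sup>2) \<partial>lborel)"

lemma energy_Lp_le:
  assumes "g \<in> borel_measurable borel" "0 \<le> B"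
  shows "Lp_le lborel 2 (\<lambda>\<xi>. wt (\<sigma> / 2) \<xi> * norm (g \<xi>)) B \<longleftrightarrow> energy \<sigma> g \<le> ennreal (B\<^sup>2)"
proof -
  have "\<bar>wt (\<sigma> / 2) \<xi> * norm (g \<xi>)\<bar> powr 2 = wt \<sigma> \<xi> * (norm (g \<xi>))\<^sup>2" for \<xi>
  proof -
    have "\<bar>wt (\<sigma> / 2) \<xi> * norm (g \<xi>)\<bar> powr 2 = (wt (\<sigma> / 2) \<xi> * norm (g \<xi>))\<^sup>2"
      by (cases "wt (\<sigma> / 2) \<xi> * norm (g \<xi>) = 0") (auto simp: powr_numeral)
    also have "\<dots> = (wt (\<sigma> / 2) \<xi>)\<^sup>2 * (norm (g \<xi>))\<^sup>2" by (rule power_mult_distrib)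
    also have "(wt (\<sigma> / 2) \<xi>)\<^sup>2 = wt \<sigma> \<xi>"
      by (simp add: power2_eq_square powr_add[symmetric])
    finally show ?thesis .
  qed
  moreover have "B powr 2 = B\<^sup>2" using assms(2) by (cases "B = 0") (auto simp: powr_numeral)
  moreover have "(2::ennreal) \<noteq> \<infinity>" by simp
  ultimately show ?thesis
    using assms by (simp add: Lp_le_def energy_def)
qed

lemma sobolev_norm_nonneg: "0 \<le> sobolev_norm \<sigma> u"
  unfolding sobolev_norm_def Let_def by simp

lemma sobolevE:
  assumes "u \<in> sobolev \<sigma>"
  obtains g where "represents g (fourier_td u)"
  using assms by (auto simp: sobolev_def)

lemma td_apply_add: "schwartz f \<Longrightarrow> schwartz g \<Longrightarrow> td_apply u (\<lambda>x. f x + g x) = td_apply u f + td_apply u g"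
  using td_apply_tempered[of u] by (simp add: tempered_def)

lemma td_apply_cmult: "schwartz f \<Longrightarrow> td_apply u (\<lambda>x. c * f x) = c * td_apply u f"
  using td_apply_tempered[of u] by (simp add: tempered_def)

lemma td_apply_diff:
  assumes "schwartz f" "schwartz g"
  shows "td_apply u (\<lambda>x. f x - g x) = td_apply u f - td_apply u g"
  using td_apply_add[OF assms(1) schwartz_contD(1)[OF schwartz_cont_cmult[of "- 1"] assms(2)], of u]
    td_apply_cmult[OF assms(2), of u "- 1"] by simp

lemma schwartz_cont_diff:
  assumes A: "schwartz_cont A" and f: "schwartz f" "schwartz g"
  shows "A (\<lambda>x. f x - g x) = (\<lambda>x. A f x - A g x)"
  using schwartz_contD(2)[OF A f(1) schwartz_contD(1)[OF schwartz_cont_cmult[of "- 1"] f(2)]]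
    schwartz_contD(3)[OF A f(2), of "- 1"] by simp

definition cutoff_symbol :: "('a::euclidean_space \<Rightarrow> real) \<Rightarrow> bool" where
  "cutoff_symbol m \<longleftrightarrow> smooth m \<and> (\<exists>R. \<forall>\<xi>. R < norm \<xi> \<longrightarrow> m \<xi> = 0)"

lemma cutoff_symbol_diff:
  assumes "cutoff_symbol m1" "cutoff_symbol m2"
  shows "cutoff_symbol (\<lambda>\<xi>. m1 \<xi> - m2 \<xi>)"
proof -
  obtain R1 R2 where R: "\<And>\<xi>. R1 < norm \<xi> \<Longrightarrow> m1 \<xi> = 0" "\<And>\<xi>. R2 < norm \<xi> \<Longrightarrow> m2 \<xi> = 0"
    and s: "smooth m1" "smooth m2"
    using assms unfolding cutoff_symbol_def by blast
  have "smooth (\<lambda>\<xi>. m1 \<xi> - m2 \<xi>)"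
    using smooth_add[OF s(1) smooth_cmult[OF s(2), of "- 1"]] by simp
  moreover have "m1 \<xi> - m2 \<xi> = 0" if "max R1 R2 < norm \<xi>" for \<xi>
    using R that by simp
  ultimately show ?thesis unfolding cutoff_symbol_def by blast
qed

lemma cutoff_symbol_scale:
  assumes "cutoff_symbol m" "0 < a"
  shows "cutoff_symbol (\<lambda>\<xi>. m (\<xi> /\<^sub>R a))"
proof -
  obtain R where R: "\<And>\<xi>. R < norm \<xi> \<Longrightarrow> m \<xi> = 0" and s: "smooth m"
    using assms unfolding cutoff_symbol_def by blast
  have "m (\<xi> /\<^sub>R a) = 0" if "R * a < norm \<xi>" for \<xi>
    using that assms(2) by (intro R) (simp add: field_simps)
  then show ?thesis unfolding cutoff_symbol_def using smooth_scale[OF s] by blast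
qed

lemma schwartz_cont_symbol: "cutoff_symbol m \<Longrightarrow> schwartz_cont (\<lambda>f x. of_real (m x) * f x)"
  unfolding cutoff_symbol_def using schwartz_cont_cutoff by blast

lemma represents_multiplier:
  "cutoff_symbol m \<Longrightarrow> represents g (fourier_td u) \<Longrightarrow> represents (\<lambda>\<xi>. m \<xi> *\<^sub>R g \<xi>) (fourier_td (fourier_multiplier m u))"
  unfolding cutoff_symbol_def using represents_fourier_multiplier by blast

lemma td_apply_multiplier:
  assumes "cutoff_symbol m" "schwartz f"
  shows "td_apply (fourier_multiplier m u) f = td_apply u (fourier (\<lambda>x. of_real (m x) * inv_fourier f x))"
  using assms schwartz_contD(1)[OF schwartz_cont_inv_fourier assms(2)] schwartz_contD(1)[OF schwartz_cont_symbol[OF assms(1)]]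
  by (simp add: fourier_multiplier_def inv_fourier_td_def mult_td_def fourier_td_def td_apply_dual_op
      schwartz_cont_inv_fourier schwartz_cont_fourier schwartz_cont_symbol)

lemma fourier_multiplier_diff:
  assumes "cutoff_symbol m"
  shows "fourier_multiplier m (u - v) = fourier_multiplier m u - fourier_multiplier m v"
  by (rule td_eqI) (simp add: td_apply_multiplier[OF assms] minus_tempered_distribution.rep_eq)

lemma fourier_multiplier_symbol_diff:
  assumes m: "cutoff_symbol m1" "cutoff_symbol m2"
  shows "fourier_multiplier m1 u - fourier_multiplier m2 u = fourier_multiplier (\<lambda>\<xi>. m1 \<xi> - m2 \<xi>) u"
proof (rule td_eqI)
  fix f :: "'a \<Rightarrow> complex" assume f: "schwartz f"
  let ?F = "\<lambda>m x. complex_of_real (m x) * inv_fourier f x"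
  have S: "schwartz (?F m)" if "cutoff_symbol m" for m
    by (rule schwartz_contD(1)[OF schwartz_cont_symbol[OF that] schwartz_contD(1)[OF schwartz_cont_inv_fourier f]])
  have "fourier (?F (\<lambda>\<xi>. m1 \<xi> - m2 \<xi>)) = fourier (\<lambda>x. ?F m1 x - ?F m2 x)"
    by (simp add: left_diff_distrib)
  also have "\<dots> = (\<lambda>x. fourier (?F m1) x - fourier (?F m2) x)"
    by (rule schwartz_cont_diff[OF schwartz_cont_fourier S S]) (rule m)+
  finally have eq: "fourier (?F (\<lambda>\<xi>. m1 \<xi> - m2 \<xi>)) = (\<lambda>x. fourier (?F m1) x - fourier (?F m2) x)" .
  have "td_apply u (fourier (?F (\<lambda>\<xi>. m1 \<xi> - m2 \<xi>))) = td_apply u (fourier (?F m1)) - td_apply u (fourier (?F m2))"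
    unfolding eq by (intro td_apply_diff schwartz_contD(1)[OF schwartz_cont_fourier] S m)
  then show "td_apply (fourier_multiplier m1 u - fourier_multiplier m2 u) f = td_apply (fourier_multiplier (\<lambda>\<xi>. m1 \<xi> - m2 \<xi>) u) f"
    using f m cutoff_symbol_diff[OF m] by (simp add: td_apply_multiplier minus_tempered_distribution.rep_eq)
qed

locale littlewood_paley =
  fixes \<psi> :: "'a::euclidean_space \<Rightarrow> real"
  assumes cutoff: "LP_cutoff \<psi>"
begin

text \<open>
  Uniqueness of the representing function makes the choice inside \<open>sobolev_norm\<close> irrelevant.
\<close>

lemma sobolev_energy:
  assumes g: "represents g (fourier_td (u :: 'a tempered_distribution))"
  shows "u \<in> sobolev \<sigma> \<longleftrightarrow> energy \<sigma> g < \<infinity>"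
    and "u \<in> sobolev \<sigma> \<Longrightarrow> energy \<sigma> g = ennreal ((sobolev_norm \<sigma> u)\<^sup>2)"
proof -
  have mg: "g \<in> borel_measurable borel" by (rule representsD(1)[OF g])
  have int_iff: "integrable lborel (\<lambda>\<xi>. wt \<sigma> \<xi> * (norm (h \<xi>))\<^sup>2) \<longleftrightarrow> energy \<sigma> h < \<infinity>"
    if [measurable]: "h \<in> borel_measurable borel" for h :: "'a \<Rightarrow> complex"
  proof -
    have "(\<lambda>\<xi>. wt \<sigma> \<xi> * (norm (h \<xi>))\<^sup>2) \<in> borel_measurable lborel" by measurable
    then show ?thesis by (simp add: integrable_iff_bounded energy_def)
  qed
  have e: "energy \<sigma> h = energy \<sigma> g" if "represents h (fourier_td u)" for h
    unfolding energy_def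
    by (intro nn_integral_cong_AE eventually_mono[OF represents_unique[OF cutoff that g]]) simp
  show iff: "u \<in> sobolev \<sigma> \<longleftrightarrow> energy \<sigma> g < \<infinity>"
  proof
    assume "u \<in> sobolev \<sigma>"
    then obtain h where h: "represents h (fourier_td u)" and i: "integrable lborel (\<lambda>\<xi>. wt \<sigma> \<xi> * (norm (h \<xi>))\<^sup>2)"
      unfolding sobolev_def by blast
    show "energy \<sigma> g < \<infinity>" using i e[OF h] int_iff[OF representsD(1)[OF h]] by simp
  next
    assume "energy \<sigma> g < \<infinity>"
    then show "u \<in> sobolev \<sigma>" unfolding sobolev_def using g int_iff[OF mg] by blast
  qed
  assume u: "u \<in> sobolev \<sigma>"
  define h where "h = (SOME g. represents g (fourier_td u))"
  have h: "represents h (fourier_td u)" unfolding h_def by (rule someI[of "\<lambda>g. represents g (fourier_td u)", OF g])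
  have "energy \<sigma> h < \<infinity>" using u iff e[OF h] by simp
  then have int: "integrable lborel (\<lambda>\<xi>. wt \<sigma> \<xi> * (norm (h \<xi>))\<^sup>2)"
    using int_iff representsD(1)[OF h] by blast
  have "energy \<sigma> h = ennreal (LINT \<xi>|lborel. wt \<sigma> \<xi> * (norm (h \<xi>))\<^sup>2)"
    unfolding energy_def by (rule nn_integral_eq_integral[OF int]) simp
  also have "(LINT \<xi>|lborel. wt \<sigma> \<xi> * (norm (h \<xi>))\<^sup>2) = (sobolev_norm \<sigma> u)\<^sup>2"
    unfolding sobolev_norm_def Let_def h_def[symmetric] by simp
  finally show "energy \<sigma> g = ennreal ((sobolev_norm \<sigma> u)\<^sup>2)" by (simp add: e[OF h])
qed

lemma sobolev_le_iff:
  assumes g: "represents g (fourier_td (u :: 'a tempered_distribution))" and B: "0 \<le> B"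
  shows "u \<in> sobolev \<sigma> \<and> sobolev_norm \<sigma> u \<le> B \<longleftrightarrow> energy \<sigma> g \<le> ennreal (B\<^sup>2)"
proof (cases "u \<in> sobolev \<sigma>")
  case True
  have "sobolev_norm \<sigma> u \<le> B \<longleftrightarrow> (sobolev_norm \<sigma> u)\<^sup>2 \<le> B\<^sup>2"
    using sobolev_norm_nonneg[of \<sigma> u] B by (auto intro: power_mono power2_le_imp_le)
  then show ?thesis using True sobolev_energy(2)[OF g True] by simp
next
  case False
  then have "energy \<sigma> g = \<infinity>" using sobolev_energy(1)[OF g] by (simp add: less_top[symmetric])
  then show ?thesis using False by (simp add: top_unique)
qed

text \<open>
  Reduces the comparison of two Sobolev norms, possibly of different distributions and orders, to a
  pointwise inequality between weighted densities.
\<close>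

lemma sobolev_compare:
  assumes g: "represents g (fourier_td (u :: 'a tempered_distribution))" and h: "represents h (fourier_td v)"
    and le: "\<And>\<xi>. wt \<tau> \<xi> * (norm (h \<xi>))\<^sup>2 \<le> K\<^sup>2 * (wt \<sigma> \<xi> * (norm (g \<xi>))\<^sup>2)"
    and K: "0 \<le> K" and u: "u \<in> sobolev \<sigma>"
  shows "v \<in> sobolev \<tau>" "sobolev_norm \<tau> v \<le> K * sobolev_norm \<sigma> u"
proof -
  have [measurable]: "g \<in> borel_measurable borel" by (rule representsD(1)[OF g])
  have "energy \<tau> h \<le> (\<integral>\<^sup>+\<xi>. ennreal (K\<^sup>2) * ennreal (wt \<sigma> \<xi> * (norm (g \<xi>))\<^sup>2) \<partial>lborel)"
    unfolding energy_def using le by (intro nn_integral_mono) (simp add: ennreal_mult'[symmetric] ennreal_leI)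
  also have "\<dots> = ennreal (K\<^sup>2) * energy \<sigma> g"
    unfolding energy_def by (rule nn_integral_cmult) measurable
  also have "\<dots> = ennreal ((K * sobolev_norm \<sigma> u)\<^sup>2)"
    unfolding sobolev_energy(2)[OF g u] by (simp add: ennreal_mult'[symmetric] power_mult_distrib)
  finally have "energy \<tau> h \<le> ennreal ((K * sobolev_norm \<sigma> u)\<^sup>2)" .
  then have "v \<in> sobolev \<tau> \<and> sobolev_norm \<tau> v \<le> K * sobolev_norm \<sigma> u"
    using K by (subst sobolev_le_iff[OF h]) (auto simp: sobolev_norm_nonneg)
  then show "v \<in> sobolev \<tau>" "sobolev_norm \<tau> v \<le> K * sobolev_norm \<sigma> u" by auto
qed

lemma sobolev_mono:
  assumes "u \<in> sobolev \<sigma>" "\<tau> \<le> \<sigma>"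
  shows "(u :: 'a tempered_distribution) \<in> sobolev \<tau>" "sobolev_norm \<tau> u \<le> sobolev_norm \<sigma> u"
proof -
  obtain g where g: "represents g (fourier_td u)" using sobolevE[OF assms(1)] .
  have "wt \<tau> \<xi> * (norm (g \<xi>))\<^sup>2 \<le> 1\<^sup>2 * (wt \<sigma> \<xi> * (norm (g \<xi>))\<^sup>2)" for \<xi>
    using assms(2) by (simp add: mult_right_mono powr_mono)
  from sobolev_compare[OF g g this _ assms(1)]
  show "u \<in> sobolev \<tau>" "sobolev_norm \<tau> u \<le> sobolev_norm \<sigma> u" by auto
qed

text \<open>
  Minkowski's inequality in the weighted space. The domination by two representing functions covers
  sums and differences alike.
\<close>

lemma sobolev_norm_le_sum:
  assumes u: "(u :: 'a tempered_distribution) \<in> sobolev \<sigma>" and v: "v \<in> sobolev \<sigma>"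
    and g: "represents g (fourier_td u)" and h: "represents h (fourier_td v)"
    and f: "represents f (fourier_td w)" and fgh: "\<And>\<xi>. norm (f \<xi>) \<le> norm (g \<xi>) + norm (h \<xi>)"
  shows "w \<in> sobolev \<sigma> \<and> sobolev_norm \<sigma> w \<le> sobolev_norm \<sigma> u + sobolev_norm \<sigma> v"
proof -
  have [measurable]: "f \<in> borel_measurable borel" by (rule representsD(1)[OF f])
  have "Lp_le lborel 2 (\<lambda>\<xi>. wt (\<sigma> / 2) \<xi> * norm (g \<xi>)) (sobolev_norm \<sigma> u)"
    using sobolev_energy(2)[OF g u] representsD(1)[OF g] by (subst energy_Lp_le) (auto simp: sobolev_norm_nonneg)
  moreover have "Lp_le lborel 2 (\<lambda>\<xi>. wt (\<sigma> / 2) \<xi> * norm (h \<xi>)) (sobolev_norm \<sigma> v)"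
    using sobolev_energy(2)[OF h v] representsD(1)[OF h] by (subst energy_Lp_le) (auto simp: sobolev_norm_nonneg)
  ultimately have "Lp_le lborel 2 (\<lambda>\<xi>. wt (\<sigma> / 2) \<xi> * norm (g \<xi>) + wt (\<sigma> / 2) \<xi> * norm (h \<xi>))
     (sobolev_norm \<sigma> u + sobolev_norm \<sigma> v)"
    by (rule Lp_le_add) simp
  then have "Lp_le lborel 2 (\<lambda>\<xi>. wt (\<sigma> / 2) \<xi> * norm (f \<xi>)) (sobolev_norm \<sigma> u + sobolev_norm \<sigma> v)"
  proof (rule Lp_le_mono[rotated 2])
    have "wt (\<sigma> / 2) \<xi> * norm (f \<xi>) \<le> wt (\<sigma> / 2) \<xi> * norm (g \<xi>) + wt (\<sigma> / 2) \<xi> * norm (h \<xi>)" for \<xi>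
      unfolding distrib_left[symmetric] by (intro mult_left_mono fgh) simp
    then show "AE \<xi> in lborel. \<bar>wt (\<sigma> / 2) \<xi> * norm (f \<xi>)\<bar> \<le> \<bar>wt (\<sigma> / 2) \<xi> * norm (g \<xi>) + wt (\<sigma> / 2) \<xi> * norm (h \<xi>)\<bar>"
      by (intro AE_I2) (simp add: abs_of_nonneg)
  qed auto
  then show ?thesis
    using sobolev_norm_nonneg[of \<sigma> u] sobolev_norm_nonneg[of \<sigma> v] representsD(1)[OF f]
    by (subst sobolev_le_iff[OF f]) (auto simp: energy_Lp_le)
qed

lemma sobolev_diff:
  assumes "(u :: 'a tempered_distribution) \<in> sobolev \<sigma>" "v \<in> sobolev \<sigma>"
  shows "u - v \<in> sobolev \<sigma>" "sobolev_norm \<sigma> (u - v) \<le> sobolev_norm \<sigma> u + sobolev_norm \<sigma> v"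
proof -
  obtain g h where g: "represents g (fourier_td u)" and h: "represents h (fourier_td v)"
    using sobolevE assms by metis
  from sobolev_norm_le_sum[OF assms g h represents_diff[OF g h, folded fourier_td_diff] norm_triangle_ineq4]
  show "u - v \<in> sobolev \<sigma>" "sobolev_norm \<sigma> (u - v) \<le> sobolev_norm \<sigma> u + sobolev_norm \<sigma> v" by auto
qed

lemma sobolev_add:
  assumes "(u :: 'a tempered_distribution) \<in> sobolev \<sigma>" "v \<in> sobolev \<sigma>"
  shows "u + v \<in> sobolev \<sigma>" "sobolev_norm \<sigma> (u + v) \<le> sobolev_norm \<sigma> u + sobolev_norm \<sigma> v"
proof -
  obtain g h where g: "represents g (fourier_td u)" and h: "represents h (fourier_td v)"
    using sobolevE assms by metis
  from sobolev_norm_le_sum[OF assms g h represents_add[OF g h, folded fourier_td_add] norm_triangle_ineq]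
  show "u + v \<in> sobolev \<sigma>" "sobolev_norm \<sigma> (u + v) \<le> sobolev_norm \<sigma> u + sobolev_norm \<sigma> v" by auto
qed

lemma sobolev_norm_minus_commute:
  assumes "(u :: 'a tempered_distribution) \<in> sobolev \<sigma>" "v \<in> sobolev \<sigma>"
  shows "sobolev_norm \<sigma> (u - v) = sobolev_norm \<sigma> (v - u)"
proof -
  obtain g h where g: "represents g (fourier_td u)" and h: "represents h (fourier_td v)"
    using sobolevE assms by metis
  note gh = represents_diff[OF g h, folded fourier_td_diff] and hg = represents_diff[OF h g, folded fourier_td_diff]
  have "sobolev_norm \<sigma> (u - v) \<le> 1 * sobolev_norm \<sigma> (v - u)"
    using sobolev_diff assms by (intro sobolev_compare[OF hg gh]) (auto simp: norm_minus_commute)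
  moreover have "sobolev_norm \<sigma> (v - u) \<le> 1 * sobolev_norm \<sigma> (u - v)"
    using sobolev_diff assms by (intro sobolev_compare[OF gh hg]) (auto simp: norm_minus_commute)
  ultimately show ?thesis by simp
qed

lemma sobolev_norm_self_diff:
  assumes "(u :: 'a tempered_distribution) \<in> sobolev \<sigma>"
  shows "sobolev_norm \<sigma> (u - u) = 0"
proof -
  obtain g where g: "represents g (fourier_td u)" using sobolevE[OF assms] .
  have "sobolev_norm \<sigma> (u - u) \<le> 0 * sobolev_norm \<sigma> u"
    using assms by (intro sobolev_compare[OF g represents_diff[OF g g, folded fourier_td_diff]]) auto
  then show ?thesis using sobolev_norm_nonneg[of \<sigma> "u - u"] by simp
qed

lemma sobolev_norm_triangle:
  assumes "(u :: 'a tempered_distribution) \<in> sobolev \<sigma>" "v \<in> sobolev \<sigma>" "w \<in> sobolev \<sigma>"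
  shows "sobolev_norm \<sigma> (u - w) \<le> sobolev_norm \<sigma> (u - v) + sobolev_norm \<sigma> (v - w)"
  using sobolev_add(2)[OF sobolev_diff(1)[OF assms(1,2)] sobolev_diff(1)[OF assms(2,3)]] by simp

lemma sobolev_norm_abs_diff:
  assumes "(u :: 'a tempered_distribution) \<in> sobolev \<sigma>" "v \<in> sobolev \<sigma>"
  shows "\<bar>sobolev_norm \<sigma> u - sobolev_norm \<sigma> v\<bar> \<le> sobolev_norm \<sigma> (u - v)"
  using sobolev_add(2)[OF sobolev_diff(1)[OF assms] assms(2)]
    sobolev_add(2)[OF sobolev_diff(1)[OF assms(2,1)] assms(1)] sobolev_norm_minus_commute[OF assms]
  by simp

section \<open>Littlewood-Paley blocks in Sobolev spaces\<close>

definition low_symbol :: "nat \<Rightarrow> 'a \<Rightarrow> real" where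
  "low_symbol n \<xi> = \<psi> (\<xi> /\<^sub>R 2 ^ n)"

definition block_symbol :: "nat \<Rightarrow> 'a \<Rightarrow> real" where
  "block_symbol j = (if j = 0 then \<psi> else (\<lambda>\<xi>. LP_annulus \<psi> (\<xi> /\<^sub>R 2 ^ (j - 1))))"

definition lowpass :: "nat \<Rightarrow> 'a tempered_distribution \<Rightarrow> 'a tempered_distribution" where
  "lowpass n = fourier_multiplier (low_symbol n)"

lemma LP_block_eq: "LP_block \<psi> j = fourier_multiplier (block_symbol j)"
  by (simp add: LP_block_def block_symbol_def)

lemma block_symbol_0: "block_symbol 0 = low_symbol 0"
  by (simp add: block_symbol_def low_symbol_def fun_eq_iff)

lemma block_symbol_Suc: "block_symbol (Suc n) = (\<lambda>\<xi>. low_symbol (Suc n) \<xi> - low_symbol n \<xi>)"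
  by (simp add: block_symbol_def low_symbol_def LP_annulus_def fun_eq_iff mult.commute)

lemma sum_block_symbol: "(\<Sum>j\<le>n. block_symbol j \<xi>) = low_symbol n \<xi>"
  by (induction n) (simp_all add: block_symbol_0 block_symbol_Suc)

lemma cutoff_symbol_low: "cutoff_symbol (low_symbol n)"
proof -
  have "smooth \<psi>" "\<psi> \<xi> = 0" if "1 < norm \<xi>" for \<xi>
    using cutoff that by (auto simp: LP_cutoff_def)
  moreover have "smooth \<psi>" using cutoff by (simp add: LP_cutoff_def)
  ultimately have "cutoff_symbol \<psi>" unfolding cutoff_symbol_def by blast
  from cutoff_symbol_scale[OF this, of "2 ^ n"] show ?thesis
    unfolding low_symbol_def[abs_def] by simp
qed

lemma cutoff_symbol_block: "cutoff_symbol (block_symbol j)"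
  by (cases j) (simp_all add: block_symbol_0 block_symbol_Suc cutoff_symbol_diff cutoff_symbol_low)

lemma low_symbol_bounds: "0 \<le> low_symbol n \<xi>" "low_symbol n \<xi> \<le> 1"
  using cutoff by (auto simp: low_symbol_def LP_cutoff_def)

lemma block_symbol_bounds: "0 \<le> block_symbol j \<xi>" "block_symbol j \<xi> \<le> 1"
  using cutoff by (auto simp: block_symbol_def LP_cutoff_def)

lemma low_symbol_eq_1: "norm \<xi> \<le> 3 / 4 * 2 ^ n \<Longrightarrow> low_symbol n \<xi> = 1"
  using cutoff by (simp add: low_symbol_def LP_cutoff_def field_simps)

lemma low_symbol_eq_0: "2 ^ n \<le> norm \<xi> \<Longrightarrow> low_symbol n \<xi> = 0"
  using cutoff by (simp add: low_symbol_def LP_cutoff_def field_simps)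

lemma low_symbol_mono: "m \<le> n \<Longrightarrow> low_symbol m \<xi> \<le> low_symbol n \<xi>"
  unfolding sum_block_symbol[symmetric] by (intro sum_mono2) (auto simp: block_symbol_bounds)

lemma low_symbol_tendsto: "(\<lambda>n. low_symbol n \<xi>) \<longlonglongrightarrow> 1"
proof -
  obtain N :: nat where "4 / 3 * norm \<xi> < 2 ^ N" using real_arch_pow[of 2 "4 / 3 * norm \<xi>"] by auto
  have "low_symbol n \<xi> = 1" if "N \<le> n" for n
  proof (rule low_symbol_eq_1)
    have "(2::real) ^ N \<le> 2 ^ n" using that by simp
    then show "norm \<xi> \<le> 3 / 4 * 2 ^ n" using \<open>4 / 3 * norm \<xi> < 2 ^ N\<close> by linarith
  qed
  then show ?thesis by (intro tendsto_eventually) (auto simp: eventually_sequentially)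
qed

lemma block_symbol_support:
  assumes "block_symbol j \<xi> \<noteq> 0"
  shows "norm \<xi> < 2 ^ j" "j = 0 \<or> 3 / 8 * 2 ^ j < norm \<xi>"
proof -
  have "norm \<xi> < 2 ^ j \<and> (j = 0 \<or> 3 / 8 * 2 ^ j < norm \<xi>)"
  proof (cases j)
    case 0
    then show ?thesis using low_symbol_eq_0[of 0 \<xi>] assms by (auto simp: block_symbol_0 not_less[symmetric])
  next
    case (Suc n)
    have "\<not> 2 ^ Suc n \<le> norm \<xi>"
    proof
      assume *: "2 ^ Suc n \<le> norm \<xi>"
      then have "2 ^ n \<le> norm \<xi>" using order_trans[of "2 ^ n" "2 ^ Suc n :: real"] by simp
      then show False using assms low_symbol_eq_0[of n \<xi>] low_symbol_eq_0[OF *] by (simp add: Suc block_symbol_Suc)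
    qed
    moreover have "\<not> norm \<xi> \<le> 3 / 4 * 2 ^ n"
    proof
      assume *: "norm \<xi> \<le> 3 / 4 * 2 ^ n"
      then have "norm \<xi> \<le> 3 / 4 * 2 ^ Suc n" by (rule order_trans) simp
      from low_symbol_eq_1[OF *] low_symbol_eq_1[OF this] show False
        using assms by (simp add: Suc block_symbol_Suc)
    qed
    ultimately show ?thesis by (simp add: Suc)
  qed
  then show "norm \<xi> < 2 ^ j" "j = 0 \<or> 3 / 8 * 2 ^ j < norm \<xi>" by auto
qed

text \<open>
  A frequency in the supports of blocks \<open>k < j\<close> satisfies \<open>3/8 2\<^sup>j < \<bar>\<xi>\<bar> < 2\<^sup>k\<close>, which forces
  \<open>j = k + 1\<close>.
\<close>

lemma card_block_support: "card {j. j \<le> n \<and> block_symbol j \<xi> \<noteq> 0} \<le> 2"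
proof (cases "{j. j \<le> n \<and> block_symbol j \<xi> \<noteq> 0} = {}")
  case False
  define A where "A = {j. j \<le> n \<and> block_symbol j \<xi> \<noteq> 0}"
  define k where "k = Min A"
  have A: "finite A" "A \<noteq> {}" using False by (auto simp: A_def)
  have k: "k \<in> A" "\<And>j. j \<in> A \<Longrightarrow> k \<le> j" using A by (auto simp: k_def)
  have "j \<le> Suc k" if j: "j \<in> A" for j
  proof (rule ccontr)
    assume "\<not> j \<le> Suc k"
    then have jk: "k + 2 \<le> j" by simp
    then have "3 / 8 * 2 ^ j < norm \<xi>" using block_symbol_support(2)[of j \<xi>] j by (auto simp: A_def)
    moreover have "norm \<xi> < 2 ^ k" using block_symbol_support(1)[of k \<xi>] k(1) by (auto simp: A_def)
    moreover have "(2::real) ^ (k + 2) \<le> 2 ^ j" using jk by (intro power_increasing) auto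
    moreover have "(0::real) < 2 ^ k" by simp
    moreover have "(2::real) ^ (k + 2) = 4 * 2 ^ k" by simp
    ultimately show False by linarith
  qed
  then have "A \<subseteq> {k, Suc k}" using k(2) by (auto simp: le_Suc_eq dest: antisym)
  then have "card A \<le> card {k, Suc k}" by (intro card_mono) auto
  then show ?thesis by (simp add: A_def)
next
  case True
  show ?thesis unfolding True by simp
qed

text \<open>
  The symbol of \<open>S\<^sub>n\<close> is a sum of block symbols of which at most two are nonzero at a given frequency.
  This almost orthogonality controls a norm by the square sum of its blocks.
\<close>

lemma low_symbol_square_le: "(low_symbol n \<xi>)\<^sup>2 \<le> 2 * (\<Sum>j\<le>n. (block_symbol j \<xi>)\<^sup>2)"
proof -
  define A where "A = {j. j \<le> n \<and> block_symbol j \<xi> \<noteq> 0}"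
  have A: "(\<Sum>j\<le>n. f (block_symbol j \<xi>)) = (\<Sum>j\<in>A. f (block_symbol j \<xi>))" if "f 0 = 0" for f :: "real \<Rightarrow> real"
    using that by (intro sum.mono_neutral_right) (auto simp: A_def)
  have "(low_symbol n \<xi>)\<^sup>2 = (\<Sum>j\<in>A. block_symbol j \<xi>)\<^sup>2"
    unfolding sum_block_symbol[symmetric] using A[of "\<lambda>x. x"] by simp
  also have "\<dots> \<le> (\<Sum>j\<in>A. (block_symbol j \<xi>)\<^sup>2) * card A"
    by (rule sum_squared_le_sum_of_squares)
  also have "\<dots> \<le> (\<Sum>j\<in>A. (block_symbol j \<xi>)\<^sup>2) * 2"
    using card_block_support[of n \<xi>] by (intro mult_left_mono) (auto simp: A_def sum_nonneg)
  finally show ?thesis using A[of "\<lambda>x. x\<^sup>2"] by simp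
qed

lemma sum_block_symbol_square_le: "(\<Sum>j\<le>n. (block_symbol j \<xi>)\<^sup>2) \<le> 1"
proof -
  have "(\<Sum>j\<le>n. (block_symbol j \<xi>)\<^sup>2) \<le> (\<Sum>j\<le>n. block_symbol j \<xi>)"
    using block_symbol_bounds by (intro sum_mono) (simp add: power2_eq_square mult_left_le)
  then show ?thesis using low_symbol_bounds(2)[of n \<xi>] by (simp add: sum_block_symbol)
qed

text \<open>
  The cost of a change of regularity by \<open>d\<close> on block \<open>j\<close>. The factor \<open>8\<close> reflects that
  \<open>(1 + \<bar>\<xi>\<bar>\<^sup>2) / 4\<^sup>j\<close> lies between \<open>1/8\<close> and \<open>8\<close> on the support of that block.
\<close>

definition bernstein :: "nat \<Rightarrow> real \<Rightarrow> real" where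
  "bernstein j d = 8 powr \<bar>d\<bar> * 2 powr (real j * d)"

lemma bernstein_nonneg: "0 \<le> bernstein j d"
  by (simp add: bernstein_def)

lemma wt_block_le:
  assumes "block_symbol j \<xi> \<noteq> 0"
  shows "wt \<tau> \<xi> \<le> (bernstein j (\<tau> - \<sigma>))\<^sup>2 * wt \<sigma> \<xi>"
proof -
  define d where "d = \<tau> - \<sigma>"
  define y where "y = 1 + (norm \<xi>)\<^sup>2"
  define q where "q = y / 4 ^ j"
  have y: "0 < y" by (simp add: y_def add_pos_nonneg)
  have p4: "(4::real) ^ j = (2 ^ j)\<^sup>2" by (simp add: power2_eq_square power_mult_distrib[symmetric])
  have "(norm \<xi>)\<^sup>2 \<le> (2 ^ j)\<^sup>2"
    using block_symbol_support(1)[OF assms] by (intro power_mono) auto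
  then have "y \<le> 8 * 4 ^ j" using one_le_power[of "4::real" j] unfolding y_def p4[symmetric] by linarith
  then have q8: "q \<le> 8" by (simp add: q_def divide_simps)
  have "4 ^ j \<le> 8 * y"
  proof (cases "j = 0")
    case False
    then have "3 / 8 * 2 ^ j \<le> norm \<xi>" using block_symbol_support(2)[OF assms] by auto
    then have "(3 / 8 * 2 ^ j)\<^sup>2 \<le> (norm \<xi>)\<^sup>2" by (intro power_mono) auto
    then have "9 / 64 * 4 ^ j \<le> (norm \<xi>)\<^sup>2" unfolding p4 by (simp add: power_mult_distrib power2_eq_square)
    moreover have "(0::real) \<le> 4 ^ j" by simp
    moreover have "9 / 64 * P \<le> N \<Longrightarrow> 0 \<le> P \<Longrightarrow> P \<le> 8 * (1 + N)" for P N :: real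
      by simp
    ultimately show ?thesis unfolding y_def by blast
  qed (simp add: y_def)
  then have q18: "1 / q \<le> 8" using y by (simp add: q_def divide_simps)
  have q: "0 < q" using y by (simp add: q_def)
  have "q powr d \<le> 8 powr \<bar>d\<bar>"
  proof (cases "0 \<le> d")
    case True
    then show ?thesis using q q8 by (simp add: powr_mono2)
  next
    case False
    have "q powr d = (1 / q) powr (- d)" using q by (simp add: powr_divide powr_minus_divide)
    also have "\<dots> \<le> 8 powr (- d)" using False q q18 by (intro powr_mono2) auto
    finally show ?thesis using False by simp
  qed
  moreover have "8 powr \<bar>d\<bar> \<le> (8 powr \<bar>d\<bar>)\<^sup>2"
    using ge_one_powr_ge_zero[of 8 "\<bar>d\<bar>"] by (simp add: self_le_power)
  ultimately have qd: "q powr d \<le> (8 powr \<bar>d\<bar>)\<^sup>2" by linarith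
  have "y powr \<tau> = y powr d * y powr \<sigma>"
    by (simp add: d_def powr_add[symmetric])
  also have "y powr d = q powr d * (4 ^ j) powr d"
    using q by (simp add: q_def powr_mult[symmetric] y)
  also have "(4 ^ j) powr d = (2 powr (real j * d))\<^sup>2"
  proof -
    have "((4::real) ^ j) powr d = (2 ^ j) powr d * (2 ^ j) powr d"
      unfolding p4 power2_eq_square by (simp add: powr_mult)
    also have "(2 ^ j) powr d = (2::real) powr (real j * d)"
      by (simp add: powr_realpow[symmetric] powr_powr)
    finally show ?thesis by (simp add: power2_eq_square)
  qed
  also have "q powr d * (2 powr (real j * d))\<^sup>2 * y powr \<sigma> \<le> (8 powr \<bar>d\<bar>)\<^sup>2 * (2 powr (real j * d))\<^sup>2 * y powr \<sigma>"
    by (intro mult_right_mono qd) auto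
  finally show ?thesis by (simp add: bernstein_def power_mult_distrib d_def y_def)
qed

lemma block_bernstein:
  assumes u: "u \<in> sobolev \<rho>" and b: "LP_block \<psi> j u \<in> sobolev \<sigma>"
  shows "LP_block \<psi> j u \<in> sobolev \<tau>"
    and "sobolev_norm \<tau> (LP_block \<psi> j u) \<le> bernstein j (\<tau> - \<sigma>) * sobolev_norm \<sigma> (LP_block \<psi> j u)"
proof -
  obtain g where g: "represents g (fourier_td u)" using sobolevE[OF u] .
  note r = represents_multiplier[OF cutoff_symbol_block g, of j, folded LP_block_eq]
  have "wt \<tau> \<xi> * (norm (block_symbol j \<xi> *\<^sub>R g \<xi>))\<^sup>2
    \<le> (bernstein j (\<tau> - \<sigma>))\<^sup>2 * (wt \<sigma> \<xi> * (norm (block_symbol j \<xi> *\<^sub>R g \<xi>))\<^sup>2)" for \<xi>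
    using mult_right_mono[OF wt_block_le[of j \<xi> \<tau> \<sigma>], of "(norm (block_symbol j \<xi> *\<^sub>R g \<xi>))\<^sup>2"]
    by (cases "block_symbol j \<xi> = 0") (auto simp: mult.assoc)
  from sobolev_compare[OF r r this bernstein_nonneg b]
  show "LP_block \<psi> j u \<in> sobolev \<tau>"
    "sobolev_norm \<tau> (LP_block \<psi> j u) \<le> bernstein j (\<tau> - \<sigma>) * sobolev_norm \<sigma> (LP_block \<psi> j u)" .
qed

lemma multiplier_contraction:
  assumes u: "(u :: 'a tempered_distribution) \<in> sobolev \<sigma>" and m: "cutoff_symbol m" "\<And>\<xi>. 0 \<le> m \<xi>" "\<And>\<xi>. m \<xi> \<le> 1"
  shows "fourier_multiplier m u \<in> sobolev \<sigma>" "sobolev_norm \<sigma> (fourier_multiplier m u) \<le> sobolev_norm \<sigma> u"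
proof -
  obtain g where g: "represents g (fourier_td u)" using sobolevE[OF u] .
  have "wt \<sigma> \<xi> * (norm (m \<xi> *\<^sub>R g \<xi>))\<^sup>2 \<le> 1\<^sup>2 * (wt \<sigma> \<xi> * (norm (g \<xi>))\<^sup>2)" for \<xi>
  proof -
    have "norm (m \<xi> *\<^sub>R g \<xi>) \<le> 1 * norm (g \<xi>)"
      using m(2,3)[of \<xi>] unfolding norm_scaleR by (intro mult_right_mono) auto
    then have "(norm (m \<xi> *\<^sub>R g \<xi>))\<^sup>2 \<le> (norm (g \<xi>))\<^sup>2" by (intro power_mono) auto
    from mult_left_mono[OF this, of "wt \<sigma> \<xi>"] show ?thesis by simp
  qed
  from sobolev_compare[OF g represents_multiplier[OF m(1) g] this _ u]
  show "fourier_multiplier m u \<in> sobolev \<sigma>" "sobolev_norm \<sigma> (fourier_multiplier m u) \<le> sobolev_norm \<sigma> u"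
    by auto
qed

lemmas block_contraction = multiplier_contraction[OF _ cutoff_symbol_block block_symbol_bounds, folded LP_block_eq]
lemmas lowpass_contraction = multiplier_contraction[OF _ cutoff_symbol_low low_symbol_bounds, folded lowpass_def]

lemma block_le:
  assumes "u \<in> sobolev \<sigma>"
  shows "LP_block \<psi> j u \<in> sobolev \<tau>"
    and "sobolev_norm \<tau> (LP_block \<psi> j u) \<le> bernstein j (\<tau> - \<sigma>) * sobolev_norm \<sigma> u"
  using block_bernstein[OF assms block_contraction(1)[OF assms], where j = j and \<tau> = \<tau>]
    mult_left_mono[OF block_contraction(2)[OF assms, where j = j] bernstein_nonneg[of j "\<tau> - \<sigma>"]] by auto

lemma lowpass_le:
  assumes u: "u \<in> sobolev \<sigma>"
  shows "lowpass n u \<in> sobolev \<tau>"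
    and "sobolev_norm \<tau> (lowpass n u) \<le> (1 + 4 ^ n) powr \<bar>\<tau> - \<sigma>\<bar> * sobolev_norm \<sigma> u"
proof -
  obtain g where g: "represents g (fourier_td u)" using sobolevE[OF u] .
  let ?K = "(1 + 4 ^ n) powr \<bar>\<tau> - \<sigma>\<bar> :: real"
  have "wt \<tau> \<xi> * (norm (low_symbol n \<xi> *\<^sub>R g \<xi>))\<^sup>2 \<le> ?K\<^sup>2 * (wt \<sigma> \<xi> * (norm (g \<xi>))\<^sup>2)" for \<xi>
  proof (cases "2 ^ n \<le> norm \<xi>")
    case True
    then have "low_symbol n \<xi> = 0" by (rule low_symbol_eq_0)
    then show ?thesis by simp
  next
    case False
    define y where "y = 1 + (norm \<xi>)\<^sup>2"
    have "(norm \<xi>)\<^sup>2 \<le> (2 ^ n)\<^sup>2" using False by (intro power_mono) auto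
    also have "(2 ^ n)\<^sup>2 = (4::real) ^ n" by (simp add: power2_eq_square power_mult_distrib[symmetric])
    finally have y: "1 \<le> y" "y \<le> 1 + 4 ^ n" by (auto simp: y_def)
    have "y powr (\<tau> - \<sigma>) \<le> y powr \<bar>\<tau> - \<sigma>\<bar>" using y by (intro powr_mono) auto
    also have "\<dots> \<le> ?K" using y by (intro powr_mono2) auto
    also have "?K \<le> ?K\<^sup>2" using y by (intro self_le_power ge_one_powr_ge_zero) auto
    finally have "y powr (\<tau> - \<sigma>) * y powr \<sigma> \<le> ?K\<^sup>2 * y powr \<sigma>" by (intro mult_right_mono) auto
    then have w: "wt \<tau> \<xi> \<le> ?K\<^sup>2 * wt \<sigma> \<xi>" by (simp add: powr_add[symmetric] y_def)
    have "norm (low_symbol n \<xi> *\<^sub>R g \<xi>) \<le> 1 * norm (g \<xi>)"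
      using low_symbol_bounds[of n \<xi>] unfolding norm_scaleR by (intro mult_right_mono) auto
    then have "(norm (low_symbol n \<xi> *\<^sub>R g \<xi>))\<^sup>2 \<le> (norm (g \<xi>))\<^sup>2" by (intro power_mono) auto
    from mult_mono[OF w this] show ?thesis by (simp add: mult.assoc)
  qed
  from sobolev_compare[OF g represents_multiplier[OF cutoff_symbol_low g, folded lowpass_def] this _ u]
  show "lowpass n u \<in> sobolev \<tau>" "sobolev_norm \<tau> (lowpass n u) \<le> ?K * sobolev_norm \<sigma> u" by auto
qed

lemma lowpass_Suc_diff: "lowpass (Suc n) u - lowpass n u = LP_block \<psi> (Suc n) u"
  unfolding lowpass_def LP_block_eq block_symbol_Suc
  by (rule fourier_multiplier_symbol_diff[OF cutoff_symbol_low cutoff_symbol_low])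

lemma lowpass_le_sum_blocks:
  assumes "u \<in> sobolev \<sigma>"
  shows "sobolev_norm \<tau> (lowpass n u) \<le> (\<Sum>j\<le>n. sobolev_norm \<tau> (LP_block \<psi> j u))"
proof (induction n)
  case 0
  show ?case by (simp add: lowpass_def LP_block_eq block_symbol_0)
next
  case (Suc n)
  have "lowpass (Suc n) u = lowpass n u + LP_block \<psi> (Suc n) u"
    using lowpass_Suc_diff[of n u] by (simp add: algebra_simps)
  then show ?case
    using sobolev_add(2)[OF lowpass_le(1)[OF assms, where n = n and \<tau> = \<tau>] block_le(1)[OF assms, where j = "Suc n" and \<tau> = \<tau>]] Suc by simp
qed

lemma sum_blocks_le:
  assumes u: "u \<in> sobolev \<sigma>"
  shows "(\<Sum>j\<le>n. (sobolev_norm \<sigma> (LP_block \<psi> j u))\<^sup>2) \<le> (sobolev_norm \<sigma> u)\<^sup>2"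
proof -
  obtain g where g: "represents g (fourier_td u)" using sobolevE[OF u] .
  have [measurable]: "g \<in> borel_measurable borel" by (rule representsD(1)[OF g])
  note r = represents_multiplier[OF cutoff_symbol_block g, folded LP_block_eq]
  have [measurable]: "(\<lambda>\<xi>. block_symbol j \<xi> *\<^sub>R g \<xi>) \<in> borel_measurable borel" for j
    by (rule representsD(1)[OF r])
  have "ennreal (\<Sum>j\<le>n. (sobolev_norm \<sigma> (LP_block \<psi> j u))\<^sup>2) = (\<Sum>j\<le>n. energy \<sigma> (\<lambda>\<xi>. block_symbol j \<xi> *\<^sub>R g \<xi>))"
    unfolding sobolev_energy(2)[OF r block_le(1)[OF u]] by simp
  also have "\<dots> = (\<integral>\<^sup>+\<xi>. (\<Sum>j\<le>n. ennreal (wt \<sigma> \<xi> * (norm (block_symbol j \<xi> *\<^sub>R g \<xi>))\<^sup>2)) \<partial>lborel)"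
    unfolding energy_def by (rule nn_integral_sum[symmetric]) measurable
  also have "\<dots> \<le> energy \<sigma> g"
    unfolding energy_def
  proof (rule nn_integral_mono)
    fix \<xi> :: 'a
    have "(\<Sum>j\<le>n. wt \<sigma> \<xi> * (norm (block_symbol j \<xi> *\<^sub>R g \<xi>))\<^sup>2)
      = (\<Sum>j\<le>n. (block_symbol j \<xi>)\<^sup>2) * (wt \<sigma> \<xi> * (norm (g \<xi>))\<^sup>2)"
      unfolding sum_distrib_right by (intro sum.cong) (simp_all add: power_mult_distrib mult_ac)
    also have "\<dots> \<le> 1 * (wt \<sigma> \<xi> * (norm (g \<xi>))\<^sup>2)"
      by (intro mult_right_mono sum_block_symbol_square_le) auto
    finally show "(\<Sum>j\<le>n. ennreal (wt \<sigma> \<xi> * (norm (block_symbol j \<xi> *\<^sub>R g \<xi>))\<^sup>2)) \<le> ennreal (wt \<sigma> \<xi> * (norm (g \<xi>))\<^sup>2)"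
      by (subst sum_ennreal) (auto intro: ennreal_leI)
  qed
  also have "\<dots> = ennreal ((sobolev_norm \<sigma> u)\<^sup>2)" by (rule sobolev_energy(2)[OF g u])
  finally show ?thesis by simp
qed

lemma lowpass_square_le_sum_blocks:
  assumes u: "u \<in> sobolev \<rho>"
  shows "(sobolev_norm \<sigma> (lowpass n u))\<^sup>2 \<le> 2 * (\<Sum>j\<le>n. (sobolev_norm \<sigma> (LP_block \<psi> j u))\<^sup>2)"
proof -
  obtain g where g: "represents g (fourier_td u)" using sobolevE[OF u] .
  have [measurable]: "g \<in> borel_measurable borel" by (rule representsD(1)[OF g])
  note r = represents_multiplier[OF cutoff_symbol_block g, folded LP_block_eq]
  note l = represents_multiplier[OF cutoff_symbol_low g, folded lowpass_def]
  have [measurable]: "(\<lambda>\<xi>. block_symbol j \<xi> *\<^sub>R g \<xi>) \<in> borel_measurable borel" for j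
    by (rule representsD(1)[OF r])
  have "ennreal ((sobolev_norm \<sigma> (lowpass n u))\<^sup>2) = energy \<sigma> (\<lambda>\<xi>. low_symbol n \<xi> *\<^sub>R g \<xi>)"
    by (rule sobolev_energy(2)[OF l lowpass_le(1)[OF u], symmetric])
  also have "\<dots> \<le> (\<integral>\<^sup>+\<xi>. 2 * (\<Sum>j\<le>n. ennreal (wt \<sigma> \<xi> * (norm (block_symbol j \<xi> *\<^sub>R g \<xi>))\<^sup>2)) \<partial>lborel)"
    unfolding energy_def
  proof (rule nn_integral_mono)
    fix \<xi> :: 'a
    have "wt \<sigma> \<xi> * (norm (low_symbol n \<xi> *\<^sub>R g \<xi>))\<^sup>2 = (low_symbol n \<xi>)\<^sup>2 * (wt \<sigma> \<xi> * (norm (g \<xi>))\<^sup>2)"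
      by (simp add: power_mult_distrib mult_ac)
    also have "\<dots> \<le> 2 * (\<Sum>j\<le>n. (block_symbol j \<xi>)\<^sup>2) * (wt \<sigma> \<xi> * (norm (g \<xi>))\<^sup>2)"
      by (intro mult_right_mono low_symbol_square_le) auto
    also have "\<dots> = 2 * (\<Sum>j\<le>n. wt \<sigma> \<xi> * (norm (block_symbol j \<xi> *\<^sub>R g \<xi>))\<^sup>2)"
      unfolding sum_distrib_right sum_distrib_left by (intro sum.cong) (simp_all add: power_mult_distrib mult_ac)
    finally have "ennreal (wt \<sigma> \<xi> * (norm (low_symbol n \<xi> *\<^sub>R g \<xi>))\<^sup>2) \<le> ennreal (2 * (\<Sum>j\<le>n. wt \<sigma> \<xi> * (norm (block_symbol j \<xi> *\<^sub>R g \<xi>))\<^sup>2))"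
      by (rule ennreal_leI)
    also have "\<dots> = 2 * (\<Sum>j\<le>n. ennreal (wt \<sigma> \<xi> * (norm (block_symbol j \<xi> *\<^sub>R g \<xi>))\<^sup>2))"
      by (subst ennreal_mult') (simp_all add: sum_ennreal)
    finally show "ennreal (wt \<sigma> \<xi> * (norm (low_symbol n \<xi> *\<^sub>R g \<xi>))\<^sup>2) \<le> 2 * (\<Sum>j\<le>n. ennreal (wt \<sigma> \<xi> * (norm (block_symbol j \<xi> *\<^sub>R g \<xi>))\<^sup>2))" .
  qed
  also have "\<dots> = 2 * (\<Sum>j\<le>n. energy \<sigma> (\<lambda>\<xi>. block_symbol j \<xi> *\<^sub>R g \<xi>))"
    unfolding energy_def by (subst nn_integral_cmult, measurable) (subst nn_integral_sum, measurable)
  also have "\<dots> = ennreal (2 * (\<Sum>j\<le>n. (sobolev_norm \<sigma> (LP_block \<psi> j u))\<^sup>2))"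
    unfolding sobolev_energy(2)[OF r block_le(1)[OF u]] by (simp add: ennreal_mult' sum_nonneg)
  finally show ?thesis by (simp add: sum_nonneg)
qed

text \<open>
  Fatou's lemma on the Fourier side, as the symbols of the truncations converge to one.
\<close>

lemma sobolev_of_lowpass:
  assumes u: "u \<in> sobolev \<rho>" and B: "\<And>n. sobolev_norm \<sigma> (lowpass n u) \<le> B"
  shows "u \<in> sobolev \<sigma>" "sobolev_norm \<sigma> u \<le> B"
proof -
  have B0: "0 \<le> B" using B[of 0] sobolev_norm_nonneg order_trans by blast
  obtain g where g: "represents g (fourier_td u)" using sobolevE[OF u] .
  have [measurable]: "g \<in> borel_measurable borel" by (rule representsD(1)[OF g])
  note l = represents_multiplier[OF cutoff_symbol_low g, folded lowpass_def]
  have [measurable]: "(\<lambda>\<xi>. low_symbol n \<xi> *\<^sub>R g \<xi>) \<in> borel_measurable borel" for n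
    by (rule representsD(1)[OF l])
  have "energy \<sigma> g = (\<integral>\<^sup>+\<xi>. liminf (\<lambda>n. ennreal (wt \<sigma> \<xi> * (norm (low_symbol n \<xi> *\<^sub>R g \<xi>))\<^sup>2)) \<partial>lborel)"
    unfolding energy_def
  proof (rule nn_integral_cong)
    fix \<xi> :: 'a
    have "(\<lambda>n. wt \<sigma> \<xi> * (norm (low_symbol n \<xi> *\<^sub>R g \<xi>))\<^sup>2) \<longlonglongrightarrow> wt \<sigma> \<xi> * (norm (1 *\<^sub>R g \<xi>))\<^sup>2"
      by (intro tendsto_mult_left tendsto_power tendsto_norm tendsto_scaleR low_symbol_tendsto tendsto_const)
    then have "(\<lambda>n. ennreal (wt \<sigma> \<xi> * (norm (low_symbol n \<xi> *\<^sub>R g \<xi>))\<^sup>2)) \<longlonglongrightarrow> ennreal (wt \<sigma> \<xi> * (norm (g \<xi>))\<^sup>2)"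
      by (intro tendsto_ennrealI) simp
    from lim_imp_Liminf[OF sequentially_bot this]
    show "ennreal (wt \<sigma> \<xi> * (norm (g \<xi>))\<^sup>2) = liminf (\<lambda>n. ennreal (wt \<sigma> \<xi> * (norm (low_symbol n \<xi> *\<^sub>R g \<xi>))\<^sup>2))" by simp
  qed
  also have "\<dots> \<le> liminf (\<lambda>n. energy \<sigma> (\<lambda>\<xi>. low_symbol n \<xi> *\<^sub>R g \<xi>))"
    unfolding energy_def by (rule nn_integral_liminf) measurable
  also have "\<dots> \<le> liminf (\<lambda>n::nat. ennreal (B\<^sup>2))"
  proof (intro Liminf_mono always_eventually allI)
    fix n
    show "energy \<sigma> (\<lambda>\<xi>. low_symbol n \<xi> *\<^sub>R g \<xi>) \<le> ennreal (B\<^sup>2)"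
      using sobolev_le_iff[OF l[of n] B0, of \<sigma>] lowpass_le(1)[OF u] B by blast
  qed
  also have "\<dots> = ennreal (B\<^sup>2)" by (simp add: Liminf_const)
  finally show "u \<in> sobolev \<sigma>" "sobolev_norm \<sigma> u \<le> B"
    using sobolev_le_iff[OF g B0, of \<sigma>] by auto
qed

lemma lowpass_norm_mono:
  assumes u: "u \<in> sobolev \<rho>" and mn: "m \<le> n"
  shows "sobolev_norm \<sigma> (lowpass m u) \<le> sobolev_norm \<sigma> (lowpass n u)"
proof -
  obtain g where g: "represents g (fourier_td u)" using sobolevE[OF u] .
  note l = represents_multiplier[OF cutoff_symbol_low g, folded lowpass_def]
  have "wt \<sigma> \<xi> * (norm (low_symbol m \<xi> *\<^sub>R g \<xi>))\<^sup>2 \<le> 1\<^sup>2 * (wt \<sigma> \<xi> * (norm (low_symbol n \<xi> *\<^sub>R g \<xi>))\<^sup>2)" for \<xi>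
    using low_symbol_mono[OF mn, of \<xi>] low_symbol_bounds(1)[of m \<xi>]
    by (auto intro!: mult_left_mono power_mono mult_right_mono)
  from sobolev_compare(2)[OF l l this _ lowpass_le(1)[OF u]] show ?thesis by simp
qed

lemma lowpass_tendsto:
  assumes u: "u \<in> sobolev \<sigma>"
  shows "(\<lambda>n. sobolev_norm \<sigma> (lowpass n u - u)) \<longlonglongrightarrow> 0"
proof -
  obtain g where g: "represents g (fourier_td u)" using sobolevE[OF u] .
  have [measurable]: "g \<in> borel_measurable borel" by (rule representsD(1)[OF g])
  note l = represents_multiplier[OF cutoff_symbol_low g, folded lowpass_def]
  note r = represents_diff[OF l g, folded fourier_td_diff]
  have [measurable]: "(\<lambda>\<xi>. low_symbol n \<xi> *\<^sub>R g \<xi> - g \<xi>) \<in> borel_measurable borel" for n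
    by (rule representsD(1)[OF r])
  have "(\<lambda>n. \<integral>\<^sup>+\<xi>. ennreal (wt \<sigma> \<xi> * (norm (low_symbol n \<xi> *\<^sub>R g \<xi> - g \<xi>))\<^sup>2) \<partial>lborel)
    \<longlonglongrightarrow> (\<integral>\<^sup>+(\<xi>::'a). 0 \<partial>lborel)"
  proof (rule nn_integral_dominated_convergence[where w="\<lambda>\<xi>. ennreal (wt \<sigma> \<xi> * (norm (g \<xi>))\<^sup>2)"])
    show "(\<integral>\<^sup>+\<xi>. ennreal (wt \<sigma> \<xi> * (norm (g \<xi>))\<^sup>2) \<partial>lborel) < \<infinity>"
      using sobolev_energy(1)[OF g] u by (simp add: energy_def)
    have "wt \<sigma> \<xi> * (norm (low_symbol n \<xi> *\<^sub>R g \<xi> - g \<xi>))\<^sup>2 \<le> wt \<sigma> \<xi> * (norm (g \<xi>))\<^sup>2" for n \<xi>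
    proof -
      have "low_symbol n \<xi> *\<^sub>R g \<xi> - g \<xi> = (low_symbol n \<xi> - 1) *\<^sub>R g \<xi>" by (simp add: scaleR_diff_left)
      then have "norm (low_symbol n \<xi> *\<^sub>R g \<xi> - g \<xi>) \<le> 1 * norm (g \<xi>)"
        using low_symbol_bounds[of n \<xi>] by (simp only: norm_scaleR) (intro mult_right_mono, auto)
      then show ?thesis by (intro mult_left_mono power_mono) auto
    qed
    then show "AE \<xi> in lborel. ennreal (wt \<sigma> \<xi> * (norm (low_symbol n \<xi> *\<^sub>R g \<xi> - g \<xi>))\<^sup>2) \<le> ennreal (wt \<sigma> \<xi> * (norm (g \<xi>))\<^sup>2)" for n
      by (intro AE_I2 ennreal_leI)
    have "(\<lambda>n. wt \<sigma> \<xi> * (norm (low_symbol n \<xi> *\<^sub>R g \<xi> - g \<xi>))\<^sup>2) \<longlonglongrightarrow> wt \<sigma> \<xi> * (norm (1 *\<^sub>R g \<xi> - g \<xi>))\<^sup>2" for \<xi>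
      by (intro tendsto_mult_left tendsto_power tendsto_norm tendsto_scaleR tendsto_diff low_symbol_tendsto tendsto_const)
    then show "AE \<xi> in lborel. (\<lambda>n. ennreal (wt \<sigma> \<xi> * (norm (low_symbol n \<xi> *\<^sub>R g \<xi> - g \<xi>))\<^sup>2)) \<longlonglongrightarrow> 0"
      by (intro AE_I2) (simp flip: ennreal_0)
  qed measurable
  then have "(\<lambda>n. energy \<sigma> (\<lambda>\<xi>. low_symbol n \<xi> *\<^sub>R g \<xi> - g \<xi>)) \<longlonglongrightarrow> 0"
    by (simp add: energy_def)
  then have "(\<lambda>n. ennreal ((sobolev_norm \<sigma> (lowpass n u - u))\<^sup>2)) \<longlonglongrightarrow> ennreal 0"
    using sobolev_energy(2)[OF r sobolev_diff(1)[OF lowpass_le(1)[OF u] u]] by simp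
  then have "(\<lambda>n. (sobolev_norm \<sigma> (lowpass n u - u))\<^sup>2) \<longlonglongrightarrow> 0"
    by (subst (asm) tendsto_ennreal_iff) auto
  then have "(\<lambda>n. sqrt ((sobolev_norm \<sigma> (lowpass n u - u))\<^sup>2)) \<longlonglongrightarrow> sqrt 0"
    by (rule tendsto_real_sqrt)
  then show ?thesis by (simp add: sobolev_norm_nonneg)
qed

text \<open>
  Frequencies with \<open>1 + \<bar>\<xi>\<bar>\<^sup>2 > R\<close> are controlled by the strong norm with a factor that is small
  for large \<open>R\<close>, the others by the weak norm. This additive form integrates in time by the triangle
  inequality alone.
\<close>

lemma sobolev_interpolation:
  assumes s: "s0 < s" "s < s1" and \<eta>: "0 < \<eta>"
  obtains C where "0 \<le> C"
    "\<And>u :: 'a tempered_distribution. u \<in> sobolev s1 \<Longrightarrow> sobolev_norm s u \<le> \<eta> * sobolev_norm s1 u + C * sobolev_norm s0 u"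
proof -
  define R where "R = max 1 ((\<eta>\<^sup>2) powr (- 1 / (s1 - s)))"
  have R: "1 \<le> R" by (simp add: R_def)
  define C where "C = sqrt (R powr (s - s0))"
  have C2: "C\<^sup>2 = R powr (s - s0)" by (simp add: C_def)
  have w: "wt s \<xi> \<le> \<eta>\<^sup>2 * wt s1 \<xi> + C\<^sup>2 * wt s0 \<xi>" for \<xi> :: 'a
  proof -
    define y where "y = 1 + (norm \<xi>)\<^sup>2"
    have y: "1 \<le> y" by (simp add: y_def)
    show ?thesis
    proof (cases "y \<le> R")
      case True
      have "y powr s = y powr (s - s0) * y powr s0" by (simp add: powr_add[symmetric])
      also have "\<dots> \<le> C\<^sup>2 * y powr s0"
        unfolding C2 using True y s by (intro mult_right_mono powr_mono2) auto
      finally show ?thesis using \<eta> by (simp add: y_def add_increasing)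
    next
      case False
      have "y powr s = y powr (- (s1 - s)) * y powr s1" by (simp add: powr_add[symmetric])
      also have "\<dots> \<le> \<eta>\<^sup>2 * y powr s1"
      proof (rule mult_right_mono)
        have "y powr (- (s1 - s)) \<le> ((\<eta>\<^sup>2) powr (- 1 / (s1 - s))) powr (- (s1 - s))"
          using False s \<eta> by (intro powr_mono2') (auto simp: R_def)
        also have "\<dots> = (\<eta>\<^sup>2) powr 1"
        proof -
          have "(- 1 / (s1 - s)) * (- (s1 - s)) = 1" using s by (simp add: divide_simps)
          then show ?thesis by (simp only: powr_powr)
        qed
        also have "\<dots> = \<eta>\<^sup>2" using \<eta> by simp
        finally show "y powr (- (s1 - s)) \<le> \<eta>\<^sup>2" .
      qed simp
      finally show ?thesis by (simp add: y_def add_increasing2)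
    qed
  qed
  have "sobolev_norm s u \<le> \<eta> * sobolev_norm s1 u + C * sobolev_norm s0 u"
    if u: "u \<in> sobolev s1" for u :: "'a tempered_distribution"
  proof -
    obtain g where g: "represents g (fourier_td u)" using sobolevE[OF u] .
    have [measurable]: "g \<in> borel_measurable borel" by (rule representsD(1)[OF g])
    have u0: "u \<in> sobolev s0" using sobolev_mono(1)[OF u, of s0] s by simp
    let ?A = "sobolev_norm s1 u" and ?B = "sobolev_norm s0 u"
    have nn: "0 \<le> ?A" "0 \<le> ?B" "0 \<le> C" by (auto simp: sobolev_norm_nonneg C_def)
    have "energy s g \<le> (\<integral>\<^sup>+\<xi>. ennreal (\<eta>\<^sup>2) * ennreal (wt s1 \<xi> * (norm (g \<xi>))\<^sup>2) + ennreal (C\<^sup>2) * ennreal (wt s0 \<xi> * (norm (g \<xi>))\<^sup>2) \<partial>lborel)"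
      unfolding energy_def
    proof (rule nn_integral_mono)
      fix \<xi> :: 'a
      have "ennreal (wt s \<xi> * (norm (g \<xi>))\<^sup>2) \<le> ennreal (\<eta>\<^sup>2 * (wt s1 \<xi> * (norm (g \<xi>))\<^sup>2) + C\<^sup>2 * (wt s0 \<xi> * (norm (g \<xi>))\<^sup>2))"
        using mult_right_mono[OF w[of \<xi>], of "(norm (g \<xi>))\<^sup>2"] by (intro ennreal_leI) (simp add: distrib_right mult.assoc)
      then show "ennreal (wt s \<xi> * (norm (g \<xi>))\<^sup>2) \<le> ennreal (\<eta>\<^sup>2) * ennreal (wt s1 \<xi> * (norm (g \<xi>))\<^sup>2) + ennreal (C\<^sup>2) * ennreal (wt s0 \<xi> * (norm (g \<xi>))\<^sup>2)"
        by (simp add: ennreal_mult'[symmetric])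
    qed
    also have "\<dots> = ennreal (\<eta>\<^sup>2) * energy s1 g + ennreal (C\<^sup>2) * energy s0 g"
      unfolding energy_def by (subst nn_integral_add) (auto simp: nn_integral_cmult)
    also have "\<dots> = ennreal (\<eta>\<^sup>2 * ?A\<^sup>2 + C\<^sup>2 * ?B\<^sup>2)"
      unfolding sobolev_energy(2)[OF g u] sobolev_energy(2)[OF g u0] by (simp add: ennreal_mult'[symmetric])
    also have "\<dots> \<le> ennreal ((\<eta> * ?A + C * ?B)\<^sup>2)"
      using nn \<eta> by (intro ennreal_leI) (simp add: power2_sum power_mult_distrib)
    finally show ?thesis
      using sobolev_le_iff[OF g, of "\<eta> * ?A + C * ?B" s] nn \<eta> by simp
  qed
  moreover have "0 \<le> C" by (simp add: C_def)
  ultimately show ?thesis using that by blast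
qed

end

section \<open>Strongly measurable functions of time\<close>

lemma borel_measurable_AE_limit:
  fixes f :: "nat \<Rightarrow> real \<Rightarrow> real"
  assumes S: "S \<in> sets lebesgue" and f: "\<And>n. f n \<in> borel_measurable (lebesgue_on S)"
    and lim: "AE t in lebesgue_on S. (\<lambda>n. f n t) \<longlonglongrightarrow> g t"
  shows "g \<in> borel_measurable (lebesgue_on S)"
proof -
  have S': "S \<inter> space lebesgue \<in> sets lebesgue" using S by simp
  have "(\<lambda>t. indicator S t *\<^sub>R f n t) \<in> borel_measurable lebesgue" for n
    using f borel_measurable_restrict_space_iff[OF S'] by blast
  then have "(\<lambda>t. lim (\<lambda>n. indicator S t *\<^sub>R f n t)) \<in> borel_measurable lebesgue"
    by (rule borel_measurable_lim_metric)
  moreover have "AE t in lebesgue. lim (\<lambda>n. indicator S t *\<^sub>R f n t) = indicator S t *\<^sub>R g t"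
    using lim unfolding AE_restrict_space_iff[OF S']
  proof eventually_elim
    case (elim t)
    then have "(\<lambda>n. indicator S t *\<^sub>R f n t) \<longlonglongrightarrow> indicator S t *\<^sub>R g t"
      by (cases "t \<in> S") auto
    then show ?case by (rule limI)
  qed
  ultimately have "(\<lambda>t. indicator S t *\<^sub>R g t) \<in> borel_measurable lebesgue"
    by (rule borel_measurable_AE)
  then show ?thesis using borel_measurable_restrict_space_iff[OF S'] by blast
qed

lemma tendsto_zero_squeeze:
  fixes f g :: "'b \<Rightarrow> real"
  assumes "\<And>n. 0 \<le> f n" "\<And>n. f n \<le> g n" "(g \<longlongrightarrow> 0) F"
  shows "(f \<longlongrightarrow> 0) F"
  by (rule real_tendsto_sandwich[OF _ _ tendsto_const assms(3)]) (simp_all add: assms(1,2))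

locale sobolev_evolution = littlewood_paley \<psi> for \<psi> :: "'a::euclidean_space \<Rightarrow> real" +
  fixes T :: real and \<mu> :: ennreal
  assumes T: "0 < T" and \<mu>: "2 \<le> \<mu>"
begin

abbreviation M :: "real measure" where "M \<equiv> lebesgue_on {0<..<T}"

lemma LP_block_diff: "LP_block \<psi> j (u - v) = LP_block \<psi> j u - LP_block \<psi> j v"
  unfolding LP_block_eq by (rule fourier_multiplier_diff[OF cutoff_symbol_block])

lemma lowpass_diff: "lowpass n (u - v) = lowpass n u - lowpass n v"
  unfolding lowpass_def by (rule fourier_multiplier_diff[OF cutoff_symbol_low])

lemma \<mu>1: "1 \<le> \<mu>"
  using \<mu> by (rule order_trans[rotated]) simp

lemma finite_measure_M: "finite_measure M"
  by (rule finite_measure_lebesgue_on) simp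

lemma bochner_measurableE:
  assumes "bochner_measurable M \<sigma> F"
  obtains S where "\<And>n. simple_function M (S n)" "\<And>n t. t \<in> space M \<Longrightarrow> S n t \<in> sobolev \<sigma>"
    "AE t in M. F t \<in> sobolev \<sigma> \<and> (\<lambda>n. sobolev_norm \<sigma> (S n t - F t)) \<longlonglongrightarrow> 0"
  using assms unfolding bochner_measurable_def image_subset_iff by blast

lemma bochner_measurableI:
  assumes "\<And>n. simple_function M (S n)" "\<And>n t. t \<in> space M \<Longrightarrow> S n t \<in> sobolev \<sigma>"
    "AE t in M. F t \<in> sobolev \<sigma> \<and> (\<lambda>n. sobolev_norm \<sigma> (S n t - F t)) \<longlonglongrightarrow> 0"
  shows "bochner_measurable M \<sigma> F"
  unfolding bochner_measurable_def using assms by (intro exI[of _ S]) auto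

lemma bochner_measurable_AE: "bochner_measurable M \<sigma> F \<Longrightarrow> AE t in M. F t \<in> sobolev \<sigma>"
  by (erule bochner_measurableE) (auto elim: eventually_mono)

lemma bochner_measurable_simple:
  assumes "simple_function M (S :: real \<Rightarrow> 'a tempered_distribution)" "\<And>t. t \<in> space M \<Longrightarrow> S t \<in> sobolev \<sigma>"
  shows "bochner_measurable M \<sigma> S"
proof (rule bochner_measurableI[of "\<lambda>_. S"])
  show "AE t in M. S t \<in> sobolev \<sigma> \<and> (\<lambda>n. sobolev_norm \<sigma> (S t - S t)) \<longlonglongrightarrow> 0"
    by (rule AE_I2) (simp only: assms(2) sobolev_norm_self_diff tendsto_const simp_thms)
qed (use assms in auto)

lemma bochner_measurable_map2:
  assumes F: "bochner_measurable M \<sigma> F" and G: "bochner_measurable M \<rho> G"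
    and A: "\<And>u v. u \<in> sobolev \<sigma> \<Longrightarrow> v \<in> sobolev \<rho> \<Longrightarrow> A u v \<in> sobolev \<tau>"
    and lip: "\<And>u v u' v'. u \<in> sobolev \<sigma> \<Longrightarrow> v \<in> sobolev \<rho> \<Longrightarrow> u' \<in> sobolev \<sigma> \<Longrightarrow> v' \<in> sobolev \<rho> \<Longrightarrow>
      sobolev_norm \<tau> (A u v - A u' v') \<le> C * (sobolev_norm \<sigma> (u - u') + sobolev_norm \<rho> (v - v'))"
  shows "bochner_measurable M \<tau> (\<lambda>t. A (F t) (G t))"
proof -
  obtain S where S: "\<And>n. simple_function M (S n)" "\<And>n t. t \<in> space M \<Longrightarrow> S n t \<in> sobolev \<sigma>"
    "AE t in M. F t \<in> sobolev \<sigma> \<and> (\<lambda>n. sobolev_norm \<sigma> (S n t - F t)) \<longlonglongrightarrow> 0"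
    using F by (rule bochner_measurableE) blast
  obtain R where R: "\<And>n. simple_function M (R n)" "\<And>n t. t \<in> space M \<Longrightarrow> R n t \<in> sobolev \<rho>"
    "AE t in M. G t \<in> sobolev \<rho> \<and> (\<lambda>n. sobolev_norm \<rho> (R n t - G t)) \<longlonglongrightarrow> 0"
    using G by (rule bochner_measurableE) blast
  show ?thesis
  proof (rule bochner_measurableI[of "\<lambda>n t. A (S n t) (R n t)"])
    show "simple_function M (\<lambda>t. A (S n t) (R n t))" for n
      by (rule simple_function_compose2[OF S(1) R(1)])
    show "A (S n t) (R n t) \<in> sobolev \<tau>" if "t \<in> space M" for n t
      by (intro A S R that)
    show "AE t in M. A (F t) (G t) \<in> sobolev \<tau> \<and> (\<lambda>n. sobolev_norm \<tau> (A (S n t) (R n t) - A (F t) (G t))) \<longlonglongrightarrow> 0"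
      using S(3) R(3) AE_space
    proof eventually_elim
      case (elim t)
      have "(\<lambda>n. C * (sobolev_norm \<sigma> (S n t - F t) + sobolev_norm \<rho> (R n t - G t))) \<longlonglongrightarrow> C * (0 + 0)"
        using elim by (intro tendsto_intros) auto
      then have lim: "(\<lambda>n. C * (sobolev_norm \<sigma> (S n t - F t) + sobolev_norm \<rho> (R n t - G t))) \<longlonglongrightarrow> 0" by simp
      have "sobolev_norm \<tau> (A (S n t) (R n t) - A (F t) (G t)) \<le> C * (sobolev_norm \<sigma> (S n t - F t) + sobolev_norm \<rho> (R n t - G t))" for n
        using elim by (intro lip S(2) R(2)) auto
      from tendsto_zero_squeeze[OF sobolev_norm_nonneg this lim]
      have "(\<lambda>n. sobolev_norm \<tau> (A (S n t) (R n t) - A (F t) (G t))) \<longlonglongrightarrow> 0" .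
      then show ?case using elim A by blast
    qed
  qed
qed

lemma bochner_measurable_map:
  assumes F: "bochner_measurable M \<sigma> F"
    and A: "\<And>u :: 'a tempered_distribution. u \<in> sobolev \<sigma> \<Longrightarrow> (A u :: 'a tempered_distribution) \<in> sobolev \<tau>"
    and lip: "\<And>u v. u \<in> sobolev \<sigma> \<Longrightarrow> v \<in> sobolev \<sigma> \<Longrightarrow> sobolev_norm \<tau> (A u - A v) \<le> C * sobolev_norm \<sigma> (u - v)"
  shows "bochner_measurable M \<tau> (\<lambda>t. A (F t))"
proof (rule bochner_measurable_map2[OF F F, where C = "\<bar>C\<bar>" and A = "\<lambda>u _. A u"])
  fix u v u' v' :: "'a tempered_distribution"
  assume "u \<in> sobolev \<sigma>" "u' \<in> sobolev \<sigma>"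
  then have "sobolev_norm \<tau> (A u - A u') \<le> C * sobolev_norm \<sigma> (u - u')" by (rule lip)
  also have "\<dots> \<le> \<bar>C\<bar> * (sobolev_norm \<sigma> (u - u') + sobolev_norm \<sigma> (v - v'))"
    by (intro mult_mono) (auto simp: sobolev_norm_nonneg)
  finally show "sobolev_norm \<tau> (A u - A u') \<le> \<bar>C\<bar> * (sobolev_norm \<sigma> (u - u') + sobolev_norm \<sigma> (v - v'))" .
qed (use A in auto)

lemma bochner_measurable_diff:
  assumes "bochner_measurable M \<sigma> F" "bochner_measurable M \<sigma> (G :: real \<Rightarrow> 'a tempered_distribution)"
  shows "bochner_measurable M \<sigma> (\<lambda>t. F t - G t)"
proof (rule bochner_measurable_map2[OF assms, where C = 1])
  fix u v u' v' :: "'a tempered_distribution"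
  assume u: "u \<in> sobolev \<sigma>" "v \<in> sobolev \<sigma>" "u' \<in> sobolev \<sigma>" "v' \<in> sobolev \<sigma>"
  have eq: "u - v - (u' - v') = (u - u') - (v - v')" by simp
  show "sobolev_norm \<sigma> (u - v - (u' - v')) \<le> 1 * (sobolev_norm \<sigma> (u - u') + sobolev_norm \<sigma> (v - v'))"
    unfolding eq mult_1_left by (rule sobolev_diff(2)[OF sobolev_diff(1)[OF u(1,3)] sobolev_diff(1)[OF u(2,4)]])
qed (rule sobolev_diff)

lemma bochner_measurable_add:
  assumes "bochner_measurable M \<sigma> F" "bochner_measurable M \<sigma> (G :: real \<Rightarrow> 'a tempered_distribution)"
  shows "bochner_measurable M \<sigma> (\<lambda>t. F t + G t)"
proof (rule bochner_measurable_map2[OF assms, where C = 1])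
  fix u v u' v' :: "'a tempered_distribution"
  assume u: "u \<in> sobolev \<sigma>" "v \<in> sobolev \<sigma>" "u' \<in> sobolev \<sigma>" "v' \<in> sobolev \<sigma>"
  have eq: "u + v - (u' + v') = (u - u') + (v - v')" by simp
  show "sobolev_norm \<sigma> (u + v - (u' + v')) \<le> 1 * (sobolev_norm \<sigma> (u - u') + sobolev_norm \<sigma> (v - v'))"
    unfolding eq mult_1_left by (rule sobolev_add(2)[OF sobolev_diff(1)[OF u(1,3)] sobolev_diff(1)[OF u(2,4)]])
qed (rule sobolev_add)

lemma bochner_measurable_mono:
  assumes "bochner_measurable M \<sigma> (F :: real \<Rightarrow> 'a tempered_distribution)" "\<tau> \<le> \<sigma>"
  shows "bochner_measurable M \<tau> F"
proof (rule bochner_measurable_map[OF assms(1)])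
  fix u v :: "'a tempered_distribution" assume "u \<in> sobolev \<sigma>" "v \<in> sobolev \<sigma>"
  then show "sobolev_norm \<tau> (u - v) \<le> 1 * sobolev_norm \<sigma> (u - v)"
    using sobolev_mono(2)[OF sobolev_diff(1) assms(2)] by simp
qed (rule sobolev_mono(1)[OF _ assms(2)])

lemma bochner_measurable_block:
  assumes "bochner_measurable M \<sigma> F"
  shows "bochner_measurable M \<tau> (\<lambda>t. LP_block \<psi> j (F t))"
proof (rule bochner_measurable_map[OF assms])
  fix u v :: "'a tempered_distribution" assume "u \<in> sobolev \<sigma>" "v \<in> sobolev \<sigma>"
  then show "sobolev_norm \<tau> (LP_block \<psi> j u - LP_block \<psi> j v) \<le> bernstein j (\<tau> - \<sigma>) * sobolev_norm \<sigma> (u - v)"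
    unfolding LP_block_diff[symmetric] by (intro block_le(2) sobolev_diff(1))
qed (rule block_le(1))

lemma bochner_measurable_lowpass:
  assumes "bochner_measurable M \<sigma> F"
  shows "bochner_measurable M \<tau> (\<lambda>t. lowpass n (F t))"
proof (rule bochner_measurable_map[OF assms])
  fix u v :: "'a tempered_distribution" assume "u \<in> sobolev \<sigma>" "v \<in> sobolev \<sigma>"
  then show "sobolev_norm \<tau> (lowpass n u - lowpass n v) \<le> (1 + 4 ^ n) powr \<bar>\<tau> - \<sigma>\<bar> * sobolev_norm \<sigma> (u - v)"
    unfolding lowpass_diff[symmetric] by (intro lowpass_le(2) sobolev_diff(1))
qed (rule lowpass_le(1))

lemma bochner_measurable_norm:
  assumes "bochner_measurable M \<sigma> (F :: real \<Rightarrow> 'a tempered_distribution)"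
  shows "(\<lambda>t. sobolev_norm \<sigma> (F t)) \<in> borel_measurable M"
proof -
  obtain S where S: "\<And>n. simple_function M (S n)" "\<And>n t. t \<in> space M \<Longrightarrow> S n t \<in> sobolev \<sigma>"
    "AE t in M. F t \<in> sobolev \<sigma> \<and> (\<lambda>n. sobolev_norm \<sigma> (S n t - F t)) \<longlonglongrightarrow> 0"
    using assms by (rule bochner_measurableE) blast
  show ?thesis
  proof (rule borel_measurable_AE_limit)
    show "(\<lambda>t. sobolev_norm \<sigma> (S n t)) \<in> borel_measurable M" for n
      by (rule borel_measurable_simple_function[OF simple_function_compose1[OF S(1)]])
    show "AE t in M. (\<lambda>n. sobolev_norm \<sigma> (S n t)) \<longlonglongrightarrow> sobolev_norm \<sigma> (F t)"
      using S(3) AE_space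
    proof eventually_elim
      case (elim t)
      have "(\<lambda>n. sobolev_norm \<sigma> (S n t) - sobolev_norm \<sigma> (F t)) \<longlonglongrightarrow> 0"
      proof (rule Lim_null_comparison[OF always_eventually[OF allI]])
        show "norm (sobolev_norm \<sigma> (S n t) - sobolev_norm \<sigma> (F t)) \<le> sobolev_norm \<sigma> (S n t - F t)" for n
          unfolding real_norm_def using elim by (intro sobolev_norm_abs_diff S(2)) auto
      qed (use elim in auto)
      then show ?case by (rule LIM_zero_cancel)
    qed
  qed simp
qed

text \<open>
  Each \<open>G J\<close> is a limit almost everywhere of simple functions, and on an interval of finite length this
  improves to convergence in measure. Simple functions that approximate \<open>G J\<close> with error \<open>2\<^bsup>-J\<^esup>\<close>
  in the integral of the distance truncated at one have summable errors, so almost everywhere they converge to the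
  limit of the \<open>G J\<close>.
\<close>

lemma bochner_measurable_limit:
  assumes FJ: "\<And>J. bochner_measurable M \<sigma> (G J)"
    and lim: "AE t in M. F t \<in> sobolev \<sigma> \<and> (\<lambda>J. sobolev_norm \<sigma> (G J t - F t)) \<longlonglongrightarrow> 0"
  shows "bochner_measurable M \<sigma> (F :: real \<Rightarrow> 'a tempered_distribution)"
proof -
  interpret finite_measure M by (rule finite_measure_M)
  define approx where "approx J S \<longleftrightarrow> simple_function M S \<and> (\<forall>t\<in>space M. S t \<in> sobolev \<sigma>) \<and>
     (\<lambda>t. ennreal (min 1 (sobolev_norm \<sigma> (S t - G J t)))) \<in> borel_measurable M \<and>
     (\<integral>\<^sup>+t. ennreal (min 1 (sobolev_norm \<sigma> (S t - G J t))) \<partial>M) < ennreal ((1 / 2) ^ J)" for J S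
  have "\<exists>S. approx J S" for J
  proof -
    obtain S where S: "\<And>n. simple_function M (S n)" "\<And>n t. t \<in> space M \<Longrightarrow> S n t \<in> sobolev \<sigma>"
      "AE t in M. G J t \<in> sobolev \<sigma> \<and> (\<lambda>n. sobolev_norm \<sigma> (S n t - G J t)) \<longlonglongrightarrow> 0"
      using FJ[of J] by (rule bochner_measurableE) blast
    let ?d = "\<lambda>n t. ennreal (min 1 (sobolev_norm \<sigma> (S n t - G J t)))"
    have [measurable]: "(\<lambda>t. sobolev_norm \<sigma> (S n t - G J t)) \<in> borel_measurable M" for n
      by (intro bochner_measurable_norm bochner_measurable_diff bochner_measurable_simple S FJ)
    have md: "?d n \<in> borel_measurable M" for n by measurable
    have "(\<lambda>n. \<integral>\<^sup>+t. ?d n t \<partial>M) \<longlonglongrightarrow> (\<integral>\<^sup>+t. 0 \<partial>M)"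
    proof (rule nn_integral_dominated_convergence[where w="\<lambda>_. 1"])
      show "(\<integral>\<^sup>+t. 1 \<partial>M) < \<infinity>" 
        using emeasure_finite[of "space M"] by (simp only: nn_integral_const mult_1_left infinity_ennreal_def less_top)
      show "AE t in M. (\<lambda>n. ?d n t) \<longlonglongrightarrow> 0"
        using S(3)
      proof eventually_elim
        case (elim t)
        then have "(\<lambda>n. min 1 (sobolev_norm \<sigma> (S n t - G J t))) \<longlonglongrightarrow> min 1 0"
          by (intro tendsto_min tendsto_const) auto
        then have "(\<lambda>n. ennreal (min 1 (sobolev_norm \<sigma> (S n t - G J t)))) \<longlonglongrightarrow> ennreal (min 1 0)"
          by (rule tendsto_ennrealI)
        then show ?case by simp
      qed
      show "AE t in M. ?d n t \<le> 1" for n by (intro AE_I2) (simp flip: ennreal_1 add: ennreal_leI del: ennreal_1)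
    qed (use md in auto)
    then have "\<forall>\<^sub>F n in sequentially. (\<integral>\<^sup>+t. ?d n t \<partial>M) < ennreal ((1 / 2) ^ J)"
      by (intro order_tendstoD(2)) auto
    then obtain n where "(\<integral>\<^sup>+t. ?d n t \<partial>M) < ennreal ((1 / 2) ^ J)"
      by (auto simp: eventually_sequentially)
    then show ?thesis unfolding approx_def using S(1,2) md by (intro exI[of _ "S n"]) simp
  qed
  then obtain S where approx: "\<And>J. approx J (S J)" by metis
  have S: "\<And>J. simple_function M (S J)" "\<And>J t. t \<in> space M \<Longrightarrow> S J t \<in> sobolev \<sigma>"
    and d: "\<And>J. (\<lambda>t. ennreal (min 1 (sobolev_norm \<sigma> (S J t - G J t)))) \<in> borel_measurable M"
    and I: "\<And>J. (\<integral>\<^sup>+t. ennreal (min 1 (sobolev_norm \<sigma> (S J t - G J t))) \<partial>M) < ennreal ((1 / 2) ^ J)"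
    using approx unfolding approx_def by blast+
  let ?d = "\<lambda>J t. min 1 (sobolev_norm \<sigma> (S J t - G J t))"
  have "(\<integral>\<^sup>+t. (\<Sum>J. ennreal (?d J t)) \<partial>M) = (\<Sum>J. \<integral>\<^sup>+t. ennreal (?d J t) \<partial>M)"
    by (rule nn_integral_suminf) (rule d)
  also have "\<dots> \<le> (\<Sum>J. ennreal ((1 / 2) ^ J))"
    by (intro suminf_le I less_imp_le summableI)
  also have "\<dots> = ennreal (\<Sum>J. (1 / 2) ^ J)"
    by (intro suminf_ennreal2 summable_geometric) auto
  finally have "(\<integral>\<^sup>+t. (\<Sum>J. ennreal (?d J t)) \<partial>M) \<noteq> \<infinity>"
    by (auto simp: top_unique)
  then have "AE t in M. (\<Sum>J. ennreal (?d J t)) \<noteq> \<infinity>"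
    by (intro nn_integral_noteq_infinite borel_measurable_suminf_order d)
  moreover have "AE t in M. \<forall>J. G J t \<in> sobolev \<sigma>"
    unfolding AE_all_countable using bochner_measurable_AE[OF FJ] by blast
  ultimately have "AE t in M. F t \<in> sobolev \<sigma> \<and> (\<lambda>J. sobolev_norm \<sigma> (S J t - F t)) \<longlonglongrightarrow> 0"
    using lim AE_space
  proof eventually_elim
    case (elim t)
    have "summable (\<lambda>J. ?d J t)"
      using elim(1) by (intro summable_suminf_not_top) (auto simp: sobolev_norm_nonneg)
    then have d0: "(\<lambda>J. ?d J t) \<longlonglongrightarrow> 0" by (rule summable_LIMSEQ_zero)
    then have "\<forall>\<^sub>F J in sequentially. ?d J t < 1" by (rule order_tendstoD) simp
    then have "\<forall>\<^sub>F J in sequentially. ?d J t = sobolev_norm \<sigma> (S J t - G J t)"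
      by eventually_elim auto
    then have "(\<lambda>J. sobolev_norm \<sigma> (S J t - G J t)) \<longlonglongrightarrow> 0"
      by (rule Lim_transform_eventually[OF d0])
    then have "(\<lambda>J. sobolev_norm \<sigma> (S J t - G J t) + sobolev_norm \<sigma> (G J t - F t)) \<longlonglongrightarrow> 0 + 0"
      using elim(3) by (intro tendsto_add) auto
    then have lim: "(\<lambda>J. sobolev_norm \<sigma> (S J t - G J t) + sobolev_norm \<sigma> (G J t - F t)) \<longlonglongrightarrow> 0" by simp
    have "sobolev_norm \<sigma> (S J t - F t) \<le> sobolev_norm \<sigma> (S J t - G J t) + sobolev_norm \<sigma> (G J t - F t)" for J
      using elim by (intro sobolev_norm_triangle S(2)) auto
    from tendsto_zero_squeeze[OF sobolev_norm_nonneg this lim]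
    have "(\<lambda>J. sobolev_norm \<sigma> (S J t - F t)) \<longlonglongrightarrow> 0" .
    then show ?case using elim(3) by blast
  qed
  then show ?thesis by (intro bochner_measurableI[of S] S) auto
qed

text \<open>
  A function that is measurable into a large Sobolev space and takes values in a smaller one is
  measurable into the latter: its truncations in frequency are measurable into every Sobolev space and
  converge in the strong norm.
\<close>

lemma bochner_measurable_upgrade:
  assumes F: "bochner_measurable M \<sigma> (F :: real \<Rightarrow> 'a tempered_distribution)" and t: "AE t in M. F t \<in> sobolev \<tau>"
  shows "bochner_measurable M \<tau> F"
proof (rule bochner_measurable_limit)
  show "bochner_measurable M \<tau> (\<lambda>t. lowpass n (F t))" for n by (rule bochner_measurable_lowpass[OF F])
  show "AE t in M. F t \<in> sobolev \<tau> \<and> (\<lambda>n. sobolev_norm \<tau> (lowpass n (F t) - F t)) \<longlonglongrightarrow> 0"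
    using t by eventually_elim (auto intro: lowpass_tendsto)
qed

section \<open>Lebesgue norms in time of Sobolev-valued functions\<close>

text \<open>
  \<open>F \<in> L\<^sup>\<mu>((0,T); H\<^sup>\<sigma>)\<close> with norm at most \<open>B\<close>; \<open>Lmu_leI_norm\<close> and \<open>Lmu_leD\<close>
  translate from and to membership and norm.
\<close>

definition Lmu_le :: "real \<Rightarrow> (real \<Rightarrow> 'a tempered_distribution) \<Rightarrow> real \<Rightarrow> bool" where
  "Lmu_le \<sigma> F B \<longleftrightarrow> bochner_measurable M \<sigma> F \<and> Lp_le M \<mu> (\<lambda>t. sobolev_norm \<sigma> (F t)) B"

lemma Lmu_le_bochner: "Lmu_le \<sigma> F B \<Longrightarrow> bochner_measurable M \<sigma> F"
  by (simp add: Lmu_le_def)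

lemma Lmu_le_nonneg: "Lmu_le \<sigma> F B \<Longrightarrow> 0 \<le> B"
  by (auto simp: Lmu_le_def dest: Lp_leD)

lemma AE_M_nontrivial: "ae_filter M \<noteq> bot"
proof -
  have "emeasure M (space M) = ennreal T"
    using T by (simp add: emeasure_restrict_space)
  then show ?thesis using T by (simp add: ae_filter_eq_bot_iff)
qed

lemma Lmu_leI_norm:
  assumes F: "F \<in> Lmu_sobolev \<mu> T \<sigma>"
  shows "Lmu_le \<sigma> F (Lmu_sobolev_norm \<mu> T \<sigma> F)"
proof -
  let ?f = "\<lambda>t. sobolev_norm \<sigma> (F t)"
  have bm: "bochner_measurable M \<sigma> F" using F by (simp add: Lmu_sobolev_def)
  have [measurable]: "?f \<in> borel_measurable M" by (rule bochner_measurable_norm[OF bm])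
  have "Lp_le M \<mu> ?f (Lmu_sobolev_norm \<mu> T \<sigma> F)"
  proof (cases "\<mu> = \<infinity>")
    case True
    define e where "e = esssup M (\<lambda>t. ereal (?f t))"
    have e: "e < \<infinity>" using F True by (simp add: Lmu_sobolev_def e_def)
    have AE: "AE t in M. ereal (?f t) \<le> e" unfolding e_def by (rule esssup_AE)
    then have "AE t in M. 0 \<le> e"
      by eventually_elim (metis ereal_less_eq(5) order_trans sobolev_norm_nonneg)
    then have e0: "0 \<le> e"
      using AE_M_nontrivial by simp
    then obtain b where b: "e = ereal b" "0 \<le> b" using e by (cases e) auto
    have "AE t in M. \<bar>?f t\<bar> \<le> b" using AE by eventually_elim (simp add: b sobolev_norm_nonneg)
    then show ?thesis
      using True b by (simp add: Lp_le_def Lmu_sobolev_norm_def e_def[symmetric])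
  next
    case False
    define p where "p = enn2real \<mu>"
    have p: "1 \<le> p" using exponent_ge[of 1 \<mu>] \<mu>1 False by (simp add: p_def)
    have int: "integrable M (\<lambda>t. ?f t powr p)" using F False by (simp add: Lmu_sobolev_def p_def)
    define I where "I = (LINT t|M. ?f t powr p)"
    have I: "0 \<le> I" by (simp add: I_def)
    have "(\<integral>\<^sup>+t. ennreal (\<bar>?f t\<bar> powr p) \<partial>M) = ennreal I"
      unfolding I_def using nn_integral_eq_integral[OF int] by (simp add: sobolev_norm_nonneg)
    also have "I = (I powr (1 / p)) powr p" using I p by (simp add: powr_powr)
    finally show ?thesis
      using False by (simp add: Lp_le_def Lmu_sobolev_norm_def p_def[symmetric] I_def[symmetric])
  qed
  then show ?thesis using bm by (simp add: Lmu_le_def)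
qed

lemma Lmu_leD:
  assumes "Lmu_le \<sigma> F B"
  shows "F \<in> Lmu_sobolev \<mu> T \<sigma>" "Lmu_sobolev_norm \<mu> T \<sigma> F \<le> B"
proof -
  let ?f = "\<lambda>t. sobolev_norm \<sigma> (F t)"
  have bm: "bochner_measurable M \<sigma> F" using assms by (simp add: Lmu_le_def)
  have [measurable]: "?f \<in> borel_measurable M" by (rule bochner_measurable_norm[OF bm])
  have B: "0 \<le> B" by (rule Lmu_le_nonneg[OF assms])
  have "F \<in> Lmu_sobolev \<mu> T \<sigma> \<and> Lmu_sobolev_norm \<mu> T \<sigma> F \<le> B"
  proof (cases "\<mu> = \<infinity>")
    case True
    define e where "e = esssup M (\<lambda>t. ereal (?f t))"
    have "AE t in M. \<bar>?f t\<bar> \<le> B" using assms True unfolding Lmu_le_def Lp_le_def by simp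
    then have "AE t in M. ereal (?f t) \<le> ereal B" by eventually_elim auto
    then have e: "e \<le> ereal B" unfolding e_def by (intro esssup_I) auto
    then have "real_of_ereal e \<le> B" using B by (cases e) auto
    then show ?thesis
      using bm True e by (auto simp: Lmu_sobolev_def Lmu_sobolev_norm_def e_def[symmetric])
  next
    case False
    define p where "p = enn2real \<mu>"
    have p: "1 \<le> p" using exponent_ge[of 1 \<mu>] \<mu>1 False by (simp add: p_def)
    have le: "(\<integral>\<^sup>+t. ennreal (?f t powr p) \<partial>M) \<le> ennreal (B powr p)"
      using assms False by (simp add: Lmu_le_def Lp_le_def p_def sobolev_norm_nonneg)
    then have int: "integrable M (\<lambda>t. ?f t powr p)"
      by (intro integrableI_bounded) (auto simp: le_less_trans[OF _ ennreal_less_top])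
    have "ennreal (LINT t|M. ?f t powr p) \<le> ennreal (B powr p)"
      using le nn_integral_eq_integral[OF int] by simp
    then have "(LINT t|M. ?f t powr p) \<le> B powr p" by simp
    then have "(LINT t|M. ?f t powr p) powr (1 / p) \<le> (B powr p) powr (1 / p)"
      using p by (intro powr_mono2) auto
    also have "\<dots> = B" using B p by (simp add: powr_powr)
    finally show ?thesis
      using bm int False by (simp add: Lmu_sobolev_def Lmu_sobolev_norm_def p_def[symmetric])
  qed
  then show "F \<in> Lmu_sobolev \<mu> T \<sigma>" "Lmu_sobolev_norm \<mu> T \<sigma> F \<le> B" by auto
qed

lemma Lmu_le_by_norm:
  assumes "bochner_measurable M \<sigma> F" and "Lp_le M \<mu> g B" and "AE t in M. sobolev_norm \<sigma> (F t) \<le> g t"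
  shows "Lmu_le \<sigma> F B"
  unfolding Lmu_le_def
proof (intro conjI assms(1) Lp_le_mono[OF bochner_measurable_norm[OF assms(1)] _ assms(2)] order_refl)
  show "AE t in M. \<bar>sobolev_norm \<sigma> (F t)\<bar> \<le> \<bar>g t\<bar>"
    using assms(3) by eventually_elim (simp add: sobolev_norm_nonneg)
qed

lemma Lmu_le_mono: "Lmu_le \<sigma> F A \<Longrightarrow> A \<le> B \<Longrightarrow> Lmu_le \<sigma> F B"
  unfolding Lmu_le_def by (auto intro: Lp_le_mono dest: Lp_leD)

lemma Lmu_le_lower:
  assumes F: "Lmu_le \<sigma> F B" and "\<tau> \<le> \<sigma>"
  shows "Lmu_le \<tau> F B"
proof (rule Lmu_le_by_norm)
  show "bochner_measurable M \<tau> F" using Lmu_le_bochner[OF F] assms(2) by (rule bochner_measurable_mono)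
  show "Lp_le M \<mu> (\<lambda>t. sobolev_norm \<sigma> (F t)) B" using F by (simp add: Lmu_le_def)
  show "AE t in M. sobolev_norm \<tau> (F t) \<le> sobolev_norm \<sigma> (F t)"
    using bochner_measurable_AE[OF Lmu_le_bochner[OF F]] by eventually_elim (rule sobolev_mono(2)[OF _ assms(2)])
qed

lemma Lmu_le_diff:
  assumes F: "Lmu_le \<sigma> F A" and G: "Lmu_le \<sigma> G B"
  shows "Lmu_le \<sigma> (\<lambda>t. F t - G t) (A + B)"
proof (rule Lmu_le_by_norm)
  show "bochner_measurable M \<sigma> (\<lambda>t. F t - G t)"
    using F G by (intro bochner_measurable_diff Lmu_le_bochner)
  show "Lp_le M \<mu> (\<lambda>t. sobolev_norm \<sigma> (F t) + sobolev_norm \<sigma> (G t)) (A + B)"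
    using F G by (intro Lp_le_add \<mu>1) (auto simp: Lmu_le_def)
  show "AE t in M. sobolev_norm \<sigma> (F t - G t) \<le> sobolev_norm \<sigma> (F t) + sobolev_norm \<sigma> (G t)"
    using bochner_measurable_AE[OF Lmu_le_bochner[OF F]] bochner_measurable_AE[OF Lmu_le_bochner[OF G]]
    by eventually_elim (rule sobolev_diff(2))
qed

lemma Lmu_le_add:
  assumes F: "Lmu_le \<sigma> F A" and G: "Lmu_le \<sigma> G B"
  shows "Lmu_le \<sigma> (\<lambda>t. F t + G t) (A + B)"
proof (rule Lmu_le_by_norm)
  show "bochner_measurable M \<sigma> (\<lambda>t. F t + G t)"
    using F G by (intro bochner_measurable_add Lmu_le_bochner)
  show "Lp_le M \<mu> (\<lambda>t. sobolev_norm \<sigma> (F t) + sobolev_norm \<sigma> (G t)) (A + B)"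
    using F G by (intro Lp_le_add \<mu>1) (auto simp: Lmu_le_def)
  show "AE t in M. sobolev_norm \<sigma> (F t + G t) \<le> sobolev_norm \<sigma> (F t) + sobolev_norm \<sigma> (G t)"
    using bochner_measurable_AE[OF Lmu_le_bochner[OF F]] bochner_measurable_AE[OF Lmu_le_bochner[OF G]]
    by eventually_elim (rule sobolev_add(2))
qed

lemma Lmu_le_triangle:
  assumes "Lmu_le \<sigma> (\<lambda>t. F t - G t) A" and "Lmu_le \<sigma> G B"
  shows "Lmu_le \<sigma> F (A + B)"
  using Lmu_le_add[OF assms] by simp

lemma Lmu_le_block:
  assumes F: "Lmu_le \<sigma> F B"
  shows "Lmu_le \<tau> (\<lambda>t. LP_block \<psi> j (F t)) (bernstein j (\<tau> - \<sigma>) * B)"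
proof (rule Lmu_le_by_norm)
  show "bochner_measurable M \<tau> (\<lambda>t. LP_block \<psi> j (F t))"
    by (rule bochner_measurable_block[OF Lmu_le_bochner[OF F]])
  show "Lp_le M \<mu> (\<lambda>t. bernstein j (\<tau> - \<sigma>) * sobolev_norm \<sigma> (F t)) (bernstein j (\<tau> - \<sigma>) * B)"
    using Lp_le_cmult[of M \<mu> "\<lambda>t. sobolev_norm \<sigma> (F t)" B "bernstein j (\<tau> - \<sigma>)"] F
    by (simp add: Lmu_le_def bernstein_nonneg)
  show "AE t in M. sobolev_norm \<tau> (LP_block \<psi> j (F t)) \<le> bernstein j (\<tau> - \<sigma>) * sobolev_norm \<sigma> (F t)"
    using bochner_measurable_AE[OF Lmu_le_bochner[OF F]] by eventually_elim (rule block_le(2))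
qed

text \<open>
  Only membership of \<open>F t\<close> in the weak space is known beforehand. The norms of the truncations
  \<open>S\<^sub>n (F t)\<close> increase with \<open>n\<close> and are bounded in \<open>L\<^sup>\<mu>\<close> by the square function of the blocks, hence
  they are bounded at almost every time, which gives membership in the strong space; their limit is
  the norm of \<open>F t\<close>.
\<close>

lemma Lmu_le_of_blocks:
  assumes F: "bochner_measurable M \<sigma> F" and d: "\<And>j. Lmu_le s (\<lambda>t. LP_block \<psi> j (F t)) (d j)"
    and D: "0 \<le> D" "\<And>n. (\<Sum>j\<le>n. (d j)\<^sup>2) \<le> D\<^sup>2"
  shows "Lmu_le s F (sqrt 2 * D)"
proof -
  have AE: "AE t in M. F t \<in> sobolev \<sigma>" by (rule bochner_measurable_AE[OF F])
  define h where "h n t = sobolev_norm s (lowpass n (F t))" for n t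
  have h: "Lp_le M \<mu> (h n) (sqrt 2 * D)" for n
  proof (rule Lp_le_mono)
    show "h n \<in> borel_measurable M"
      unfolding h_def[abs_def] by (intro bochner_measurable_norm bochner_measurable_lowpass[OF F])
    show "Lp_le M \<mu> (\<lambda>t. sqrt 2 * sqrt (\<Sum>j\<le>n. (sobolev_norm s (LP_block \<psi> j (F t)))\<^sup>2)) (\<bar>sqrt 2\<bar> * sqrt (\<Sum>j\<le>n. (d j)\<^sup>2))"
      using d by (intro Lp_le_cmult Lp_le_square_sum \<mu>) (auto simp: Lmu_le_def)
    show "AE t in M. \<bar>h n t\<bar> \<le> \<bar>sqrt 2 * sqrt (\<Sum>j\<le>n. (sobolev_norm s (LP_block \<psi> j (F t)))\<^sup>2)\<bar>"
      using AE
    proof eventually_elim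
      case (elim t)
      have "h n t \<le> sqrt (2 * (\<Sum>j\<le>n. (sobolev_norm s (LP_block \<psi> j (F t)))\<^sup>2))"
        unfolding h_def by (rule real_le_rsqrt[OF lowpass_square_le_sum_blocks[OF elim]])
      then show ?case by (simp add: h_def sobolev_norm_nonneg real_sqrt_mult sum_nonneg)
    qed
    have "sqrt (\<Sum>j\<le>n. (d j)\<^sup>2) \<le> D" using D by (intro real_le_lsqrt) (auto simp: sum_nonneg)
    then show "\<bar>sqrt 2\<bar> * sqrt (\<Sum>j\<le>n. (d j)\<^sup>2) \<le> sqrt 2 * D" by (simp add: mult_left_mono)
  qed
  have inc: "AE t in M. incseq (\<lambda>n. h n t)"
    using AE by eventually_elim (auto simp: h_def incseq_def intro: lowpass_norm_mono)
  have "AE t in M. \<exists>K. \<forall>n. h n t \<le> K"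
    by (rule Lp_le_incseq_AE_bounded[OF h _ inc \<mu>1]) (simp add: h_def sobolev_norm_nonneg)
  with AE have s: "AE t in M. F t \<in> sobolev s"
    by eventually_elim (auto simp: h_def intro: sobolev_of_lowpass(1))
  have bm: "bochner_measurable M s F" by (rule bochner_measurable_upgrade[OF F s])
  have lim: "AE t in M. (\<lambda>n. h n t) \<longlonglongrightarrow> sobolev_norm s (F t)"
    using s
  proof eventually_elim
    case (elim t)
    have "(\<lambda>n. h n t - sobolev_norm s (F t)) \<longlonglongrightarrow> 0"
    proof (rule Lim_null_comparison[OF always_eventually[OF allI]])
      show "norm (h n t - sobolev_norm s (F t)) \<le> sobolev_norm s (lowpass n (F t) - F t)" for n
        unfolding real_norm_def h_def by (rule sobolev_norm_abs_diff[OF lowpass_le(1)[OF elim] elim])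
      show "(\<lambda>n. sobolev_norm s (lowpass n (F t) - F t)) \<longlonglongrightarrow> 0" by (rule lowpass_tendsto[OF elim])
    qed
    then show ?case by (rule LIM_zero_cancel)
  qed
  show ?thesis
    unfolding Lmu_le_def using bm Lp_le_limit[OF h lim bochner_measurable_norm[OF bm] \<mu>1] by blast
qed

section \<open>Continuity in time\<close>

lemma AE_M_interval:
  assumes ae: "AE t in M. P t" and ab: "0 \<le> a" "b \<le> T" "a < b"
  obtains t where "a < t" "t < b" "P t"
proof -
  have "AE t in lebesgue. t \<in> {0<..<T} \<longrightarrow> P t"
    using ae by (subst (asm) AE_restrict_space_iff) auto
  have "\<not> (AE t in lebesgue. t \<notin> {a<..<b})"
  proof
    assume "AE t in lebesgue. t \<notin> {a<..<b}"
    then have "{a<..<b} \<in> null_sets lebesgue"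
      by (subst (asm) AE_iff_null_sets[symmetric]) auto
    then have "emeasure lebesgue {a<..<b} = 0" by blast
    then show False using ab by simp
  qed
  moreover have "AE t in lebesgue. t \<notin> {a<..<b}" if "\<not> (\<exists>t. a < t \<and> t < b \<and> P t)"
    using \<open>AE t in lebesgue. t \<in> {0<..<T} \<longrightarrow> P t\<close>
    by eventually_elim (use that ab in auto)
  ultimately show ?thesis using that by blast
qed

text \<open>
  For \<open>\<mu> = \<infinity>\<close> an essential bound on a block holds at every time for a continuous representative: a
  strict violation at one time would persist on an interval, a set of positive measure.
\<close>

lemma block_sup_bound:
  assumes inf: "\<mu> = \<infinity>" and GF: "AE t in M. G t = F t"
    and G: "\<And>t. t \<in> {0..T} \<Longrightarrow> G t \<in> sobolev \<sigma>"
    and cont: "\<And>t. t \<in> {0..T} \<Longrightarrow> ((\<lambda>t'. sobolev_norm \<sigma> (G t' - G t)) \<longlongrightarrow> 0) (at t within {0..T})"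
    and d: "Lmu_le s (\<lambda>t. LP_block \<psi> j (F t)) d" and t: "t \<in> {0..T}"
  shows "sobolev_norm s (LP_block \<psi> j (G t)) \<le> d"
proof (rule ccontr)
  assume contra: "\<not> ?thesis"
  define e where "e = sobolev_norm s (LP_block \<psi> j (G t)) - d"
  have e: "0 < e" using contra by (simp add: e_def)
  define K where "K = bernstein j (s - \<sigma>) + 1"
  have K: "0 < K" "bernstein j (s - \<sigma>) \<le> K" using bernstein_nonneg[of j "s - \<sigma>"] by (auto simp: K_def)
  have "\<forall>\<^sub>F t' in at t within {0..T}. sobolev_norm \<sigma> (G t' - G t) < e / K"
    using cont[OF t] by (rule order_tendstoD) (use e K in auto)
  then obtain \<delta> where \<delta>: "0 < \<delta>"
    "\<And>t'. t' \<in> {0..T} \<Longrightarrow> t' \<noteq> t \<Longrightarrow> dist t' t < \<delta> \<Longrightarrow> sobolev_norm \<sigma> (G t' - G t) < e / K"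
    unfolding eventually_at by blast
  have "AE t in M. sobolev_norm s (LP_block \<psi> j (F t)) \<le> d"
    using d inf unfolding Lmu_le_def Lp_le_def by (simp add: sobolev_norm_nonneg)
  moreover have "AE t' in M. t' \<noteq> t"
    using AE_not_in[of "{t}" lebesgue] by (subst AE_restrict_space_iff) (auto elim: eventually_mono)
  ultimately have ae: "AE t' in M. sobolev_norm s (LP_block \<psi> j (G t')) \<le> d \<and> t' \<noteq> t"
    using GF by eventually_elim simp
  obtain t' where t': "max 0 (t - \<delta>) < t'" "t' < min T (t + \<delta>)"
    "sobolev_norm s (LP_block \<psi> j (G t')) \<le> d" "t' \<noteq> t"
    using AE_M_interval[OF ae, of "max 0 (t - \<delta>)" "min T (t + \<delta>)"] t T \<delta>(1) by auto
  have Gt: "G t \<in> sobolev \<sigma>" "G t' \<in> sobolev \<sigma>" using G t t' by auto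
  have "sobolev_norm \<sigma> (G t' - G t) < e / K" using t' by (intro \<delta>(2)) (auto simp: dist_real_def)
  then have "K * sobolev_norm \<sigma> (G t' - G t) < e" using K by (simp add: field_simps)
  moreover have "sobolev_norm s (LP_block \<psi> j (G t' - G t)) \<le> K * sobolev_norm \<sigma> (G t' - G t)"
    using block_le(2)[OF sobolev_diff(1)[OF Gt(2,1)], of s j] mult_right_mono[OF K(2) sobolev_norm_nonneg[of \<sigma> "G t' - G t"]] by linarith
  moreover have "\<bar>sobolev_norm s (LP_block \<psi> j (G t')) - sobolev_norm s (LP_block \<psi> j (G t))\<bar> \<le> sobolev_norm s (LP_block \<psi> j (G t' - G t))"
    unfolding LP_block_diff 
    by (intro sobolev_norm_abs_diff block_le(1)[OF Gt(1)] block_le(1)[OF Gt(2)])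
  ultimately show False using t'(3) by (simp add: e_def)
qed

text \<open>
  At every time the square sum of the blocks dominates the \<open>H\<^sup>s\<close> norm. For the continuous representative
  \<open>G\<close>, each block of \<open>G t' - G t\<close> tends to zero, since on a block all Sobolev norms are equivalent, and the blocks are
  dominated by the square-summable bounds, so the square sum tends to zero by Tannery's theorem.
\<close>

lemma C0_sobolev_of_blocks:
  assumes inf: "\<mu> = \<infinity>" and F: "F \<in> C0_sobolev T \<sigma>"
    and d: "\<And>j. Lmu_le s (\<lambda>t. LP_block \<psi> j (F t)) (d j)" and sum: "summable (\<lambda>j. (d j)\<^sup>2)"
  shows "F \<in> C0_sobolev T s"
proof -
  obtain G where GF: "AE t in M. G t = F t" and G: "\<And>t. t \<in> {0..T} \<Longrightarrow> G t \<in> sobolev \<sigma>"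
    and cont: "\<And>t. t \<in> {0..T} \<Longrightarrow> ((\<lambda>t'. sobolev_norm \<sigma> (G t' - G t)) \<longlongrightarrow> 0) (at t within {0..T})"
    using F unfolding C0_sobolev_def by blast
  have bd: "sobolev_norm s (LP_block \<psi> j (G t)) \<le> d j" if "t \<in> {0..T}" for j t
    by (rule block_sup_bound[OF inf GF G cont d that])
  have Gs: "G t \<in> sobolev s" if t: "t \<in> {0..T}" for t
  proof (rule sobolev_of_lowpass(1)[OF G[OF t]])
    fix n
    have "(sobolev_norm s (lowpass n (G t)))\<^sup>2 \<le> 2 * (\<Sum>j\<le>n. (sobolev_norm s (LP_block \<psi> j (G t)))\<^sup>2)"
      by (rule lowpass_square_le_sum_blocks[OF G[OF t]])
    also have "\<dots> \<le> 2 * (\<Sum>j\<le>n. (d j)\<^sup>2)"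
      by (intro mult_left_mono sum_mono power_mono bd t) (auto simp: sobolev_norm_nonneg)
    also have "\<dots> \<le> 2 * (\<Sum>j. (d j)\<^sup>2)"
      by (intro mult_left_mono sum_le_suminf sum) auto
    finally show "sobolev_norm s (lowpass n (G t)) \<le> sqrt (2 * (\<Sum>j. (d j)\<^sup>2))"
      by (rule real_le_rsqrt)
  qed
  have "((\<lambda>t'. sobolev_norm s (G t' - G t)) \<longlongrightarrow> 0) (at t within {0..T})" if t: "t \<in> {0..T}" for t
  proof -
    define a where "a j t' = (if t' \<in> {0..T} then (sobolev_norm s (LP_block \<psi> j (G t' - G t)))\<^sup>2 else 0)" for j t'
    have nontriv: "at t within {0..T} \<noteq> bot"
      using t T by (auto simp: trivial_limit_within islimpt_Icc)
    have alim: "((\<lambda>t'. a j t') \<longlongrightarrow> 0) (at t within {0..T})" for j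
    proof (rule tendsto_zero_squeeze)
      have "((\<lambda>t'. (bernstein j (s - \<sigma>) * sobolev_norm \<sigma> (G t' - G t))\<^sup>2) \<longlongrightarrow> (bernstein j (s - \<sigma>) * 0)\<^sup>2) (at t within {0..T})"
        by (intro tendsto_intros cont t)
      then show "((\<lambda>t'. (bernstein j (s - \<sigma>) * sobolev_norm \<sigma> (G t' - G t))\<^sup>2) \<longlongrightarrow> 0) (at t within {0..T})" by simp
      show "a j t' \<le> (bernstein j (s - \<sigma>) * sobolev_norm \<sigma> (G t' - G t))\<^sup>2" for t'
        using block_le(2)[OF sobolev_diff(1)[OF G G[OF t]], of t' s j]
        by (auto simp: a_def sobolev_norm_nonneg intro!: power_mono)
    qed (simp add: a_def)
    have ab: "norm (a j t') \<le> 4 * (d j)\<^sup>2" for j t'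
    proof (cases "t' \<in> {0..T}")
      case True
      have "sobolev_norm s (LP_block \<psi> j (G t' - G t)) \<le> sobolev_norm s (LP_block \<psi> j (G t')) + sobolev_norm s (LP_block \<psi> j (G t))"
        unfolding LP_block_diff 
        by (intro sobolev_diff(2) block_le(1)[OF G[OF t]] block_le(1)[OF G[OF True]])
      also have "\<dots> \<le> 2 * d j" using bd[OF t, of j] bd[OF True, of j] by simp
      finally have "(sobolev_norm s (LP_block \<psi> j (G t' - G t)))\<^sup>2 \<le> (2 * d j)\<^sup>2"
        by (intro power_mono) (auto simp: sobolev_norm_nonneg)
      then show ?thesis using True by (simp add: a_def power_mult_distrib)
    qed (auto simp: a_def)
    have sd: "summable (\<lambda>j. 4 * (d j)\<^sup>2)" by (rule summable_mult[OF sum])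
    have "((\<lambda>t'. \<Sum>j. a j t') \<longlongrightarrow> (\<Sum>j. 0)) (at t within {0..T})"
      using tannerys_theorem[OF alim always_eventually sd nontriv] ab by auto
    then have "((\<lambda>t'. sqrt (2 * (\<Sum>j. a j t'))) \<longlongrightarrow> sqrt (2 * 0)) (at t within {0..T})"
      by (intro tendsto_intros) simp
    then have lim: "((\<lambda>t'. sqrt (2 * (\<Sum>j. a j t'))) \<longlongrightarrow> 0) (at t within {0..T})" by simp
    have sa: "summable (\<lambda>j. a j t')" for t'
      by (rule summable_comparison_test'[OF sd, of 0]) (rule ab)
    have le: "sobolev_norm s (G t' - G t) \<le> sqrt (2 * (\<Sum>j. a j t'))" if t': "t' \<in> {0..T}" for t'
    proof (rule sobolev_of_lowpass(2)[OF sobolev_diff(1)[OF G[OF t'] G[OF t]]])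
      fix n
      have "(sobolev_norm s (lowpass n (G t' - G t)))\<^sup>2 \<le> 2 * (\<Sum>j\<le>n. (sobolev_norm s (LP_block \<psi> j (G t' - G t)))\<^sup>2)"
        by (rule lowpass_square_le_sum_blocks[OF sobolev_diff(1)[OF G[OF t'] G[OF t]]])
      also have "\<dots> = 2 * (\<Sum>j\<le>n. a j t')" using t' by (simp add: a_def)
      also have "\<dots> \<le> 2 * (\<Sum>j. a j t')"
        by (intro mult_left_mono sum_le_suminf sa) (auto simp: a_def)
      finally show "sobolev_norm s (lowpass n (G t' - G t)) \<le> sqrt (2 * (\<Sum>j. a j t'))"
        by (rule real_le_rsqrt)
    qed
    show ?thesis
    proof (rule real_tendsto_sandwich[OF _ _ tendsto_const lim])
      show "\<forall>\<^sub>F t' in at t within {0..T}. sobolev_norm s (G t' - G t) \<le> sqrt (2 * (\<Sum>j. a j t'))"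
        unfolding eventually_at_filter using le by (intro always_eventually) auto
    qed (simp add: sobolev_norm_nonneg)
  qed
  then show ?thesis unfolding C0_sobolev_def using GF Gs by blast
qed

end

section \<open>Square-summable sequences\<close>

text \<open>
  By the Cauchy-Schwarz inequality with weight \<open>\<kappa> j\<close>, the square of each row sum is at most \<open>A\<close> times
  \<open>\<Sum>k. \<kappa> j k * (x k)\<^sup>2\<close>; summation over \<open>j\<close> uses the column sums.
\<close>

lemma schur_test:
  fixes \<kappa> :: "'i \<Rightarrow> 'k \<Rightarrow> real"
  assumes \<kappa>: "\<And>j k. 0 \<le> \<kappa> j k" and A: "0 \<le> A"
    and row: "\<And>j. j \<in> J \<Longrightarrow> (\<Sum>k\<in>K. \<kappa> j k) \<le> A"
    and col: "\<And>k. k \<in> K \<Longrightarrow> (\<Sum>j\<in>J. \<kappa> j k) \<le> A"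
  shows "L2_set (\<lambda>j. \<Sum>k\<in>K. \<kappa> j k * x k) J \<le> A * L2_set x K"
proof -
  have "(\<Sum>j\<in>J. (\<Sum>k\<in>K. \<kappa> j k * x k)\<^sup>2) \<le> (\<Sum>j\<in>J. A * (\<Sum>k\<in>K. \<kappa> j k * (x k)\<^sup>2))"
  proof (rule sum_mono)
    fix j assume j: "j \<in> J"
    have "(\<Sum>k\<in>K. \<kappa> j k * x k)\<^sup>2 = (\<Sum>k\<in>K. sqrt (\<kappa> j k) * (sqrt (\<kappa> j k) * x k))\<^sup>2"
      using \<kappa> by (simp add: mult.assoc[symmetric])
    also have "\<dots> \<le> (\<Sum>k\<in>K. (sqrt (\<kappa> j k))\<^sup>2) * (\<Sum>k\<in>K. (sqrt (\<kappa> j k) * x k)\<^sup>2)"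
      by (rule Cauchy_Schwarz_ineq_sum)
    also have "\<dots> = (\<Sum>k\<in>K. \<kappa> j k) * (\<Sum>k\<in>K. \<kappa> j k * (x k)\<^sup>2)"
      using \<kappa> by (simp add: power_mult_distrib)
    also have "\<dots> \<le> A * (\<Sum>k\<in>K. \<kappa> j k * (x k)\<^sup>2)"
      using \<kappa> by (intro mult_right_mono row j sum_nonneg mult_nonneg_nonneg) auto
    finally show "(\<Sum>k\<in>K. \<kappa> j k * x k)\<^sup>2 \<le> A * (\<Sum>k\<in>K. \<kappa> j k * (x k)\<^sup>2)" .
  qed
  also have "\<dots> = A * (\<Sum>k\<in>K. (\<Sum>j\<in>J. \<kappa> j k) * (x k)\<^sup>2)"
    unfolding sum_distrib_left[symmetric] sum_distrib_right by (subst sum.swap) (rule refl)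
  also have "\<dots> \<le> A * (\<Sum>k\<in>K. A * (x k)\<^sup>2)"
    by (intro mult_left_mono A sum_mono mult_right_mono col) auto
  also have "\<dots> = (A * L2_set x K)\<^sup>2"
    by (simp add: L2_set_def power_mult_distrib sum_nonneg sum_distrib_left[symmetric] power2_eq_square[of A])
  finally show ?thesis
    unfolding L2_set_def[of "\<lambda>j. \<Sum>k\<in>K. \<kappa> j k * x k"] using A by (intro real_le_lsqrt) auto
qed

text \<open>
  This is \<open>q\<close> to the power \<open>\<bar>j - k\<bar>\<close>, written without truncated subtraction.
\<close>

definition geo_kernel :: "real \<Rightarrow> nat \<Rightarrow> nat \<Rightarrow> real" where
  "geo_kernel q j k = q ^ (max j k - min j k)"

lemma geo_kernel_commute: "geo_kernel q j k = geo_kernel q k j"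
  by (simp add: geo_kernel_def max.commute min.commute)

lemma geo_kernel_nonneg: "0 \<le> q \<Longrightarrow> 0 \<le> geo_kernel q j k"
  by (simp add: geo_kernel_def)

lemma sum_geo_kernel:
  assumes q: "0 < q" "q < 1" and K: "finite K"
  shows "(\<Sum>k\<in>K. geo_kernel q j k) \<le> 2 / (1 - q)"
proof -
  have g: "(\<Sum>i\<in>I. q ^ i) \<le> 1 / (1 - q)" if "finite I" for I
  proof -
    have "(\<Sum>i\<in>I. q ^ i) \<le> (\<Sum>i. q ^ i)" using q that by (intro sum_le_suminf) auto
    then show ?thesis using q by (simp add: suminf_geometric)
  qed
  have "(\<Sum>k\<in>K. geo_kernel q j k) = (\<Sum>k\<in>K \<inter> {..j}. geo_kernel q j k) + (\<Sum>k\<in>K \<inter> {j<..}. geo_kernel q j k)"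
    using K by (subst sum.union_disjoint[symmetric]) (auto intro!: sum.cong)
  also have "(\<Sum>k\<in>K \<inter> {..j}. geo_kernel q j k) = (\<Sum>i\<in>(\<lambda>k. j - k) ` (K \<inter> {..j}). q ^ i)"
    by (subst sum.reindex) (auto simp: inj_on_def geo_kernel_def intro!: sum.cong)
  also have "(\<Sum>k\<in>K \<inter> {j<..}. geo_kernel q j k) = (\<Sum>i\<in>(\<lambda>k. k - j) ` (K \<inter> {j<..}). q ^ i)"
    by (subst sum.reindex) (auto simp: inj_on_def geo_kernel_def intro!: sum.cong)
  also have "(\<Sum>i\<in>(\<lambda>k. j - k) ` (K \<inter> {..j}). q ^ i) + (\<Sum>i\<in>(\<lambda>k. k - j) ` (K \<inter> {j<..}). q ^ i)
     \<le> 1 / (1 - q) + 1 / (1 - q)"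
    using K by (intro add_mono g) auto
  finally show ?thesis by simp
qed

lemma L2_geo_kernel:
  assumes q: "0 < q" "q < 1" and J: "finite J" and K: "finite K"
  shows "L2_set (\<lambda>j. \<Sum>k\<in>K. geo_kernel q j k * x k) J \<le> 2 / (1 - q) * L2_set x K"
proof (rule schur_test)
  show "(\<Sum>j\<in>J. geo_kernel q j k) \<le> 2 / (1 - q)" for k
    using sum_geo_kernel[OF q J, of k] by (simp add: geo_kernel_commute)
qed (use q K in \<open>auto intro: sum_geo_kernel geo_kernel_nonneg\<close>)

lemma powr_le_geo:
  assumes "0 < \<delta>" "\<delta> \<le> a"
  shows "2 powr (- (a * real i)) \<le> (2 powr (- \<delta>)) ^ i"
proof -
  have "2 powr (- (a * real i)) \<le> 2 powr (- (\<delta> * real i))"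
    using assms by (intro powr_mono) (auto intro: mult_right_mono)
  also have "\<dots> = (2 powr (- \<delta>)) ^ i"
    by (simp add: powr_realpow[symmetric] powr_powr)
  finally show ?thesis .
qed

section \<open>Interpolation of weakly Lipschitz, tame maps\<close>

text \<open>
  The hypotheses of the theorem with explicit constants. The Lipschitz hypothesis bounds a norm that
  carries information only on \<open>L\<^sup>\<mu> H\<^bsup>s0\<^esup>\<close>; \<open>maps\<close> ensures that the differences belong to it.
\<close>

locale tame_map = sobolev_evolution \<psi> T \<mu>
  for \<psi> :: "'a::euclidean_space \<Rightarrow> real" and T :: real and \<mu> :: ennreal +
  fixes s0 s s1 r C0 C1 :: real and u0 :: "'a tempered_distribution"
    and \<Phi> :: "'a tempered_distribution \<Rightarrow> real \<Rightarrow> 'a tempered_distribution"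
  assumes s: "s0 < s" "s < s1" and u0: "u0 \<in> sobolev s" and C: "0 < C0" "0 < C1"
    and maps: "v \<in> sobolev_ball s u0 r \<Longrightarrow> \<Phi> v \<in> Lmu_sobolev \<mu> T s0"
    and weak_lipschitz: "v \<in> sobolev_ball s u0 r \<Longrightarrow> w \<in> sobolev_ball s u0 r \<Longrightarrow>
      Lmu_sobolev_norm \<mu> T s0 (\<lambda>t. \<Phi> v t - \<Phi> w t) \<le> C0 * sobolev_norm s0 (v - w)"
    and tame: "(\<And>\<sigma>. v \<in> sobolev \<sigma>) \<Longrightarrow> v \<in> sobolev_ball s u0 r \<Longrightarrow>
      \<Phi> v \<in> Lmu_sobolev \<mu> T s1 \<and> Lmu_sobolev_norm \<mu> T s1 (\<Phi> v) \<le> C1 * sobolev_norm s1 v"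
begin

abbreviation B :: "'a tempered_distribution set" where "B \<equiv> sobolev_ball s u0 r"

lemma ball_sobolev: "v \<in> B \<Longrightarrow> v \<in> sobolev s"
  by (simp add: sobolev_ball_def)

lemma Phi_diff:
  assumes "v \<in> B" "w \<in> B"
  shows "Lmu_le s0 (\<lambda>t. \<Phi> v t - \<Phi> w t) (C0 * sobolev_norm s0 (v - w))"
proof -
  have "(\<lambda>t. \<Phi> v t - \<Phi> w t) \<in> Lmu_sobolev \<mu> T s0"
    by (rule Lmu_leD(1)[OF Lmu_le_diff[OF Lmu_leI_norm[OF maps[OF assms(1)]] Lmu_leI_norm[OF maps[OF assms(2)]]]])
  from Lmu_le_mono[OF Lmu_leI_norm[OF this] weak_lipschitz[OF assms]] show ?thesis .
qed

lemma Phi_lowpass: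
  assumes v: "v \<in> sobolev s" "lowpass n v \<in> B"
  shows "Lmu_le s1 (\<Phi> (lowpass n v)) (C1 * sobolev_norm s1 (lowpass n v))"
proof -
  have "\<Phi> (lowpass n v) \<in> Lmu_sobolev \<mu> T s1 \<and> Lmu_sobolev_norm \<mu> T s1 (\<Phi> (lowpass n v)) \<le> C1 * sobolev_norm s1 (lowpass n v)"
    by (rule tame[OF lowpass_le(1)[OF v(1)] v(2)])
  then show ?thesis using Lmu_le_mono[OF Lmu_leI_norm] by blast
qed

text \<open>
  The geometric decay that the gaps \<open>s - s0\<close> and \<open>s1 - s\<close> provide away from the diagonal.
\<close>

definition rate :: real where "rate = 2 powr (- min (s - s0) (s1 - s))"

text \<open>
  Dominates the block norm of \<open>v\<close> at index \<open>m\<close> and, with the decay that the tame estimate allows, the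
  contribution of all lower blocks. It is still square-summable.
\<close>

definition envelope :: "'a tempered_distribution \<Rightarrow> nat \<Rightarrow> real" where
  "envelope v m = (\<Sum>l\<le>m. geo_kernel rate m l * sobolev_norm s (LP_block \<psi> l v))"

definition schur_const :: real where "schur_const = 2 / (1 - rate)"

definition block_const :: real where "block_const = C0 * 64 powr (s - s0) + 2 * C1 * 64 powr (s1 - s)"

lemma rate: "0 < rate" "rate < 1"
proof -
  have "2 powr (- min (s - s0) (s1 - s)) < 2 powr 0" using s by (intro powr_less_mono) auto
  then show "0 < rate" "rate < 1" by (auto simp: rate_def)
qed

lemma schur_const: "1 \<le> schur_const"
  using rate by (simp add: schur_const_def divide_simps)

lemma block_const: "0 \<le> block_const"
  using C by (simp add: block_const_def)

lemma envelope_nonneg: "0 \<le> envelope v m"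
  unfolding envelope_def using rate by (intro sum_nonneg mult_nonneg_nonneg geo_kernel_nonneg) (auto simp: sobolev_norm_nonneg)

lemma block_le_envelope: "sobolev_norm s (LP_block \<psi> m v) \<le> envelope v m"
proof -
  have "geo_kernel rate m m * sobolev_norm s (LP_block \<psi> m v) \<le> envelope v m"
    unfolding envelope_def using rate
    by (intro member_le_sum[of m "{..m}" "\<lambda>l. geo_kernel rate m l * sobolev_norm s (LP_block \<psi> l v)"])
      (auto intro!: mult_nonneg_nonneg geo_kernel_nonneg simp: sobolev_norm_nonneg)
  then show ?thesis by (simp add: geo_kernel_def)
qed

lemma L2_envelope:
  assumes v: "v \<in> sobolev s" and J: "finite J"
  shows "L2_set (envelope v) J \<le> schur_const * sobolev_norm s v"
proof -
  define N where "N = (if J = {} then 0 else Max J)"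
  have N: "m \<le> N" if "m \<in> J" for m using J that by (auto simp: N_def)
  let ?c = "\<lambda>l. sobolev_norm s (LP_block \<psi> l v)"
  have "L2_set (envelope v) J \<le> L2_set (\<lambda>m. \<Sum>l\<le>N. geo_kernel rate m l * ?c l) J"
  proof (rule L2_set_mono)
    fix m assume m: "m \<in> J"
    show "envelope v m \<le> (\<Sum>l\<le>N. geo_kernel rate m l * ?c l)"
      unfolding envelope_def using N[OF m] rate
      by (intro sum_mono2) (auto intro!: mult_nonneg_nonneg geo_kernel_nonneg simp: sobolev_norm_nonneg)
  qed (rule envelope_nonneg)
  also have "\<dots> \<le> schur_const * L2_set ?c {..N}"
    unfolding schur_const_def using rate J by (intro L2_geo_kernel) auto
  also have "L2_set ?c {..N} \<le> sobolev_norm s v"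
    unfolding L2_set_def using sum_blocks_le[OF v] by (intro real_le_lsqrt) (auto simp: sobolev_norm_nonneg sum_nonneg)
  finally show ?thesis using schur_const by (simp add: mult_left_mono)
qed

lemma envelope_triangle:
  assumes "v \<in> sobolev s" "w \<in> sobolev s"
  shows "envelope w m \<le> envelope v m + envelope (w - v) m"
proof -
  have "sobolev_norm s (LP_block \<psi> l w) \<le> sobolev_norm s (LP_block \<psi> l v) + sobolev_norm s (LP_block \<psi> l (w - v))" for l
    using sobolev_add(2)[OF block_le(1)[OF assms(1), where j = l and \<tau> = s]
        block_le(1)[OF sobolev_diff(1)[OF assms(2,1)], where j = l and \<tau> = s]]
    by (simp add: LP_block_diff)
  then show ?thesis
    unfolding envelope_def sum.distrib[symmetric] distrib_left[symmetric] using rate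
    by (intro sum_mono mult_left_mono geo_kernel_nonneg) auto
qed

text \<open>
  The heart of the proof. At output frequencies below the input frequency, \<open>j \<le> Suc k\<close>, the
  Lipschitz bound at level \<open>s0\<close> wins; above it the tame bound at level \<open>s1\<close> does. The tame bound
  sees \<open>S\<^bsub>k+1\<^esub> v\<close> in the norm \<open>s1\<close>, whose blocks grow like \<open>2\<^bsup>(s1-s)l\<^esup>\<close>, so that the last ones
  dominate and their sum is of the size of the envelope.
\<close>

lemma increment_block:
  assumes v: "v \<in> sobolev s" and B: "lowpass k v \<in> B" "lowpass (Suc k) v \<in> B"
  shows "Lmu_le s (\<lambda>t. LP_block \<psi> j (\<Phi> (lowpass (Suc k) v) t - \<Phi> (lowpass k v) t))
    (block_const * geo_kernel rate j (Suc k) * envelope v (Suc k))"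
proof -
  let ?a = "s - s0" and ?b = "s1 - s" and ?m = "Suc k"
  let ?D = "\<lambda>t. \<Phi> (lowpass (Suc k) v) t - \<Phi> (lowpass k v) t"
  let ?c = "\<lambda>l. sobolev_norm s (LP_block \<psi> l v)"
  have d: "0 < min ?a ?b" using s by simp
  have kn: "0 \<le> geo_kernel rate j ?m" using rate by (intro geo_kernel_nonneg) auto
  have e0: "0 \<le> envelope v ?m" by (rule envelope_nonneg)
  show ?thesis
  proof (cases "j \<le> ?m")
    case True
    have "Lmu_le s0 ?D (C0 * sobolev_norm s0 (LP_block \<psi> ?m v))"
      using Phi_diff[OF B(2,1)] by (simp add: lowpass_Suc_diff)
    moreover have "C0 * sobolev_norm s0 (LP_block \<psi> ?m v) \<le> C0 * (bernstein ?m (s0 - s) * envelope v ?m)"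
      using block_bernstein(2)[OF v block_le(1)[OF v, where \<tau> = s], where j = "Suc k" and \<tau> = s0] C
        mult_left_mono[OF block_le_envelope[of ?m v] bernstein_nonneg[of ?m "s0 - s"]]
      by (intro mult_left_mono) auto
    ultimately have "Lmu_le s0 ?D (C0 * (bernstein ?m (s0 - s) * envelope v ?m))"
      by (rule Lmu_le_mono)
    then have "Lmu_le s (\<lambda>t. LP_block \<psi> j (?D t)) (bernstein j (s - s0) * (C0 * (bernstein ?m (s0 - s) * envelope v ?m)))"
      by (rule Lmu_le_block)
    then show ?thesis
    proof (rule Lmu_le_mono)
      have "bernstein j (s - s0) * bernstein ?m (s0 - s) = 64 powr ?a * 2 powr (- (?a * real (?m - j)))"
      proof -
        have "(8::real) powr ?a * 8 powr ?a = 64 powr ?a" by (simp add: powr_mult[symmetric])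
        moreover have "(2::real) powr (real j * (s - s0)) * 2 powr (real ?m * (s0 - s)) = 2 powr (- (?a * real (?m - j)))"
          using True by (simp add: powr_add[symmetric] of_nat_diff algebra_simps)
        ultimately show ?thesis using s by (simp add: bernstein_def abs_of_nonneg abs_of_nonpos mult_ac)
      qed
      also have "\<dots> \<le> 64 powr ?a * geo_kernel rate j ?m"
        using powr_le_geo[OF d, of ?a "?m - j"] True by (intro mult_left_mono) (auto simp: rate_def geo_kernel_def max_def)
      finally have "C0 * (bernstein j (s - s0) * bernstein ?m (s0 - s)) * envelope v ?m \<le> C0 * (64 powr ?a * geo_kernel rate j ?m) * envelope v ?m"
        using C e0 by (intro mult_right_mono mult_left_mono) auto
      also have "\<dots> = (C0 * 64 powr ?a) * (geo_kernel rate j ?m * envelope v ?m)" by (simp add: mult_ac)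
      also have "\<dots> \<le> block_const * (geo_kernel rate j ?m * envelope v ?m)"
        using C kn e0 by (intro mult_right_mono mult_nonneg_nonneg) (auto simp: block_const_def)
      finally show "bernstein j (s - s0) * (C0 * (bernstein ?m (s0 - s) * envelope v ?m)) \<le> block_const * geo_kernel rate j ?m * envelope v ?m"
        by (simp add: mult_ac)
    qed
  next
    case False
    have low: "sobolev_norm s1 (lowpass n v) \<le> 8 powr ?b * (\<Sum>l\<le>?m. 2 powr (real l * ?b) * ?c l)" if "n \<le> ?m" for n
    proof -
      have "sobolev_norm s1 (lowpass n v) \<le> (\<Sum>l\<le>n. sobolev_norm s1 (LP_block \<psi> l v))"
        by (rule lowpass_le_sum_blocks[OF v])
      also have "\<dots> \<le> (\<Sum>l\<le>?m. sobolev_norm s1 (LP_block \<psi> l v))"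
        using that by (intro sum_mono2) (auto simp: sobolev_norm_nonneg)
      also have "\<dots> \<le> (\<Sum>l\<le>?m. bernstein l ?b * ?c l)"
        by (intro sum_mono block_bernstein(2)[OF v block_le(1)[OF v]])
      also have "\<dots> = 8 powr ?b * (\<Sum>l\<le>?m. 2 powr (real l * ?b) * ?c l)"
        unfolding sum_distrib_left using s by (intro sum.cong) (auto simp: bernstein_def)
      finally show ?thesis .
    qed
    have env: "(\<Sum>l\<le>?m. 2 powr (real l * ?b) * ?c l) \<le> 2 powr (real ?m * ?b) * envelope v ?m"
      unfolding envelope_def sum_distrib_left
    proof (rule sum_mono)
      fix l assume l: "l \<in> {..?m}"
      have "2 powr (real l * ?b) = 2 powr (real ?m * ?b) * 2 powr (- (?b * real (?m - l)))"
        using l by (simp add: powr_add[symmetric] of_nat_diff algebra_simps)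
      also have "\<dots> \<le> 2 powr (real ?m * ?b) * geo_kernel rate ?m l"
        using powr_le_geo[OF d, of ?b "?m - l"] l by (intro mult_left_mono) (auto simp: rate_def geo_kernel_def max_def min_def)
      finally have "2 powr (real l * ?b) * ?c l \<le> 2 powr (real ?m * ?b) * geo_kernel rate ?m l * ?c l"
        by (intro mult_right_mono) (auto simp: sobolev_norm_nonneg)
      then show "2 powr (real l * ?b) * ?c l \<le> 2 powr (real ?m * ?b) * (geo_kernel rate ?m l * ?c l)"
        by (simp add: mult.assoc)
    qed
    let ?L = "8 powr ?b * (2 powr (real ?m * ?b) * envelope v ?m)"
    have L: "sobolev_norm s1 (lowpass n v) \<le> ?L" if "n \<le> ?m" for n
      by (rule order_trans[OF low[OF that] mult_left_mono[OF env]]) simp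
    have "Lmu_le s1 ?D (C1 * sobolev_norm s1 (lowpass ?m v) + C1 * sobolev_norm s1 (lowpass k v))"
      by (intro Lmu_le_diff Phi_lowpass v B)
    moreover have "C1 * sobolev_norm s1 (lowpass ?m v) + C1 * sobolev_norm s1 (lowpass k v) \<le> 2 * C1 * ?L"
    proof -
      have "C1 * sobolev_norm s1 (lowpass ?m v) + C1 * sobolev_norm s1 (lowpass k v) \<le> C1 * ?L + C1 * ?L"
        using C by (intro add_mono mult_left_mono L) auto
      also have "\<dots> = 2 * C1 * ?L" by (simp only: mult_2 distrib_right)
      finally show ?thesis .
    qed
    ultimately have "Lmu_le s1 ?D (2 * C1 * ?L)" by (rule Lmu_le_mono)
    then have "Lmu_le s (\<lambda>t. LP_block \<psi> j (?D t)) (bernstein j (s - s1) * (2 * C1 * ?L))"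
      by (rule Lmu_le_block)
    then show ?thesis
    proof (rule Lmu_le_mono)
      have "bernstein j (s - s1) * (8 powr ?b * 2 powr (real ?m * ?b)) = 64 powr ?b * 2 powr (- (?b * real (j - ?m)))"
      proof -
        have "(8::real) powr ?b * 8 powr ?b = 64 powr ?b" by (simp add: powr_mult[symmetric])
        moreover have "(2::real) powr (real j * (s - s1)) * 2 powr (real ?m * ?b) = 2 powr (- (?b * real (j - ?m)))"
          using False by (simp add: powr_add[symmetric] of_nat_diff algebra_simps)
        ultimately show ?thesis using s by (simp add: bernstein_def abs_of_nonneg abs_of_nonpos mult_ac)
      qed
      also have "\<dots> \<le> 64 powr ?b * geo_kernel rate j ?m"
        using powr_le_geo[OF d, of ?b "j - ?m"] False by (intro mult_left_mono) (auto simp: rate_def geo_kernel_def max_def)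
      finally have "2 * C1 * (bernstein j (s - s1) * (8 powr ?b * 2 powr (real ?m * ?b))) * envelope v ?m \<le> 2 * C1 * (64 powr ?b * geo_kernel rate j ?m) * envelope v ?m"
        using C e0 by (intro mult_right_mono mult_left_mono) auto
      also have "\<dots> = (2 * C1 * 64 powr ?b) * (geo_kernel rate j ?m * envelope v ?m)" by (simp add: mult_ac)
      also have "\<dots> \<le> block_const * (geo_kernel rate j ?m * envelope v ?m)"
        using C kn e0 by (intro mult_right_mono mult_nonneg_nonneg) (auto simp: block_const_def)
      finally show "bernstein j (s - s1) * (2 * C1 * ?L) \<le> block_const * geo_kernel rate j ?m * envelope v ?m"
        by (simp add: mult_ac)
    qed
  qed
qed


lemma telescoped_block:
  assumes v: "v \<in> sobolev s" and B: "\<And>k. n \<le> k \<Longrightarrow> lowpass k v \<in> B" and "n \<le> N"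
  shows "Lmu_le s (\<lambda>t. LP_block \<psi> j (\<Phi> (lowpass N v) t - \<Phi> (lowpass n v) t))
    (\<Sum>m\<in>{n<..N}. block_const * geo_kernel rate j m * envelope v m)"
  using \<open>n \<le> N\<close>
proof (induction N rule: dec_induct)
  case base
  have "Lmu_le s (\<lambda>t. LP_block \<psi> j (\<Phi> (lowpass n v) t - \<Phi> (lowpass n v) t))
     (bernstein j (s - s0) * (C0 * sobolev_norm s0 (lowpass n v - lowpass n v)))"
    by (rule Lmu_le_block[OF Phi_diff[OF B B]]) simp_all
  then show ?case
    unfolding sobolev_norm_self_diff[OF lowpass_le(1)[OF v]] by simp
next
  case (step N)
  have "Lmu_le s (\<lambda>t. LP_block \<psi> j (\<Phi> (lowpass (Suc N) v) t - \<Phi> (lowpass N v) t) + LP_block \<psi> j (\<Phi> (lowpass N v) t - \<Phi> (lowpass n v) t))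
     (block_const * geo_kernel rate j (Suc N) * envelope v (Suc N) + (\<Sum>m\<in>{n<..N}. block_const * geo_kernel rate j m * envelope v m))"
    using step.hyps by (intro Lmu_le_add increment_block v B step.IH) auto
  moreover have "{n<..Suc N} = insert (Suc N) {n<..N}" using step.hyps by auto
  ultimately show ?case by (simp add: LP_block_diff)
qed

text \<open>
  On a fixed block, \<open>\<Phi> (S\<^sub>N v)\<close> converges to \<open>\<Phi> v\<close> in the norm \<open>s\<close>, because it does so at level
  \<open>s0\<close>. Finitely many blocks of the telescoping sum up to \<open>N\<close> are bounded by the Schur test uniformly
  in \<open>N\<close>.
\<close>

lemma tail_blocks:
  assumes v: "v \<in> B" and B: "\<And>k. n \<le> k \<Longrightarrow> lowpass k v \<in> B"
    and E: "0 \<le> E" "\<And>N. L2_set (envelope v) {n<..N} \<le> E"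
  obtains d where "\<And>j. Lmu_le s (\<lambda>t. LP_block \<psi> j (\<Phi> v t - \<Phi> (lowpass n v) t)) (d j)"
    "\<And>J. (\<Sum>j\<le>J. (d j)\<^sup>2) \<le> (block_const * schur_const * E)\<^sup>2"
proof -
  have vs: "v \<in> sobolev s" by (rule ball_sobolev[OF v])
  let ?F = "\<lambda>j t. LP_block \<psi> j (\<Phi> v t - \<Phi> (lowpass n v) t)"
  define d where "d j = Lmu_sobolev_norm \<mu> T s (?F j)" for j
  define R where "R j N = bernstein j (s - s0) * (C0 * sobolev_norm s0 (v - lowpass N v))" for j N
  define f where "f j N = (\<Sum>m\<in>{n<..N}. block_const * geo_kernel rate j m * envelope v m)" for j N
  have bd: "Lmu_le s (?F j) (R j N + f j N)" if "n \<le> N" for j N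
  proof -
    have "Lmu_le s (\<lambda>t. LP_block \<psi> j (\<Phi> v t - \<Phi> (lowpass N v) t) + LP_block \<psi> j (\<Phi> (lowpass N v) t - \<Phi> (lowpass n v) t)) (R j N + f j N)"
      unfolding R_def f_def
      by (intro Lmu_le_add Lmu_le_block[OF Phi_diff[OF v B[OF that]]] telescoped_block vs B that)
    then show ?thesis by (simp add: LP_block_diff)
  qed
  have d: "Lmu_le s (?F j) (d j)" for j
    unfolding d_def by (rule Lmu_leI_norm[OF Lmu_leD(1)[OF bd[OF order_refl]]])
  have d0: "0 \<le> d j" for j by (rule Lmu_le_nonneg[OF d])
  have dle: "d j \<le> R j N + f j N" if "n \<le> N" for j N
    unfolding d_def by (rule Lmu_leD(2)[OF bd[OF that]])
  have R0: "(\<lambda>N. R j N) \<longlonglongrightarrow> 0" for j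
  proof -
    have "(\<lambda>N. sobolev_norm s0 (v - lowpass N v)) \<longlonglongrightarrow> 0"
    proof (rule tendsto_zero_squeeze[OF sobolev_norm_nonneg _ lowpass_tendsto[OF vs]])
      show "sobolev_norm s0 (v - lowpass N v) \<le> sobolev_norm s (lowpass N v - v)" for N
        using sobolev_mono(2)[OF sobolev_diff(1)[OF vs lowpass_le(1)[OF vs]], of s0 N] s
          sobolev_norm_minus_commute[OF vs lowpass_le(1)[OF vs, where n = N]] by simp
    qed
    then have "(\<lambda>N. bernstein j (s - s0) * (C0 * sobolev_norm s0 (v - lowpass N v))) \<longlonglongrightarrow> bernstein j (s - s0) * (C0 * 0)"
      by (intro tendsto_mult_left)
    then show ?thesis by (simp add: R_def)
  qed
  have fJ: "L2_set (\<lambda>j. f j N) {..J} \<le> block_const * schur_const * E" for J N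
  proof -
    have "L2_set (\<lambda>j. f j N) {..J} = block_const * L2_set (\<lambda>j. \<Sum>m\<in>{n<..N}. geo_kernel rate j m * envelope v m) {..J}"
      unfolding f_def L2_set_right_distrib[OF block_const] by (simp add: sum_distrib_left mult.assoc)
    also have "\<dots> \<le> block_const * (schur_const * L2_set (envelope v) {n<..N})"
      unfolding schur_const_def using rate by (intro mult_left_mono L2_geo_kernel block_const) auto
    also have "\<dots> \<le> block_const * (schur_const * E)"
      using schur_const by (intro mult_left_mono E block_const) auto
    finally show ?thesis by (simp add: mult.assoc)
  qed
  \<comment> \<open>The remainders \<open>R j N\<close> vanish as \<open>N\<close> grows, for the finitely many \<open>j \<le> J\<close>.\<close>
  have dJ: "L2_set d {..J} \<le> block_const * schur_const * E" for J
  proof (rule LIMSEQ_le_const)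
    have "(\<lambda>N. (\<Sum>j\<le>J. R j N) + block_const * schur_const * E) \<longlonglongrightarrow> (\<Sum>j\<le>J. 0) + block_const * schur_const * E"
      by (intro tendsto_intros R0)
    then show "(\<lambda>N. (\<Sum>j\<le>J. R j N) + block_const * schur_const * E) \<longlonglongrightarrow> block_const * schur_const * E" by simp
    have "L2_set d {..J} \<le> (\<Sum>j\<le>J. R j N) + block_const * schur_const * E" if "n \<le> N" for N
    proof -
      have Rn: "0 \<le> R j N" for j
        unfolding R_def using C by (intro mult_nonneg_nonneg bernstein_nonneg sobolev_norm_nonneg) simp
      have "L2_set d {..J} \<le> L2_set (\<lambda>j. R j N + f j N) {..J}"
        by (intro L2_set_mono dle that d0)
      also have "\<dots> \<le> L2_set (\<lambda>j. R j N) {..J} + L2_set (\<lambda>j. f j N) {..J}"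
        by (rule L2_set_triangle_ineq)
      also have "L2_set (\<lambda>j. R j N) {..J} \<le> (\<Sum>j\<le>J. R j N)"
        by (rule L2_set_le_sum) (rule Rn)
      finally show ?thesis using fJ[of N J] by linarith
    qed
    then show "\<exists>N0. \<forall>N\<ge>N0. L2_set d {..J} \<le> (\<Sum>j\<le>J. R j N) + block_const * schur_const * E" by blast
  qed
  have "(\<Sum>j\<le>J. (d j)\<^sup>2) \<le> (block_const * schur_const * E)\<^sup>2" for J
    using power_mono[OF dJ[of J], of 2] by (simp add: L2_set_def sum_nonneg)
  with d show ?thesis by (rule that)
qed

lemma tail_estimate:
  assumes v: "v \<in> B" and B: "\<And>k. n \<le> k \<Longrightarrow> lowpass k v \<in> B"
    and E: "0 \<le> E" "\<And>N. L2_set (envelope v) {n<..N} \<le> E"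
  shows "Lmu_le s (\<lambda>t. \<Phi> v t - \<Phi> (lowpass n v) t) (sqrt 2 * (block_const * schur_const * E))"
proof -
  obtain d where d: "\<And>j. Lmu_le s (\<lambda>t. LP_block \<psi> j (\<Phi> v t - \<Phi> (lowpass n v) t)) (d j)"
    "\<And>J. (\<Sum>j\<le>J. (d j)\<^sup>2) \<le> (block_const * schur_const * E)\<^sup>2"
    using tail_blocks[OF v B E] by blast
  have "bochner_measurable M s0 (\<lambda>t. \<Phi> v t - \<Phi> (lowpass n v) t)"
    by (rule Lmu_le_bochner[OF Phi_diff[OF v B[OF order_refl]]])
  then show ?thesis
    using block_const schur_const E(1) d by (intro Lmu_le_of_blocks) (auto intro!: mult_nonneg_nonneg)
qed

text \<open>
  Truncation is a contraction, so the truncations of all \<open>w\<close> close to \<open>v\<close> enter the open ball at the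
  same index. This uniformity is needed for continuity.
\<close>

lemma lowpass_near_ball:
  assumes v: "v \<in> B"
  shows "\<exists>n. \<forall>k\<ge>n. \<forall>w\<in>sobolev s. sobolev_norm s (w - v) < (r - sobolev_norm s (v - u0)) / 2 \<longrightarrow> lowpass k w \<in> B"
proof -
  have vs: "v \<in> sobolev s" by (rule ball_sobolev[OF v])
  define \<rho> where "\<rho> = r - sobolev_norm s (v - u0)"
  have \<rho>: "0 < \<rho>" using v by (simp add: \<rho>_def sobolev_ball_def)
  have "\<forall>\<^sub>F k in sequentially. sobolev_norm s (lowpass k v - v) < \<rho> / 2"
    using lowpass_tendsto[OF vs] by (rule order_tendstoD) (use \<rho> in simp)
  then obtain n where n: "\<And>k. n \<le> k \<Longrightarrow> sobolev_norm s (lowpass k v - v) < \<rho> / 2"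
    unfolding eventually_sequentially by blast
  have "lowpass k w \<in> B" if k: "n \<le> k" and w: "w \<in> sobolev s" "sobolev_norm s (w - v) < \<rho> / 2" for k w
  proof -
    have l: "lowpass k w \<in> sobolev s" "lowpass k v \<in> sobolev s" using lowpass_le(1) w vs by auto
    have "sobolev_norm s (lowpass k w - u0) \<le> sobolev_norm s (lowpass k w - lowpass k v) + sobolev_norm s (lowpass k v - u0)"
      by (rule sobolev_norm_triangle[OF l u0])
    also have "sobolev_norm s (lowpass k v - u0) \<le> sobolev_norm s (lowpass k v - v) + sobolev_norm s (v - u0)"
      by (rule sobolev_norm_triangle[OF l(2) vs u0])
    also have "sobolev_norm s (lowpass k w - lowpass k v) \<le> sobolev_norm s (w - v)"
      unfolding lowpass_diff[symmetric] by (rule lowpass_contraction(2)[OF sobolev_diff(1)[OF w(1) vs]])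
    finally show ?thesis using n[OF k] w(2) l(1) by (simp add: sobolev_ball_def \<rho>_def)
  qed
  then show ?thesis unfolding \<rho>_def by blast
qed

lemma lowpass_in_ball:
  assumes v: "v \<in> B"
  shows "\<exists>n. \<forall>k\<ge>n. lowpass k v \<in> B"
proof -
  have vs: "v \<in> sobolev s" by (rule ball_sobolev[OF v])
  have "sobolev_norm s (v - v) < (r - sobolev_norm s (v - u0)) / 2"
    unfolding sobolev_norm_self_diff[OF vs] using v by (simp add: sobolev_ball_def)
  then show ?thesis using lowpass_near_ball[OF v] vs by blast
qed

text \<open>
  The blocks of \<open>\<Phi> (S\<^sub>n v)\<close> decay geometrically because it is bounded at the higher level \<open>s1\<close>; those
  of the difference to \<open>\<Phi> v\<close> are square-summable by \<open>tail_blocks\<close>.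
\<close>

lemma Phi_square_summable_blocks:
  assumes v: "v \<in> B"
  shows "\<Phi> v \<in> Lmu_sobolev \<mu> T s"
    and "(\<lambda>t. LP_block \<psi> j (\<Phi> v t)) \<in> Lmu_sobolev \<mu> T s"
    and "summable (\<lambda>j. (Lmu_sobolev_norm \<mu> T s (\<lambda>t. LP_block \<psi> j (\<Phi> v t)))\<^sup>2)"
proof -
  have vs: "v \<in> sobolev s" by (rule ball_sobolev[OF v])
  obtain n where n: "\<And>k. n \<le> k \<Longrightarrow> lowpass k v \<in> B"
    using lowpass_in_ball[OF v] by blast
  define E where "E = schur_const * sobolev_norm s v"
  have E: "0 \<le> E" "\<And>N. L2_set (envelope v) {n<..N} \<le> E"
    using schur_const L2_envelope[OF vs] by (auto simp: E_def sobolev_norm_nonneg)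
  obtain A where A: "Lmu_le s1 (\<Phi> (lowpass n v)) A"
    using Phi_lowpass[OF vs n[OF order_refl]] by blast
  have A0: "0 \<le> A" by (rule Lmu_le_nonneg[OF A])
  have As: "Lmu_le s (\<Phi> (lowpass n v)) A" using s by (intro Lmu_le_lower[OF A]) simp
  show "\<Phi> v \<in> Lmu_sobolev \<mu> T s"
    by (rule Lmu_leD(1)[OF Lmu_le_triangle[OF tail_estimate[OF v n E] As]])
  obtain d where d: "\<And>j. Lmu_le s (\<lambda>t. LP_block \<psi> j (\<Phi> v t - \<Phi> (lowpass n v) t)) (d j)"
    "\<And>J. (\<Sum>j\<le>J. (d j)\<^sup>2) \<le> (block_const * schur_const * E)\<^sup>2"
    using tail_blocks[OF v n E] by blast
  have bl: "Lmu_le s (\<lambda>t. LP_block \<psi> j (\<Phi> v t)) (d j + bernstein j (s - s1) * A)" for j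
  proof (rule Lmu_le_triangle)
    show "Lmu_le s (\<lambda>t. LP_block \<psi> j (\<Phi> v t) - LP_block \<psi> j (\<Phi> (lowpass n v) t)) (d j)"
      using d(1)[of j] by (simp add: LP_block_diff)
  qed (rule Lmu_le_block[OF A])
  show "(\<lambda>t. LP_block \<psi> j (\<Phi> v t)) \<in> Lmu_sobolev \<mu> T s" by (rule Lmu_leD(1)[OF bl])
  have sd: "summable (\<lambda>j. (d j)\<^sup>2)"
  proof (rule bounded_imp_summable)
    show "(\<Sum>j\<le>J. (d j)\<^sup>2) \<le> (block_const * schur_const * E)\<^sup>2" for J by (rule d(2))
  qed simp
  have sb: "summable (\<lambda>j. (bernstein j (s - s1) * A)\<^sup>2)"
  proof -
    define q where "q = (2 powr (s - s1))\<^sup>2"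
    have "2 powr (s - s1) < 2 powr 0" using s by (intro powr_less_mono) auto
    then have "(2 powr (s - s1))\<^sup>2 < 1" by (simp add: power_less_one_iff abs_square_less_1)
    then have q: "0 \<le> q" "q < 1" by (auto simp: q_def)
    have "(bernstein j (s - s1) * A)\<^sup>2 = (8 powr \<bar>s - s1\<bar> * A)\<^sup>2 * q ^ j" for j
    proof -
      have "2 powr (real j * (s - s1)) = (2 powr (s - s1)) ^ j"
        by (simp add: powr_realpow[symmetric] powr_powr mult.commute)
      then show ?thesis by (simp add: bernstein_def q_def power_mult_distrib power_mult[symmetric] mult.commute)
    qed
    then show ?thesis using q by (simp add: summable_mult summable_geometric)
  qed
  show "summable (\<lambda>j. (Lmu_sobolev_norm \<mu> T s (\<lambda>t. LP_block \<psi> j (\<Phi> v t)))\<^sup>2)"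
  proof (rule summable_comparison_test')
    show "summable (\<lambda>j. 2 * (d j)\<^sup>2 + 2 * (bernstein j (s - s1) * A)\<^sup>2)"
      by (intro summable_add summable_mult sd sb)
    fix j :: nat
    let ?N = "Lmu_sobolev_norm \<mu> T s (\<lambda>t. LP_block \<psi> j (\<Phi> v t))"
    have N0: "0 \<le> ?N" by (rule Lmu_le_nonneg[OF Lmu_leI_norm[OF Lmu_leD(1)[OF bl]]])
    have "?N\<^sup>2 \<le> (d j + bernstein j (s - s1) * A)\<^sup>2"
      by (intro power_mono Lmu_leD(2)[OF bl] N0)
    also have "\<dots> \<le> 2 * (d j)\<^sup>2 + 2 * (bernstein j (s - s1) * A)\<^sup>2"
      using sum_squares_bound[of "d j" "bernstein j (s - s1) * A"] by (simp add: power2_sum)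
    finally show "norm (?N\<^sup>2) \<le> 2 * (d j)\<^sup>2 + 2 * (bernstein j (s - s1) * A)\<^sup>2" by simp
  qed
qed

lemma Lmu_le_interpolate:
  assumes F0: "Lmu_le s0 F A0" and F1: "Lmu_le s1 F A1" and \<eta>: "0 \<le> \<eta>" "0 \<le> c"
    and ineq: "\<And>u :: 'a tempered_distribution. u \<in> sobolev s1 \<Longrightarrow> sobolev_norm s u \<le> \<eta> * sobolev_norm s1 u + c * sobolev_norm s0 u"
  shows "Lmu_le s F (\<eta> * A1 + c * A0)"
proof (rule Lmu_le_by_norm)
  show "bochner_measurable M s F" using s by (intro bochner_measurable_mono[OF Lmu_le_bochner[OF F1]]) simp
  show "Lp_le M \<mu> (\<lambda>t. \<eta> * sobolev_norm s1 (F t) + c * sobolev_norm s0 (F t)) (\<eta> * A1 + c * A0)"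
    using Lp_le_cmult[of M \<mu> "\<lambda>t. sobolev_norm s1 (F t)" A1 \<eta>] Lp_le_cmult[of M \<mu> "\<lambda>t. sobolev_norm s0 (F t)" A0 c]
      F0 F1 \<eta> by (intro Lp_le_add \<mu>1) (auto simp: Lmu_le_def)
  show "AE t in M. sobolev_norm s (F t) \<le> \<eta> * sobolev_norm s1 (F t) + c * sobolev_norm s0 (F t)"
    using bochner_measurable_AE[OF Lmu_le_bochner[OF F1]] by eventually_elim (rule ineq)
qed

lemma envelope_tail:
  assumes v: "v \<in> sobolev s" and \<eta>: "0 < \<eta>"
  obtains n where "\<And>m N. n \<le> m \<Longrightarrow> L2_set (envelope v) {m<..N} \<le> \<eta>"
proof -
  have "(\<Sum>j\<le>J. (envelope v j)\<^sup>2) \<le> (schur_const * sobolev_norm s v)\<^sup>2" for J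
    using power_mono[OF L2_envelope[OF v, of "{..J}"], of 2] by (simp add: L2_set_def sum_nonneg)
  then have "summable (\<lambda>j. (envelope v j)\<^sup>2)"
    by (intro bounded_imp_summable) auto
  then obtain n where n: "\<And>m N. n \<le> m \<Longrightarrow> norm (\<Sum>j\<in>{m..<N}. (envelope v j)\<^sup>2) < \<eta>\<^sup>2"
    unfolding summable_Cauchy using \<eta> by (meson zero_less_power)
  have "L2_set (envelope v) {m<..N} \<le> \<eta>" if "n \<le> m" for m N
  proof -
    have "{m<..N} = {Suc m..<Suc N}" by auto
    then have "(\<Sum>j\<in>{m<..N}. (envelope v j)\<^sup>2) \<le> \<eta>\<^sup>2"
      using n[of "Suc m" "Suc N"] that by (simp add: sum_nonneg)
    then show ?thesis unfolding L2_set_def using \<eta> by (intro real_le_lsqrt) auto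
  qed
  then show ?thesis by (rule that)
qed

text \<open>
  The index \<open>n\<close> is chosen first, from the tail of the envelope of \<open>v\<close>; it also fixes the bound \<open>A\<close> of
  the truncated difference at level \<open>s1\<close>, and then the constant of the interpolation inequality.
  Only then is \<open>\<delta>\<close> chosen.
\<close>

lemma Phi_continuous:
  assumes v: "v \<in> B" and \<epsilon>: "0 < \<epsilon>"
  shows "\<exists>\<delta>>0. \<forall>w\<in>B. sobolev_norm s (w - v) < \<delta> \<longrightarrow> Lmu_sobolev_norm \<mu> T s (\<lambda>t. \<Phi> w t - \<Phi> v t) < \<epsilon>"
proof -
  have vs: "v \<in> sobolev s" by (rule ball_sobolev[OF v])
  define K where "K = sqrt 2 * (block_const * schur_const)"
  have K: "0 \<le> K" using block_const schur_const by (simp add: K_def)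
  \<comment> \<open>The three pieces contribute \<open>2 K \<eta>\<close>, \<open>2 \<eta>\<close> and \<open>K \<eta>\<close>.\<close>
  define \<eta> where "\<eta> = \<epsilon> / (3 * K + 3)"
  have \<eta>: "0 < \<eta>" using \<epsilon> K by (simp add: \<eta>_def)
  obtain n1 where n1: "\<forall>k\<ge>n1. \<forall>w\<in>sobolev s. sobolev_norm s (w - v) < (r - sobolev_norm s (v - u0)) / 2 \<longrightarrow> lowpass k w \<in> B"
    using lowpass_near_ball[OF v] by blast
  obtain n2 where n2: "\<And>m N. n2 \<le> m \<Longrightarrow> L2_set (envelope v) {m<..N} \<le> \<eta>"
    using envelope_tail[OF vs \<eta>] by blast
  define n where "n = max n1 n2"
  define L where "L = (1 + 4 ^ n) powr \<bar>s1 - s\<bar>"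
  have L: "0 \<le> L" by (simp add: L_def)
  define A where "A = C1 * (L * (sobolev_norm s v + 1)) + C1 * (L * sobolev_norm s v)"
  have A: "0 \<le> A" using C L sobolev_norm_nonneg[of s v] by (simp add: A_def)
  obtain c where c: "0 \<le> c"
    "\<And>u :: 'a tempered_distribution. u \<in> sobolev s1 \<Longrightarrow> sobolev_norm s u \<le> \<eta> / (A + 1) * sobolev_norm s1 u + c * sobolev_norm s0 u"
    using sobolev_interpolation[OF s, of "\<eta> / (A + 1)"] \<eta> A by auto
  \<comment> \<open>In order: \<open>w\<close> stays bounded, its truncations stay in the ball, its envelope has a small tail, the weak difference is small.\<close>
  define \<delta> where "\<delta> = Min {1, (r - sobolev_norm s (v - u0)) / 2, \<eta> / schur_const, \<eta> / (c * C0 + 1)}"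
  have \<delta>: "0 < \<delta>" using v \<eta> schur_const c(1) C by (auto simp: \<delta>_def sobolev_ball_def add_nonneg_pos)
  have "Lmu_sobolev_norm \<mu> T s (\<lambda>t. \<Phi> w t - \<Phi> v t) < \<epsilon>" if w: "w \<in> B" and wv: "sobolev_norm s (w - v) < \<delta>" for w
  proof -
    have ws: "w \<in> sobolev s" by (rule ball_sobolev[OF w])
    have wvs: "w - v \<in> sobolev s" by (rule sobolev_diff(1)[OF ws vs])
    have wv1: "sobolev_norm s (w - v) \<le> 1" and wv2: "sobolev_norm s (w - v) < (r - sobolev_norm s (v - u0)) / 2"
      and wv3: "sobolev_norm s (w - v) \<le> \<eta> / schur_const" and wv4: "sobolev_norm s (w - v) \<le> \<eta> / (c * C0 + 1)"
      using wv by (auto simp: \<delta>_def)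
    have self: "sobolev_norm s (v - v) < (r - sobolev_norm s (v - u0)) / 2"
      unfolding sobolev_norm_self_diff[OF vs] using v by (simp add: sobolev_ball_def)
    have Bv: "lowpass k v \<in> B" and Bw: "lowpass k w \<in> B" if "n \<le> k" for k
    proof -
      have "n1 \<le> k" using that by (simp add: n_def)
      then show "lowpass k v \<in> B" "lowpass k w \<in> B" using n1 vs ws self wv2 by blast+
    qed
    have tv: "Lmu_le s (\<lambda>t. \<Phi> v t - \<Phi> (lowpass n v) t) (K * \<eta>)"
      using tail_estimate[OF v Bv less_imp_le[OF \<eta>] n2[of n]] by (simp add: K_def n_def mult.assoc)
    have tw: "Lmu_le s (\<lambda>t. \<Phi> w t - \<Phi> (lowpass n w) t) (K * (2 * \<eta>))"
    proof -
      have "L2_set (envelope w) {n<..N} \<le> 2 * \<eta>" for N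
      proof -
        have "L2_set (envelope w) {n<..N} \<le> L2_set (\<lambda>m. envelope v m + envelope (w - v) m) {n<..N}"
          by (intro L2_set_mono envelope_triangle vs ws envelope_nonneg)
        also have "\<dots> \<le> L2_set (envelope v) {n<..N} + L2_set (envelope (w - v)) {n<..N}"
          by (rule L2_set_triangle_ineq)
        also have "L2_set (envelope v) {n<..N} \<le> \<eta>" by (rule n2) (simp add: n_def)
        also have "L2_set (envelope (w - v)) {n<..N} \<le> schur_const * sobolev_norm s (w - v)"
          by (rule L2_envelope[OF wvs]) simp
        also have "schur_const * sobolev_norm s (w - v) \<le> \<eta>"
          using wv3 schur_const by (simp add: field_simps)
        finally show ?thesis by simp
      qed
      from tail_estimate[OF w Bw _ this] \<eta> show ?thesis by (simp add: K_def mult.assoc)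
    qed
    have mid: "Lmu_le s (\<lambda>t. \<Phi> (lowpass n w) t - \<Phi> (lowpass n v) t) (2 * \<eta>)"
    proof -
      have Bn: "lowpass n w \<in> B" "lowpass n v \<in> B" using Bw Bv by auto
      have "Lmu_le s0 (\<lambda>t. \<Phi> (lowpass n w) t - \<Phi> (lowpass n v) t) (C0 * sobolev_norm s0 (lowpass n w - lowpass n v))"
        by (rule Phi_diff[OF Bn])
      moreover have "sobolev_norm s0 (lowpass n w - lowpass n v) \<le> sobolev_norm s (w - v)"
      proof -
        have "sobolev_norm s0 (lowpass n (w - v)) \<le> sobolev_norm s (lowpass n (w - v))"
          using s by (intro sobolev_mono(2)[OF lowpass_le(1)[OF wvs]]) simp
        also have "\<dots> \<le> sobolev_norm s (w - v)" by (rule lowpass_contraction(2)[OF wvs])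
        finally show ?thesis by (simp add: lowpass_diff)
      qed
      ultimately have 0: "Lmu_le s0 (\<lambda>t. \<Phi> (lowpass n w) t - \<Phi> (lowpass n v) t) (C0 * sobolev_norm s (w - v))"
        using C by (auto intro: Lmu_le_mono)
      have nw: "sobolev_norm s w \<le> sobolev_norm s v + 1"
        using sobolev_norm_abs_diff[OF ws vs] wv1 by linarith
      have "Lmu_le s1 (\<lambda>t. \<Phi> (lowpass n w) t - \<Phi> (lowpass n v) t) (C1 * sobolev_norm s1 (lowpass n w) + C1 * sobolev_norm s1 (lowpass n v))"
        by (intro Lmu_le_diff Phi_lowpass ws vs Bn)
      moreover have "C1 * sobolev_norm s1 (lowpass n w) + C1 * sobolev_norm s1 (lowpass n v) \<le> A"
        unfolding A_def
      proof (intro add_mono mult_left_mono)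
        show "sobolev_norm s1 (lowpass n w) \<le> L * (sobolev_norm s v + 1)"
          using lowpass_le(2)[OF ws, of s1 n] mult_left_mono[OF nw L] by (simp add: L_def)
        show "sobolev_norm s1 (lowpass n v) \<le> L * sobolev_norm s v"
          using lowpass_le(2)[OF vs, of s1 n] by (simp add: L_def)
      qed (use C in auto)
      ultimately have 1: "Lmu_le s1 (\<lambda>t. \<Phi> (lowpass n w) t - \<Phi> (lowpass n v) t) A"
        by (rule Lmu_le_mono)
      have "Lmu_le s (\<lambda>t. \<Phi> (lowpass n w) t - \<Phi> (lowpass n v) t) (\<eta> / (A + 1) * A + c * (C0 * sobolev_norm s (w - v)))"
        using \<eta> A by (intro Lmu_le_interpolate[OF 0 1 _ c]) auto
      then show ?thesis
      proof (rule Lmu_le_mono)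
        have "\<eta> / (A + 1) * A \<le> \<eta>" using \<eta> A by (simp add: field_simps)
        moreover have "c * (C0 * sobolev_norm s (w - v)) \<le> \<eta>"
        proof -
          have cC: "0 \<le> c * C0" using c(1) C by simp
          have "c * (C0 * sobolev_norm s (w - v)) \<le> (c * C0) * (\<eta> / (c * C0 + 1))"
            unfolding mult.assoc[symmetric] by (rule mult_left_mono[OF wv4 cC])
          also have "\<dots> \<le> \<eta>" using cC \<eta> by (simp add: field_simps)
          finally show ?thesis .
        qed
        ultimately show "\<eta> / (A + 1) * A + c * (C0 * sobolev_norm s (w - v)) \<le> 2 * \<eta>" by linarith
      qed
    qed
    have "Lmu_le s (\<lambda>t. (\<Phi> w t - \<Phi> (lowpass n w) t) + (\<Phi> (lowpass n w) t - \<Phi> (lowpass n v) t) - (\<Phi> v t - \<Phi> (lowpass n v) t)) (K * (2 * \<eta>) + 2 * \<eta> + K * \<eta>)"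
      by (intro Lmu_le_diff Lmu_le_add tw mid tv)
    then have "Lmu_le s (\<lambda>t. \<Phi> w t - \<Phi> v t) (K * (2 * \<eta>) + 2 * \<eta> + K * \<eta>)" by simp
    then have "Lmu_sobolev_norm \<mu> T s (\<lambda>t. \<Phi> w t - \<Phi> v t) \<le> K * (2 * \<eta>) + 2 * \<eta> + K * \<eta>"
      by (rule Lmu_leD(2))
    also have "\<dots> < (3 * K + 3) * \<eta>" using \<eta> by (simp add: algebra_simps)
    also have "\<dots> = \<epsilon>" using K by (simp add: \<eta>_def)
    finally show ?thesis .
  qed
  with \<delta> show ?thesis by blast
qed

lemma Phi_continuous_in_time:
  assumes "\<mu> = \<infinity>" "v \<in> B" "\<Phi> v \<in> C0_sobolev T \<sigma>"
  shows "\<Phi> v \<in> C0_sobolev T s"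
  by (rule C0_sobolev_of_blocks[OF assms(1,3) Lmu_leI_norm[OF Phi_square_summable_blocks(2)[OF assms(2)]] Phi_square_summable_blocks(3)[OF assms(2)]])

end

theorem theorem1:
  fixes T s0 s s1 r :: real
    and \<mu> :: ennreal
    and \<psi> :: "real ^ 'n \<Rightarrow> real"
    and u0 :: "(real ^ 'n) tempered_distribution"
    and \<Phi> :: "(real ^ 'n) tempered_distribution \<Rightarrow> real \<Rightarrow> (real ^ 'n) tempered_distribution"
  assumes "LP_cutoff \<psi>"
    and "T > 0" and "\<mu> \<ge> 2" and "s0 < s" and "s < s1" and "r > 0"
    and "u0 \<in> sobolev s"
    and maps: "\<forall>v0 \<in> sobolev_ball s u0 r. \<Phi> v0 \<in> Lmu_sobolev \<mu> T s0"
    and H1: "\<exists>C0>0. \<forall>v0 \<in> sobolev_ball s u0 r. \<forall>w0 \<in> sobolev_ball s u0 r.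
               Lmu_sobolev_norm \<mu> T s0 (\<lambda>t. \<Phi> v0 t - \<Phi> w0 t) \<le> C0 * sobolev_norm s0 (v0 - w0)"
    and H2: "\<exists>C1>0. \<forall>v0 \<in> (\<Inter>\<sigma>. sobolev \<sigma>) \<inter> sobolev_ball s u0 r.
               \<Phi> v0 \<in> Lmu_sobolev \<mu> T s1 \<and>
               Lmu_sobolev_norm \<mu> T s1 (\<Phi> v0) \<le> C1 * sobolev_norm s1 v0"
  shows
    "((\<forall>v0 \<in> sobolev_ball s u0 r. \<Phi> v0 \<in> Lmu_sobolev \<mu> T s) \<and>
      (\<forall>v0 \<in> sobolev_ball s u0 r. \<forall>\<epsilon>>0. \<exists>\<delta>>0. \<forall>w0 \<in> sobolev_ball s u0 r.
         sobolev_norm s (w0 - v0) < \<delta> \<longrightarrow>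
         Lmu_sobolev_norm \<mu> T s (\<lambda>t. \<Phi> w0 t - \<Phi> v0 t) < \<epsilon>)) \<and>
     (\<forall>v0 \<in> sobolev_ball s u0 r.
         (\<forall>j. (\<lambda>t. LP_block \<psi> j (\<Phi> v0 t)) \<in> Lmu_sobolev \<mu> T s) \<and>
         summable (\<lambda>j. (Lmu_sobolev_norm \<mu> T s (\<lambda>t. LP_block \<psi> j (\<Phi> v0 t)))\<^sup>2)) \<and>
     (\<mu> = \<infinity> \<longrightarrow>
       (\<forall>v0 \<in> sobolev_ball s u0 r.
          \<Phi> v0 \<in> (\<Union>\<sigma>. C0_sobolev T \<sigma>) \<longrightarrow> \<Phi> v0 \<in> C0_sobolev T s))"
proof -
  obtain C0 where C0: "0 < C0" "\<And>v w. v \<in> sobolev_ball s u0 r \<Longrightarrow> w \<in> sobolev_ball s u0 r \<Longrightarrow>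
      Lmu_sobolev_norm \<mu> T s0 (\<lambda>t. \<Phi> v t - \<Phi> w t) \<le> C0 * sobolev_norm s0 (v - w)"
    using H1 by blast
  obtain C1 where C1: "0 < C1" "\<And>v. v \<in> (\<Inter>\<sigma>. sobolev \<sigma>) \<inter> sobolev_ball s u0 r \<Longrightarrow>
      \<Phi> v \<in> Lmu_sobolev \<mu> T s1 \<and> Lmu_sobolev_norm \<mu> T s1 (\<Phi> v) \<le> C1 * sobolev_norm s1 v"
    using H2 by blast
  interpret tame_map \<psi> T \<mu> s0 s s1 r C0 C1 u0 \<Phi>
  proof
    show "\<Phi> v \<in> Lmu_sobolev \<mu> T s1 \<and> Lmu_sobolev_norm \<mu> T s1 (\<Phi> v) \<le> C1 * sobolev_norm s1 v"
      if "\<And>\<sigma>. v \<in> sobolev \<sigma>" "v \<in> sobolev_ball s u0 r" for v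
      using that by (intro C1(2)) blast
  qed (use assms C0 C1(1) in auto)
  show ?thesis
  proof (intro conjI ballI allI impI)
    fix v0 assume v0: "v0 \<in> sobolev_ball s u0 r"
    show "\<Phi> v0 \<in> Lmu_sobolev \<mu> T s"
      and "\<And>j. (\<lambda>t. LP_block \<psi> j (\<Phi> v0 t)) \<in> Lmu_sobolev \<mu> T s"
      and "summable (\<lambda>j. (Lmu_sobolev_norm \<mu> T s (\<lambda>t. LP_block \<psi> j (\<Phi> v0 t)))\<^sup>2)"
      by (rule Phi_square_summable_blocks[OF v0])+
    show "\<exists>\<delta>>0. \<forall>w0 \<in> sobolev_ball s u0 r. sobolev_norm s (w0 - v0) < \<delta> \<longrightarrow>
      Lmu_sobolev_norm \<mu> T s (\<lambda>t. \<Phi> w0 t - \<Phi> v0 t) < \<epsilon>" if "0 < \<epsilon>" for \<epsilon>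
      by (rule Phi_continuous[OF v0 that])
    assume "\<mu> = \<infinity>" "\<Phi> v0 \<in> (\<Union>\<sigma>. C0_sobolev T \<sigma>)"
    then show "\<Phi> v0 \<in> C0_sobolev T s"
      using Phi_continuous_in_time v0 by blast
  qed
qed

end
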